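(* Let $p$ be a prime number. The $p$-adic Hahn series $\mathfrak{A} = \sum_{k=1}^\infty p^{-1/p^k} \in W(\overline{\mathbf{F}}_p)((p^{\mathbf{Q}}))$ lies in $\mathbf{C}_p$.
   Context: Let $W(\overline{\mathbf{F}}_p)$ be the ring of Witt vectors of $\overline{\mathbf{F}}_p$ and $[\cdot]:\overline{\mathbf{F}}_p\to W(\overline{\mathbf{F}}_p)$ the Teichmüller lift. Let $W(\overline{\mathbf{F}}_p)((t^{\mathbf{Q}}))$ be the ring of Hahn series, i.e. formal sums $\sum_{q\in\mathbf{Q}} r_q t^q$ with $r_q\in W(\overline{\mathbf{F}}_p)$ whose support $\{q : r_q\neq 0\}$ is a well-ordered subset of $\mathbf{Q}$, with the usual termwise addition and convolution product. Let $\mathcal{N}$ be the maximal ideal of those $\sum_q r_q t^q$ such that $\sum_{n\in\mathbf{Z}} r_{q+n}p^n=0$ for every $q\in\mathbf{Q}$. The field of $p$-adic Hahn series is $W(\overline{\mathbf{F}}_p)((p^{\mathbf{Q}})) := W(\overline{\mathbf{F}}_p)((t^{\mathbf{Q}}))/\mathcal{N}$; the image of $\sum_q r_q t^q$ is written $\sum_q r_q p^q$ (so the image of $t$ is $p$). Every element has a unique standard expansion $\sum_{q\in\mathbf{Q}}[r_q]p^q$ with $r_q\in\overline{\mathbf{F}}_p$ and with well-ordered support $\{q : r_q\ne 0\}$; the valuation of a nonzero element is the minimum of this support. This valued field contains $\breve{\mathbf{Q}}_p = W(\overline{\mathbf{F}}_p)[p^{-1}]$, hence $\mathbf{Q}_p$,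 and is algebraically closed and complete. $\overline{\mathbf{Q}}_p$ denotes the algebraic closure of $\mathbf{Q}_p$ inside it, and $\mathbf{C}_p$ denotes the completion of $\overline{\mathbf{Q}}_p$, identified with the topological closure of $\overline{\mathbf{Q}}_p$ in $W(\overline{\mathbf{F}}_p)((p^{\mathbf{Q}}))$. The series $\mathfrak{A}$ is the image of the Hahn series $\sum_{k\ge1} t^{-1/p^k}$ (it is not the $p$-adic limit of its partial sums). *)

theory Defs
  imports
    "HOL-Algebra.Algebra"
    "HOL-Algebra.Algebraic_Closure_Type"
    "HOL-Library.Poly_Mapping"
    "Berlekamp_Zassenhaus.Finite_Field"
begin

section \<open>Witt vectors\<close>

text \<open>Polynomials with integer coefficients in variables indexed by \<open>'v\<close>: finitely supported
  families of integers indexed by monomials.\<close>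

type_synonym 'v int_mpoly = "('v \<Rightarrow>\<^sub>0 nat) \<Rightarrow>\<^sub>0 int"

definition mpoly_var :: "'v \<Rightarrow> 'v int_mpoly" where
  "mpoly_var v = Poly_Mapping.single (Poly_Mapping.single v 1) 1"

definition mpoly_eval :: "('v \<Rightarrow> 'a::comm_ring_1) \<Rightarrow> 'v int_mpoly \<Rightarrow> 'a" where
  "mpoly_eval a f = (\<Sum>m\<in>Poly_Mapping.keys f. of_int (Poly_Mapping.lookup f m) *
      (\<Prod>v\<in>Poly_Mapping.keys m. a v ^ Poly_Mapping.lookup m v))"

definition ghost :: "nat \<Rightarrow> (nat \<Rightarrow> 'a::comm_ring_1) \<Rightarrow> nat \<Rightarrow> 'a" where
  "ghost p x n = (\<Sum>i\<le>n. of_nat p ^ i * x i ^ (p ^ (n - i)))"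

text \<open>Witt's theorem: there are unique sequences of integer polynomials in the variables
  \<open>X\<^sub>i\<close> (\<open>Inl i\<close>) and \<open>Y\<^sub>i\<close> (\<open>Inr i\<close>) through which the
  ghost components become additive and multiplicative.\<close>

definition witt_add_poly :: "nat \<Rightarrow> nat \<Rightarrow> (nat + nat) int_mpoly" where
  "witt_add_poly p = (THE S. \<forall>n. ghost p S n =
      ghost p (\<lambda>i. mpoly_var (Inl i)) n + ghost p (\<lambda>i. mpoly_var (Inr i)) n)"

definition witt_mult_poly :: "nat \<Rightarrow> nat \<Rightarrow> (nat + nat) int_mpoly" where
  "witt_mult_poly p = (THE S. \<forall>n. ghost p S n =
      ghost p (\<lambda>i. mpoly_var (Inl i)) n * ghost p (\<lambda>i. mpoly_var (Inr i)) n)"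

type_synonym 'k witt_vec = "nat \<Rightarrow> 'k"

definition teichmuller :: "'k::comm_ring_1 \<Rightarrow> 'k witt_vec" where
  "teichmuller a = (\<lambda>n. if n = 0 then a else 0)"

definition witt_ring :: "nat \<Rightarrow> 'k::comm_ring_1 witt_vec ring" where
  "witt_ring p =
    \<lparr>carrier = UNIV,
     monoid.mult = (\<lambda>a b n. mpoly_eval (case_sum a b) (witt_mult_poly p n)),
     one = teichmuller 1,
     ring.zero = (\<lambda>_. 0),
     add = (\<lambda>a b n. mpoly_eval (case_sum a b) (witt_add_poly p n))\<rparr>"


section \<open>Hahn series with rational exponents\<close>

definition hahn_support :: "('w, 'm) ring_scheme \<Rightarrow> (rat \<Rightarrow> 'w) \<Rightarrow> rat set" where
  "hahn_support R f = {q. f q \<noteq> \<zero>\<^bsub>R\<^esub>}"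

text \<open>As the order on the rationals is linear, well-foundedness of \<open><\<close> on the support says that
  the support is well-ordered; it makes the index sets of the convolution sums finite.\<close>

definition hahn_ring :: "('w, 'm) ring_scheme \<Rightarrow> (rat \<Rightarrow> 'w) ring" where
  "hahn_ring R =
    \<lparr>carrier = {f. range f \<subseteq> carrier R \<and> wfp_on (hahn_support R f) (<)},
     monoid.mult = (\<lambda>f g q. \<Oplus>\<^bsub>R\<^esub>a\<in>{a. a \<in> hahn_support R f \<and> q - a \<in> hahn_support R g}.
        f a \<otimes>\<^bsub>R\<^esub> g (q - a)),
     one = (\<lambda>q. if q = 0 then \<one>\<^bsub>R\<^esub> else \<zero>\<^bsub>R\<^esub>),
     ring.zero = (\<lambda>_. \<zero>\<^bsub>R\<^esub>),
     add = (\<lambda>f g q. f q \<oplus>\<^bsub>R\<^esub> g q)\<rparr>"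


section \<open>The field of p-adic Hahn series\<close>

definition padic_null :: "('w, 'm) ring_scheme \<Rightarrow> nat \<Rightarrow> (nat \<Rightarrow> 'w) \<Rightarrow> bool" where
  "padic_null R p s \<longleftrightarrow>
    (\<forall>N. \<exists>M. \<forall>J\<ge>M. \<exists>w\<in>carrier R. s J = add_pow R (p ^ N) w)"

text \<open>\<open>padic_sum_zero R p c\<close> says that \<open>\<Sum>n\<in>\<int>. c n * p ^ n = 0\<close> in \<open>R[1/p]\<close>. Only finitely
  many negative indices occur, so we multiply by some \<open>p ^ m\<close> clearing the denominators and ask
  that the partial sums tend p-adically to zero in \<open>R\<close>.\<close>

definition padic_sum_zero :: "('w, 'm) ring_scheme \<Rightarrow> nat \<Rightarrow> (int \<Rightarrow> 'w) \<Rightarrow> bool" where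
  "padic_sum_zero R p c \<longleftrightarrow>
    (\<exists>m::nat. (\<forall>n < - int m. c n = \<zero>\<^bsub>R\<^esub>) \<and>
       padic_null R p (\<lambda>J. \<Oplus>\<^bsub>R\<^esub>j\<in>{..<J}. add_pow R (p ^ j) (c (int j - int m))))"

definition hahn_null_ideal :: "nat \<Rightarrow> (rat \<Rightarrow> 'k::comm_ring_1 witt_vec) set" where
  "hahn_null_ideal p = {f \<in> carrier (hahn_ring (witt_ring p)).
     \<forall>q. padic_sum_zero (witt_ring p) p (\<lambda>n. f (q + of_int n))}"

type_synonym 'k padic_hahn = "(rat \<Rightarrow> 'k witt_vec) set"

definition padic_hahn_field :: "nat \<Rightarrow> 'k::comm_ring_1 padic_hahn ring" where
  "padic_hahn_field p = hahn_ring (witt_ring p) Quot hahn_null_ideal p"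

definition to_padic_hahn :: "nat \<Rightarrow> (rat \<Rightarrow> 'k::comm_ring_1 witt_vec) \<Rightarrow> 'k padic_hahn" where
  "to_padic_hahn p f = hahn_null_ideal p +>\<^bsub>hahn_ring (witt_ring p)\<^esub> f"

definition standard_expansion :: "nat \<Rightarrow> 'k::comm_ring_1 padic_hahn \<Rightarrow> rat \<Rightarrow> 'k" where
  "standard_expansion p x = (THE r. wfp_on {q. r q \<noteq> 0} (<) \<and>
     x = to_padic_hahn p (\<lambda>q. teichmuller (r q)))"

text \<open>Only meaningful for nonzero \<open>x\<close>.\<close>

definition padic_hahn_val :: "nat \<Rightarrow> 'k::comm_ring_1 padic_hahn \<Rightarrow> rat" where
  "padic_hahn_val p x = (LEAST q. standard_expansion p x q \<noteq> 0)"

definition padic_hahn_closure ::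
    "nat \<Rightarrow> 'k::comm_ring_1 padic_hahn set \<Rightarrow> 'k padic_hahn set" where
  "padic_hahn_closure p S = {x \<in> carrier (padic_hahn_field p).
     \<forall>c. \<exists>y\<in>S. x = y \<or> c < padic_hahn_val p (x \<ominus>\<^bsub>padic_hahn_field p\<^esub> y)}"


section \<open>The p-adic numbers inside the p-adic Hahn series\<close>

text \<open>The valuation restricts to the p-adic valuation on the prime field \<open>\<rat>\<close>, so the copy of
  \<open>\<rat>\<^sub>p\<close> in the complete field of p-adic Hahn series is the closure of the prime field.\<close>

definition padic_numbers :: "nat \<Rightarrow> 'k::comm_ring_1 padic_hahn set" where
  "padic_numbers p = padic_hahn_closure p (generate_field (padic_hahn_field p) {})"

definition padic_algebraic_closure :: "nat \<Rightarrow> 'k::comm_ring_1 padic_hahn set" where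
  "padic_algebraic_closure p = {x \<in> carrier (padic_hahn_field p).
     (ring.algebraic (padic_hahn_field p) over padic_numbers p) x}"

definition padic_complex :: "nat \<Rightarrow> 'k::comm_ring_1 padic_hahn set" where
  "padic_complex p = padic_hahn_closure p (padic_algebraic_closure p)"

definition frakA :: "nat \<Rightarrow> 'k::comm_ring_1 padic_hahn" where
  "frakA p = to_padic_hahn p (\<lambda>q.
     if \<exists>k\<ge>1. q = - (1 / of_nat p ^ k) then \<one>\<^bsub>witt_ring p\<^esub> else \<zero>\<^bsub>witt_ring p\<^esub>)"

end

theory Submission
  imports Defs
begin

text \<open>
  Over a field of characteristic \<open>p\<close> the series \<open>\<Sum>k\<ge>1. t\<^bsup>-1/p\<^sup>k\<^esup>\<close> is a root of
  \<open>X\<^sup>p - X = 1/t\<close>. In mixed characteristic this equation holds only up to corrections, but the corrections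
  are series of the same kind multiplied by \<open>p\<close>, and the approximation can be improved without end.

  To make this precise, let \<open>\<phi>\<close> be the automorphism \<open>t \<mapsto> t\<^sup>p\<close> of the ring of Hahn series with integer
  coefficients. It lifts the Frobenius map, so that \<open>\<phi> x = x\<^sup>p + p \<delta>(x)\<close> for a unique \<open>\<delta>(x)\<close>
  (\<open>frobenius_lift\<close>). Let \<open>C\<close> be the smallest subring that contains all \<open>t\<^sup>q\<close> and is closed under
  \<open>\<phi>\<^sup>-\<^sup>1\<close> and under solutions \<open>x\<close> of \<open>\<phi> x - x = b\<close> with \<open>b\<close> in \<open>C\<close>
  (\<open>artin_schreier_closure\<close>). The series \<open>A = \<Sum>k\<ge>1. t\<^bsup>-1/p\<^sup>k\<^esup>\<close> lies in \<open>C\<close>, because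
  \<open>\<phi> A = A + 1/t\<close>, and \<open>C\<close> is closed under \<open>\<delta>\<close> (\<open>artin_schreier_closure_delta\<close>).

  Fix \<open>x\<close> in \<open>C\<close>. The support of \<open>\<phi>\<^sup>-\<^sup>n x\<close> is bounded below by a number that tends to zero as
  \<open>n\<close> grows. For every \<open>c\<close> and all large \<open>n\<close>, the image of \<open>\<phi>\<^sup>-\<^sup>n x\<close> in the field of
  \<open>p\<close>-adic Hahn series lies within valuation \<open>c\<close> of an algebraic element:

  \<^item> For \<open>c < 1\<close> (\<open>near_shrink_less_1\<close>) this follows the construction of \<open>C\<close>. In the
    Artin-Schreier step, \<open>y = \<phi>\<^sup>-\<^sup>n x\<close> satisfies \<open>y\<^sup>p - y = \<phi>\<^sup>-\<^sup>n b - p \<delta>(y)\<close>, where the first term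
    on the right is close to an algebraic \<open>g\<close> and the second has valuation at least \<open>c\<close>. The derivative of
    \<open>X\<^sup>p - X\<close> is a unit near \<open>y\<close>, so an exact root of \<open>X\<^sup>p - X - g\<close> lies close to \<open>y\<close>
    (\<open>near_artin_schreier\<close>).
  \<^item> The bound \<open>c\<close> is then raised by one at a time (\<open>near_shrink\<close>): with \<open>z = \<phi>\<^sup>-\<^sup>n\<^sup>-\<^sup>1 x\<close>
    one has \<open>\<phi>\<^sup>-\<^sup>n x = z\<^sup>p + p \<delta>(z)\<close>, and both the \<open>p\<close>-th power and the multiplication by \<open>p\<close>
    improve an approximation.

  As \<open>\<phi>\<^sup>-\<^sup>n A\<close> differs from \<open>A\<close> by finitely many algebraic terms \<open>t\<^bsup>-1/p\<^sup>k\<^esup>\<close>, the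
  series \<open>A\<close> itself is a limit of algebraic elements (\<open>near_root_sum\<close>).

  The remaining work is to know the field of \<open>p\<close>-adic Hahn series well enough. The ideal of null series is
  generated by \<open>p - t\<close>, because a null series can be cancelled by carrying from \<open>t\<^sup>q\<close> to
  \<open>t\<^bsup>q+1\<^esup>\<close>; the same carrying produces the standard expansions, and a geometric series inverts a series
  whose leading coefficient is a Teichmueller representative. The coefficient ring enters only through the properties
  collected in the locale \<open>residue_lift\<close>; for Witt vectors they come from Dwork's congruences for ghost
  components.
\<close>

hide_const (open) Divisibility.prime

section \<open>Well-ordered sets of exponents\<close>

text \<open>Well-orderedness of a subset of a linear order in terms of sequences: this form survives passing to
  subsequences, which is what the results on sums need.\<close>

lemma wfp_on_less_iff_good:
  fixes A :: "'a::linorder set"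
  shows "wfp_on A (<) \<longleftrightarrow> (\<forall>s::nat \<Rightarrow> 'a. range s \<subseteq> A \<longrightarrow> (\<exists>i j. i < j \<and> s i \<le> s j))"
proof
  assume wf: "wfp_on A (<)"
  show "\<forall>s::nat \<Rightarrow> 'a. range s \<subseteq> A \<longrightarrow> (\<exists>i j. i < j \<and> s i \<le> s j)"
  proof (intro allI impI)
    fix s :: "nat \<Rightarrow> 'a"
    assume s: "range s \<subseteq> A"
    have "\<exists>z\<in>range s. \<forall>y. y < z \<longrightarrow> y \<notin> range s"
      using wf[unfolded wfp_on_iff_ex_minimal, rule_format, OF s] by auto
    then obtain i where i: "\<forall>y. y < s i \<longrightarrow> y \<notin> range s"
      by auto
    have "s i \<le> s (Suc i)"
      using i by (meson not_less rangeI)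
    then show "\<exists>i j. i < j \<and> s i \<le> s j"
      by (intro exI[of _ i] exI[of _ "Suc i"]) auto
  qed
next
  assume good: "\<forall>s::nat \<Rightarrow> 'a. range s \<subseteq> A \<longrightarrow> (\<exists>i j. i < j \<and> s i \<le> s j)"
  show "wfp_on A (<)"
  proof (rule ccontr)
    assume "\<not> wfp_on A (<)"
    then obtain B where B: "B \<subseteq> A" "B \<noteq> {}" "\<forall>z\<in>B. \<exists>y\<in>B. y < z"
      unfolding wfp_on_iff_ex_minimal by metis
    have "\<exists>s::nat \<Rightarrow> 'a. \<forall>n. s n \<in> B \<and> s (Suc n) < s n"
    proof (rule dependent_nat_choice)
      show "\<exists>x. x \<in> B" using B(2) by auto
      show "\<exists>y. y \<in> B \<and> y < x" if "x \<in> B" for x n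
        using B(3) that by auto
    qed
    then obtain s :: "nat \<Rightarrow> 'a" where s: "\<And>n. s n \<in> B" "\<And>n. s (Suc n) < s n"
      by auto
    have less: "s j < s i" if "i < j" for i j
      using that
    proof (induction j)
      case (Suc j)
      show ?case
        using s(2)[of j] Suc by (cases "i = j") auto
    qed simp
    have "range s \<subseteq> A"
      using s(1) B(1) by auto
    then obtain i j where "i < j" "s i \<le> s j"
      using good by meson
    with less[of i j] show False
      by simp
  qed
qed

lemma wfp_on_less_nondecreasing_subseq:
  fixes A :: "'a::linorder set"
  assumes "wfp_on A (<)" and s: "range s \<subseteq> A"
  obtains f :: "nat \<Rightarrow> nat" where "strict_mono f" "\<And>i j. i \<le> j \<Longrightarrow> s (f i) \<le> s (f j)"
proof -
  obtain f :: "nat \<Rightarrow> nat" where f: "strict_mono f" "monoseq (\<lambda>n. s (f n))"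
    using seq_monosub by blast
  show thesis
  proof (cases "\<forall>m n. m \<le> n \<longrightarrow> s (f m) \<le> s (f n)")
    case True
    then show ?thesis
      using that f(1) by blast
  next
    case False
    with f(2) have decr: "s (f n) \<le> s (f m)" if "m \<le> n" for m n
      using that unfolding monoseq_def by blast
    have "\<exists>z\<in>range (s \<circ> f). \<forall>y. y < z \<longrightarrow> y \<notin> range (s \<circ> f)"
      using assms(1)[unfolded wfp_on_iff_ex_minimal, rule_format, of "range (s \<circ> f)"] s by auto
    then obtain N where N: "\<And>n. s (f N) \<le> s (f n)"
      by (auto simp: not_less[symmetric])
    have "s (f (N + i)) \<le> s (f (N + j))" for i j
      using decr[of N "N + i"] N[of "N + j"] by simp
    moreover have "strict_mono (\<lambda>n. f (N + n))"
      using f(1) by (auto simp: strict_mono_def)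
    ultimately show ?thesis
      using that[of "\<lambda>n. f (N + n)"] by blast
  qed
qed

text \<open>From a sequence of sums pick a subsequence along which the first summands do not decrease; among the second
  summands of this subsequence there is a pair in the right order.\<close>

lemma wfp_on_less_sumset:
  fixes A B :: "'a::linordered_ab_group_add set"
  assumes "wfp_on A (<)" "wfp_on B (<)"
  shows "wfp_on {a + b | a b. a \<in> A \<and> b \<in> B} (<)"
  unfolding wfp_on_less_iff_good
proof (intro allI impI)
  fix s :: "nat \<Rightarrow> 'a"
  assume "range s \<subseteq> {a + b | a b. a \<in> A \<and> b \<in> B}"
  then have "s n \<in> {a + b | a b. a \<in> A \<and> b \<in> B}" for n
    by (rule subsetD) (rule rangeI)
  then have "\<forall>n. \<exists>a b. s n = a + b \<and> a \<in> A \<and> b \<in> B"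
    by blast
  then obtain a b where ab: "\<And>n. s n = a n + b n" "\<And>n. a n \<in> A" "\<And>n. b n \<in> B"
    by metis
  obtain f :: "nat \<Rightarrow> nat" where f: "strict_mono f" "\<And>i j. i \<le> j \<Longrightarrow> a (f i) \<le> a (f j)"
    using wfp_on_less_nondecreasing_subseq[OF assms(1), of a] ab(2) by blast
  have "range (b \<circ> f) \<subseteq> B"
    using ab(3) by auto
  then obtain i j where ij: "i < j" "(b \<circ> f) i \<le> (b \<circ> f) j"
    using assms(2) unfolding wfp_on_less_iff_good by meson
  have "s (f i) \<le> s (f j)"
    using f(2)[of i j] ij by (auto simp: ab(1) intro: add_mono)
  then show "\<exists>i j. i < j \<and> s i \<le> s j"
    using ij(1) f(1) by (auto simp: strict_mono_def)
qed

lemma wfp_on_less_ex_least: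
  fixes T :: "'a::linorder set"
  assumes "wfp_on T (<)" "S \<subseteq> T" "S \<noteq> {}" shows "\<exists>z\<in>S. \<forall>y\<in>S. z \<le> y" 
proof -
  obtain z where "z \<in> S" "\<forall>y. y < z \<longrightarrow> y \<notin> S"
    using assms unfolding wfp_on_iff_ex_minimal by meson
  then have "\<forall>y\<in>S. z \<le> y" by (auto simp: not_less[symmetric])
  then show ?thesis using \<open>z \<in> S\<close> by auto
qed

lemma wfp_on_less_Un:
  fixes A B :: "'a::linorder set"
  assumes "wfp_on A (<)" "wfp_on B (<)"
  shows "wfp_on (A \<union> B) (<)"
  unfolding wfp_on_iff_ex_minimal
proof (intro allI impI)
  fix C assume C: "C \<subseteq> A \<union> B" "C \<noteq> {}"
  have "\<exists>z\<in>C. \<forall>y\<in>C. z \<le> y"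
  proof (cases "C \<inter> A = {} \<or> C \<inter> B = {}")
    case True
    then have "C \<subseteq> A \<or> C \<subseteq> B"
      using C(1) by auto
    then show ?thesis
      using wfp_on_less_ex_least[OF assms(1) _ C(2)] wfp_on_less_ex_least[OF assms(2) _ C(2)] by auto
  next
    case False
    obtain a where a: "a \<in> C \<inter> A" "\<forall>y\<in>C \<inter> A. a \<le> y"
      using wfp_on_less_ex_least[OF assms(1), of "C \<inter> A"] False by auto
    obtain b where b: "b \<in> C \<inter> B" "\<forall>y\<in>C \<inter> B. b \<le> y"
      using wfp_on_less_ex_least[OF assms(2), of "C \<inter> B"] False by auto
    have "min a b \<in> C"
      using a(1) b(1) by (simp add: min_def)
    moreover have "\<forall>y\<in>C. min a b \<le> y"
    proof
      fix y assume "y \<in> C"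
      then have "y \<in> C \<inter> A \<or> y \<in> C \<inter> B" using C(1) by auto
      then show "min a b \<le> y"
        using a(2) b(2) by (auto simp: min_le_iff_disj)
    qed
    ultimately show ?thesis
      by auto
  qed
  then show "\<exists>z\<in>C. \<forall>y. y < z \<longrightarrow> y \<notin> C"
    by (metis leD)
qed
text \<open>Along an infinite sequence of such \<open>a\<close> one can make \<open>a\<close> increase; then \<open>q - a\<close> decreases forever inside
  \<open>B\<close>. This makes the convolution sums finite.\<close>

lemma finite_wfp_on_less_antidiagonal:
  fixes A B :: "'a::linordered_ab_group_add set"
  assumes "wfp_on A (<)" "wfp_on B (<)"
  shows "finite {a. a \<in> A \<and> q - a \<in> B}"
proof (rule ccontr)
  assume inf: "infinite {a. a \<in> A \<and> q - a \<in> B}"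
  then obtain s :: "nat \<Rightarrow> 'a" where s: "inj s" "range s \<subseteq> {a. a \<in> A \<and> q - a \<in> B}"
    by (meson infinite_countable_subset)
  obtain f :: "nat \<Rightarrow> nat" where f: "strict_mono f" "\<And>i j. i \<le> j \<Longrightarrow> s (f i) \<le> s (f j)"
    using wfp_on_less_nondecreasing_subseq[OF assms(1), of s] s(2) by blast
  have "range (\<lambda>n. q - s (f n)) \<subseteq> B"
    using s(2) by auto
  then obtain i j where ij: "i < j" "q - s (f i) \<le> q - s (f j)"
    using assms(2) unfolding wfp_on_less_iff_good by meson
  with f(2)[of i j] have "s (f i) = s (f j)"
    by simp
  then show False
    using s(1) f(1) ij(1) by (metis injD nat_neq_iff strict_monoD)
qed

lemma wfp_on_less_if_initial_segments:
  fixes A :: "rat set"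
  assumes "\<And>c. wfp_on {a \<in> A. a < c} (<)"
  shows "wfp_on A (<)"
  unfolding wfp_on_iff_ex_minimal
proof (intro allI impI)
  fix C assume C: "C \<subseteq> A" "C \<noteq> {}"
  then obtain c where c: "c \<in> C" by auto
  have "{a \<in> C. a < c + 1} \<subseteq> {a \<in> A. a < c + 1}" "{a \<in> C. a < c + 1} \<noteq> {}"
    using C c by auto
  then obtain z where z: "z \<in> C" "z < c + 1" "\<forall>y. y < z \<longrightarrow> y \<notin> {a \<in> C. a < c + 1}"
    using assms[of "c + 1"] unfolding wfp_on_iff_ex_minimal by (smt (verit, ccfv_threshold) mem_Collect_eq)
  then show "\<exists>z\<in>C. \<forall>y. y < z \<longrightarrow> y \<notin> C"
    by (intro bexI[of _ z]) auto
qed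

section \<open>The ring of Hahn series\<close>

typedef (overloaded) 'a::zero hahn = "{f :: rat \<Rightarrow> 'a. wfp_on {q. f q \<noteq> 0} (<)}"
  morphisms hcoeff Abs_hahn
  by (rule exI[of _ "\<lambda>_. 0"]) (simp add: wfp_on_def)

setup_lifting type_definition_hahn

lemma hahn_eqI: "(\<And>q. hcoeff f q = hcoeff g q) \<Longrightarrow> f = g"
  by (simp add: hcoeff_inject[symmetric] fun_eq_iff)

lemma wfp_on_hcoeff: "wfp_on {q. hcoeff f q \<noteq> 0} (<)"
  using hcoeff[of f] by simp

lemma hcoeff_Abs: "wfp_on {q. f q \<noteq> 0} (<) \<Longrightarrow> hcoeff (Abs_hahn f) = f"
  by (simp add: Abs_hahn_inverse)

lemma ex_nonzero_of_sum_nonzero: "(\<Sum>a\<in>A. F a) \<noteq> 0 \<Longrightarrow> \<exists>a\<in>A. F a \<noteq> 0"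
  by (meson sum.neutral)

instantiation hahn :: (comm_ring_1) comm_ring_1
begin

lift_definition zero_hahn :: "'a hahn" is "\<lambda>_. 0" by (simp add: wfp_on_def)

lift_definition one_hahn :: "'a hahn" is "\<lambda>q. if q = 0 then 1 else 0"
  by (rule wfp_on_subset[of "{0}"]) (auto simp: wfp_on_iff_ex_minimal)

lift_definition uminus_hahn :: "'a hahn \<Rightarrow> 'a hahn" is "\<lambda>f q. - f q" by simp

lift_definition plus_hahn :: "'a hahn \<Rightarrow> 'a hahn \<Rightarrow> 'a hahn" is "\<lambda>f g q. f q + g q"
proof -
  fix f g :: "rat \<Rightarrow> 'a"
  assume "wfp_on {q. f q \<noteq> 0} (<)" "wfp_on {q. g q \<noteq> 0} (<)"
  then show "wfp_on {q. f q + g q \<noteq> 0} (<)"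
    by (rule wfp_on_subset[OF wfp_on_less_Un]) auto
qed

lift_definition minus_hahn :: "'a hahn \<Rightarrow> 'a hahn \<Rightarrow> 'a hahn" is "\<lambda>f g q. f q - g q"
proof -
  fix f g :: "rat \<Rightarrow> 'a"
  assume "wfp_on {q. f q \<noteq> 0} (<)" "wfp_on {q. g q \<noteq> 0} (<)"
  then show "wfp_on {q. f q - g q \<noteq> 0} (<)"
    by (rule wfp_on_subset[OF wfp_on_less_Un]) auto
qed

lift_definition times_hahn :: "'a hahn \<Rightarrow> 'a hahn \<Rightarrow> 'a hahn" is
  "\<lambda>f g q. \<Sum>a\<in>{a. f a \<noteq> 0 \<and> g (q - a) \<noteq> 0}. f a * g (q - a)"
proof -
  fix f g :: "rat \<Rightarrow> 'a"
  assume wf: "wfp_on {q. f q \<noteq> 0} (<)" "wfp_on {q. g q \<noteq> 0} (<)"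
  show "wfp_on {q. (\<Sum>a\<in>{a. f a \<noteq> 0 \<and> g (q - a) \<noteq> 0}. f a * g (q - a)) \<noteq> 0} (<)"
  proof (rule wfp_on_subset[OF wfp_on_less_sumset[OF wf]], rule subsetI)
    fix q
    assume "q \<in> {q. (\<Sum>a\<in>{a. f a \<noteq> 0 \<and> g (q - a) \<noteq> 0}. f a * g (q - a)) \<noteq> 0}"
    then obtain a where "f a \<noteq> 0" "g (q - a) \<noteq> 0"
      by (blast dest: ex_nonzero_of_sum_nonzero)
    then show "q \<in> {a + b |a b. a \<in> {q. f q \<noteq> 0} \<and> b \<in> {q. g q \<noteq> 0}}"
      by (intro CollectI exI[of _ a] exI[of _ "q - a"]) auto
  qed
qed

text \<open>Frees the convolution sum from its exact index set, so that several of them can be compared over a common one.\<close>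

lemma hcoeff_times_superset:
  assumes "finite A" "{a. hcoeff f a \<noteq> 0 \<and> hcoeff g (q - a) \<noteq> 0} \<subseteq> A"
  shows "hcoeff (f * g) q = (\<Sum>a\<in>A. hcoeff f a * hcoeff g (q - a))"
  unfolding times_hahn.rep_eq using assms by (intro sum.mono_neutral_left) auto

lemma finite_hahn_antidiagonal: "finite {a. hcoeff f a \<noteq> 0 \<and> hcoeff g (q - a) \<noteq> 0}"
  using finite_wfp_on_less_antidiagonal[OF wfp_on_hcoeff[of f] wfp_on_hcoeff[of g]] by simp

text \<open>Both bracketings of a triple product are sums over this set.\<close>

lemma finite_hahn_triples:
  "finite {(a, b). hcoeff f a \<noteq> 0 \<and> hcoeff g b \<noteq> 0 \<and> hcoeff h (q - a - b) \<noteq> 0}" (is "finite ?T")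
proof -
  let ?S = "{b + c |b c. b \<in> {q. hcoeff g q \<noteq> 0} \<and> c \<in> {q. hcoeff h q \<noteq> 0}}"
  let ?A = "{a. a \<in> {q. hcoeff f q \<noteq> 0} \<and> q - a \<in> ?S}"
  have "finite ?A"
    by (rule finite_wfp_on_less_antidiagonal[OF wfp_on_hcoeff wfp_on_less_sumset[OF wfp_on_hcoeff wfp_on_hcoeff]])
  then have "finite (SIGMA a:?A. {b. hcoeff g b \<noteq> 0 \<and> hcoeff h (q - a - b) \<noteq> 0})"
    using finite_hahn_antidiagonal by (intro finite_SigmaI) auto
  moreover have "?T \<subseteq> (SIGMA a:?A. {b. hcoeff g b \<noteq> 0 \<and> hcoeff h (q - a - b) \<noteq> 0})"
  proof
    fix x assume "x \<in> ?T"
    then obtain a b where "x = (a, b)" "hcoeff f a \<noteq> 0" "hcoeff g b \<noteq> 0" "hcoeff h (q - a - b) \<noteq> 0"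
      by auto
    moreover from this have "q - a \<in> ?S"
      by (intro CollectI exI[of _ b] exI[of _ "q - a - b"]) auto
    ultimately show "x \<in> (SIGMA a:?A. {b. hcoeff g b \<noteq> 0 \<and> hcoeff h (q - a - b) \<noteq> 0})"
      by auto
  qed
  ultimately show ?thesis
    using finite_subset by blast
qed

instance
proof
  fix f g h :: "'a hahn"
  show comm: "f * g = g * f" for f g :: "'a hahn"
  proof (rule hahn_eqI)
    fix q
    show "hcoeff (f * g) q = hcoeff (g * f) q"
      unfolding times_hahn.rep_eq
      by (rule sum.reindex_bij_witness[of _ "\<lambda>a. q - a" "\<lambda>a. q - a"]) (auto simp: mult.commute)
  qed
  show "f * g * h = f * (g * h)"
  proof (rule hahn_eqI)
    fix q
    let ?T = "{(a, b). hcoeff f a \<noteq> 0 \<and> hcoeff g b \<noteq> 0 \<and> hcoeff h (q - a - b) \<noteq> 0}"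
    let ?t = "\<lambda>(a, b). hcoeff f a * hcoeff g b * hcoeff h (q - a - b)"
    have fin: "finite ?T"
      by (rule finite_hahn_triples)
    have "hcoeff (f * (g * h)) q = (\<Sum>a\<in>fst ` ?T. hcoeff f a * hcoeff (g * h) (q - a))"
    proof (rule hcoeff_times_superset)
      show "{a. hcoeff f a \<noteq> 0 \<and> hcoeff (g * h) (q - a) \<noteq> 0} \<subseteq> fst ` ?T"
      proof clarify
        fix a assume a: "hcoeff f a \<noteq> 0" "hcoeff (g * h) (q - a) \<noteq> 0"
        then obtain b where "hcoeff g b \<noteq> 0" "hcoeff h (q - a - b) \<noteq> 0"
          unfolding times_hahn.rep_eq by (blast dest: ex_nonzero_of_sum_nonzero)
        then show "a \<in> fst ` ?T"
          using a(1) by (intro image_eqI[of _ _ "(a, b)"]) auto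
      qed
    qed (use fin in simp)
    also have "\<dots> = (\<Sum>a\<in>fst ` ?T. \<Sum>b\<in>{b. hcoeff g b \<noteq> 0 \<and> hcoeff h (q - a - b) \<noteq> 0}. ?t (a, b))"
      by (simp add: times_hahn.rep_eq sum_distrib_left mult.assoc)
    also have "\<dots> = sum ?t (SIGMA a:fst ` ?T. {b. hcoeff g b \<noteq> 0 \<and> hcoeff h (q - a - b) \<noteq> 0})"
      using fin finite_hahn_antidiagonal by (subst sum.Sigma) auto
    also have "(SIGMA a:fst ` ?T. {b. hcoeff g b \<noteq> 0 \<and> hcoeff h (q - a - b) \<noteq> 0}) = ?T"
      by (auto simp: image_iff) blast+
    finally have right: "hcoeff (f * (g * h)) q = sum ?t ?T" .
    let ?s = "\<lambda>(a, b). a + b"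
    have "hcoeff (f * g * h) q = (\<Sum>c\<in>?s ` ?T. hcoeff (f * g) c * hcoeff h (q - c))"
    proof (rule hcoeff_times_superset)
      show "{c. hcoeff (f * g) c \<noteq> 0 \<and> hcoeff h (q - c) \<noteq> 0} \<subseteq> ?s ` ?T"
      proof clarify
        fix c assume c: "hcoeff (f * g) c \<noteq> 0" "hcoeff h (q - c) \<noteq> 0"
        then obtain a where "hcoeff f a \<noteq> 0" "hcoeff g (c - a) \<noteq> 0"
          unfolding times_hahn.rep_eq by (blast dest: ex_nonzero_of_sum_nonzero)
        then show "c \<in> ?s ` ?T"
          using c(2) by (intro image_eqI[of _ _ "(a, c - a)"]) auto
      qed
    qed (use fin in simp)
    also have "\<dots> = (\<Sum>c\<in>?s ` ?T. \<Sum>a\<in>{a. hcoeff f a \<noteq> 0 \<and> hcoeff g (c - a) \<noteq> 0}. ?t (a, c - a))"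
      by (auto simp: times_hahn.rep_eq sum_distrib_right intro!: sum.cong)
    also have "\<dots> = (\<Sum>(c, a)\<in>(SIGMA c:?s ` ?T. {a. hcoeff f a \<noteq> 0 \<and> hcoeff g (c - a) \<noteq> 0}). ?t (a, c - a))"
      using fin finite_hahn_antidiagonal by (subst sum.Sigma) auto
    also have "\<dots> = sum ?t ?T"
      by (rule sum.reindex_bij_witness[of _ "\<lambda>(a, b). (a + b, a)" "\<lambda>(c, a). (a, c - a)"])
        (auto simp: image_iff algebra_simps)
    finally show "hcoeff (f * g * h) q = hcoeff (f * (g * h)) q"
      using right by simp
  qed
  show "(f + g) * h = f * h + g * h"
  proof (rule hahn_eqI)
    fix q
    let ?A = "{a. hcoeff f a \<noteq> 0 \<and> hcoeff h (q - a) \<noteq> 0} \<union> {a. hcoeff g a \<noteq> 0 \<and> hcoeff h (q - a) \<noteq> 0}"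
    have fin: "finite ?A"
      using finite_hahn_antidiagonal by blast
    show "hcoeff ((f + g) * h) q = hcoeff (f * h + g * h) q"
      unfolding plus_hahn.rep_eq
      by (subst (1 2 3) hcoeff_times_superset[OF fin]) (auto simp: plus_hahn.rep_eq distrib_right sum.distrib)
  qed
  show "1 * f = f"
  proof (rule hahn_eqI)
    fix q
    show "hcoeff (1 * f) q = hcoeff f q"
      by (subst hcoeff_times_superset[of "{0}"]) (auto simp: one_hahn.rep_eq)
  qed
  show "(0::'a hahn) \<noteq> 1"
    by transfer (auto simp: fun_eq_iff)
qed (transfer; auto simp: algebra_simps)+

end

lemma hcoeff_of_nat_mult: "hcoeff (of_nat n * f) q = of_nat n * hcoeff f q"
  by (induction n) (simp_all add: zero_hahn.rep_eq plus_hahn.rep_eq distrib_right)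

lemma hcoeff_sum: "hcoeff (\<Sum>i\<in>I. f i) q = (\<Sum>i\<in>I. hcoeff (f i) q)"
  by (induction I rule: infinite_finite_induct) (simp_all add: zero_hahn.rep_eq plus_hahn.rep_eq)

lemma wfp_on_singleton: "wfp_on {x::rat} (<)"
  by (auto simp: wfp_on_iff_ex_minimal)

lift_definition hmonom :: "rat \<Rightarrow> 'a::comm_ring_1 \<Rightarrow> 'a hahn" is "\<lambda>r c q. if q = r then c else 0"
  by (rule wfp_on_subset[OF wfp_on_singleton]) (auto split: if_splits)

lemma hcoeff_hmonom_mult: "hcoeff (hmonom r c * f) q = c * hcoeff f (q - r)"
  by (subst hcoeff_times_superset[of "{r}"]) (auto simp: hmonom.rep_eq split: if_splits)

lemma hmonom_mult: "hmonom r c * hmonom s d = hmonom (r + s) (c * d)"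
  by (rule hahn_eqI) (auto simp: hcoeff_hmonom_mult hmonom.rep_eq)

lemma hmonom_0_1: "hmonom 0 1 = 1"
  by (rule hahn_eqI) (simp add: hmonom.rep_eq one_hahn.rep_eq)

lemma hmonom_power: "hmonom r c ^ n = hmonom (of_nat n * r) (c ^ n)"
  by (induction n) (simp_all add: hmonom_0_1 hmonom_mult algebra_simps)

subsection \<open>Lower bounds for the support\<close>

text \<open>\<open>hge c f\<close> says that the support of \<open>f\<close> lies in \<open>[c, \<infinity>)\<close>, that is, \<open>f\<close> has \<open>t\<close>-adic valuation at
  least \<open>c\<close>. The zero series satisfies this for every \<open>c\<close>.\<close>

definition hge :: "rat \<Rightarrow> 'a::comm_ring_1 hahn \<Rightarrow> bool" where
  "hge c f \<longleftrightarrow> (\<forall>q<c. hcoeff f q = 0)"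

lemma hge_mono: "hge d f \<Longrightarrow> c \<le> d \<Longrightarrow> hge c f"
  by (auto simp: hge_def)

lemma hge_0 [simp]: "hge c 0"
  by (simp add: hge_def zero_hahn.rep_eq)

lemma hge_add: "hge c f \<Longrightarrow> hge c g \<Longrightarrow> hge c (f + g)"
  by (simp add: hge_def plus_hahn.rep_eq)

lemma hge_diff: "hge c f \<Longrightarrow> hge c g \<Longrightarrow> hge c (f - g)"
  by (simp add: hge_def minus_hahn.rep_eq)

lemma hge_uminus: "hge c f \<Longrightarrow> hge c (- f)"
  by (simp add: hge_def uminus_hahn.rep_eq)

lemma hge_mult:
  assumes "hge c f" "hge d g"
  shows "hge (c + d) (f * g)"
  unfolding hge_def
proof (intro allI impI)
  fix q assume "q < c + d"
  have "hcoeff f a = 0 \<or> hcoeff g (q - a) = 0" for a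
  proof (cases "a < c")
    case False
    then have "q - a < d"
      using \<open>q < c + d\<close> by linarith
    then show ?thesis
      using assms(2) by (simp add: hge_def)
  qed (use assms(1) in \<open>simp add: hge_def\<close>)
  then have "{a. hcoeff f a \<noteq> 0 \<and> hcoeff g (q - a) \<noteq> 0} = {}"
    by simp
  then show "hcoeff (f * g) q = 0"
    unfolding times_hahn.rep_eq by (simp only: sum.empty)
qed

lemma hge_hmonom: "hge r (hmonom r c)"
  by (simp add: hge_def hmonom.rep_eq)

lemma hge_0_1 [simp]: "hge 0 1"
  by (simp add: hge_def one_hahn.rep_eq)

lemma hge_of_nat_mult: "hge c f \<Longrightarrow> hge c (of_nat n * f)"
  by (simp add: hge_def hcoeff_of_nat_mult)

lemma hge_power: "hge c f \<Longrightarrow> hge (of_nat n * c) (f ^ n)"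
proof (induction n)
  case (Suc n)
  then show ?case
    using hge_mult[of c f "of_nat n * c" "f ^ n"] by (simp add: algebra_simps)
qed simp

lemma hge_sum: "(\<And>i. i \<in> I \<Longrightarrow> hge c (f i)) \<Longrightarrow> hge c (\<Sum>i\<in>I. f i)"
  by (simp add: hge_def hcoeff_sum)

lemma hge_all_imp_0: "(\<And>n::nat. hge (c + of_nat n * d) f) \<Longrightarrow> 0 < d \<Longrightarrow> f = 0"
proof (rule hahn_eqI)
  fix q assume *: "\<And>n::nat. hge (c + of_nat n * d) f" "0 < d"
  obtain n where "(q - c) / d < of_nat n"
    using reals_Archimedean2 by blast
  then have "q < c + of_nat n * d"
    using *(2) by (simp add: field_simps)
  then show "hcoeff f q = hcoeff 0 q"
    using *(1) by (auto simp: hge_def zero_hahn.rep_eq)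
qed

lemma ex_min_support:
  assumes "f \<noteq> 0"
  obtains q where "hcoeff f q \<noteq> 0" "hge q f"
proof -
  have "{q. hcoeff f q \<noteq> 0} \<noteq> {}"
    using assms hahn_eqI[of f 0] by (auto simp: zero_hahn.rep_eq)
  then have "\<exists>z\<in>{q. hcoeff f q \<noteq> 0}. \<forall>y\<in>{q. hcoeff f q \<noteq> 0}. z \<le> y"
    by (intro wfp_on_less_ex_least[OF wfp_on_hcoeff]) auto
  then show ?thesis
    using that unfolding hge_def by (metis leD mem_Collect_eq)
qed

lemma ex_hge: "\<exists>c\<le>0. hge c f"
proof (cases "f = 0")
  case False
  then obtain q where "hge q f"
    by (rule ex_min_support)
  then show ?thesis
    by (intro exI[of _ "min q 0"]) (auto intro: hge_mono)
qed auto

lemma hge_power_diff: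
  assumes "0 \<le> c" "hge c u" "hge c v" "hge d (u - v)"
  shows "hge d (u ^ n - v ^ n)"
proof (induction n)
  case (Suc n)
  have "u ^ Suc n - v ^ Suc n = u * (u ^ n - v ^ n) + (u - v) * v ^ n"
    by (simp add: algebra_simps)
  moreover have "hge (c + d) (u * (u ^ n - v ^ n))" "hge (d + of_nat n * c) ((u - v) * v ^ n)"
    using assms Suc by (auto intro!: hge_mult hge_power)
  ultimately show ?case
    using assms(1) by (auto intro!: hge_add elim!: hge_mono)
qed simp

text \<open>Completeness of Hahn series for the \<open>t\<close>-adic valuation, in the form of a fixed-point theorem. Below each
  exponent the iterates of \<open>\<Phi>\<close> become stationary, and the stationary coefficients form a series with well-ordered
  support. Both inverses and roots of Artin-Schreier polynomials are obtained from it.\<close>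

lemma hahn_contraction_fixpoint:
  fixes \<Phi> :: "'a::comm_ring_1 hahn \<Rightarrow> 'a hahn"
  assumes \<delta>: "0 < \<delta>"
    and maps: "\<And>u. hge c u \<Longrightarrow> hge c (\<Phi> u)"
    and contr: "\<And>u v d. hge c u \<Longrightarrow> hge c v \<Longrightarrow> c \<le> d \<Longrightarrow> hge d (u - v) \<Longrightarrow> hge (d + \<delta>) (\<Phi> u - \<Phi> v)"
  obtains u where "hge c u" "\<Phi> u = u"
proof -
  define s where "s n = (\<Phi> ^^ n) 0" for n
  have s: "hge c (s n)" for n
    by (induction n) (auto simp: s_def maps)
  have s_Suc: "s (Suc n) = \<Phi> (s n)" for n
    by (simp add: s_def)
  have step: "hge (c + of_nat n * \<delta>) (s (Suc n) - s n)" for n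
  proof (induction n)
    case 0
    then show ?case
      using s[of 1] by (simp add: s_def)
  next
    case (Suc n)
    then show ?case
      using contr[OF s s _ Suc] \<delta> by (simp add: s_Suc algebra_simps)
  qed
  have step': "hge (c + of_nat n * \<delta>) (s (n + k) - s n)" for n k
  proof (induction k)
    case (Suc k)
    have "hge (c + of_nat n * \<delta>) (s (Suc (n + k)) - s (n + k))"
      by (rule hge_mono[OF step]) (use \<delta> in \<open>simp add: mult_le_cancel_right_pos\<close>)
    then have "hge (c + of_nat n * \<delta>) ((s (Suc (n + k)) - s (n + k)) + (s (n + k) - s n))"
      using Suc by (rule hge_add)
    then show ?case
      by simp
  qed simp
  define N where "N q = (LEAST n::nat. q < c + of_nat n * \<delta>)" for q
  have N: "q < c + of_nat (N q) * \<delta>" for q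
  proof -
    obtain n where "(q - c) / \<delta> < of_nat n"
      using reals_Archimedean2 by blast
    then have "q < c + of_nat n * \<delta>"
      using \<delta> by (simp add: field_simps)
    then show ?thesis
      unfolding N_def by (rule LeastI)
  qed
  have eq: "hcoeff (s (N q)) q = hcoeff (s n) q" if "q < c + of_nat n * \<delta>" for q n
  proof -
    have "N q \<le> n"
      unfolding N_def using that by (rule Least_le)
    then obtain k where "n = N q + k"
      using le_Suc_ex by blast
    then show ?thesis
      using step'[of "N q" k] N[of q] by (auto simp: hge_def minus_hahn.rep_eq)
  qed
  define f where "f q = hcoeff (s (N q)) q" for q
  have "wfp_on {q. f q \<noteq> 0} (<)"
  proof (rule wfp_on_less_if_initial_segments)
    fix d
    have "{a \<in> {q. f q \<noteq> 0}. a < d} \<subseteq> {q. hcoeff (s (N d)) q \<noteq> 0}"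
      using eq[of _ "N d"] N[of d] by (auto simp: f_def)
    then show "wfp_on {a \<in> {q. f q \<noteq> 0}. a < d} (<)"
      by (rule wfp_on_subset[OF wfp_on_hcoeff])
  qed
  then have u: "hcoeff (Abs_hahn f) q = f q" for q
    by (simp add: hcoeff_Abs)
  have lim: "hge (c + of_nat n * \<delta>) (Abs_hahn f - s n)" for n
    using eq by (auto simp: hge_def minus_hahn.rep_eq u f_def)
  have hge_u: "hge c (Abs_hahn f)"
    using lim[of 0] by (simp add: s_def)
  have "\<Phi> (Abs_hahn f) - Abs_hahn f = 0"
  proof (rule hge_all_imp_0[OF _ \<delta>, of "c + \<delta>"])
    fix n
    have "hge (c + of_nat n * \<delta> + \<delta>) (\<Phi> (Abs_hahn f) - \<Phi> (s n))"
      using contr[OF hge_u s _ lim[of n]] \<delta> by simp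
    moreover have "hge (c + of_nat n * \<delta> + \<delta>) (Abs_hahn f - s (Suc n))"
      by (rule hge_mono[OF lim[of "Suc n"]]) (simp add: algebra_simps)
    ultimately have "hge (c + of_nat n * \<delta> + \<delta>) ((\<Phi> (Abs_hahn f) - \<Phi> (s n)) - (Abs_hahn f - s (Suc n)))"
      by (rule hge_diff)
    then show "hge (c + \<delta> + of_nat n * \<delta>) (\<Phi> (Abs_hahn f) - Abs_hahn f)"
      by (simp add: s_Suc algebra_simps)
  qed
  then show ?thesis
    using that[OF hge_u] by simp
qed

subsection \<open>Substitution and change of coefficients\<close>

text \<open>For \<open>r > 0\<close> this is the substitution \<open>t \<mapsto> t\<^sup>r\<close>; for other \<open>r\<close>, where the substitution would not
  preserve well-orderedness, it is the identity.\<close>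

lift_definition hscale :: "rat \<Rightarrow> 'a::comm_ring_1 hahn \<Rightarrow> 'a hahn" is
  "\<lambda>r f q. if 0 < r then f (q / r) else f q"
proof -
  fix r :: rat and f :: "rat \<Rightarrow> 'a"
  assume wf: "wfp_on {q. f q \<noteq> 0} (<)"
  show "wfp_on {q. (if 0 < r then f (q / r) else f q) \<noteq> 0} (<)"
  proof (cases "0 < r")
    case True
    have "wfp_on ((\<lambda>q. q * r) ` {q. f q \<noteq> 0}) (<)"
      using wf True by (subst wfp_on_image) simp
    then show ?thesis
      by (rule wfp_on_subset) (use True in \<open>auto intro!: image_eqI[of _ _ "_ / r"]\<close>)
  qed (use wf in simp)
qed

lemma hcoeff_hscale: "0 < r \<Longrightarrow> hcoeff (hscale r f) q = hcoeff f (q / r)"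
  by (simp add: hscale.rep_eq)

lemma hscale_add: "hscale r (f + g) = hscale r f + hscale r g"
  by (rule hahn_eqI) (simp add: hscale.rep_eq plus_hahn.rep_eq)

lemma hscale_diff: "hscale r (f - g) = hscale r f - hscale r g"
  by (rule hahn_eqI) (simp add: hscale.rep_eq minus_hahn.rep_eq)

lemma hscale_uminus: "hscale r (- f) = - hscale r f"
  by (rule hahn_eqI) (simp add: hscale.rep_eq uminus_hahn.rep_eq)

lemma hscale_mult: "hscale r (f * g) = hscale r f * hscale r g"
proof (rule hahn_eqI)
  fix q
  show "hcoeff (hscale r (f * g)) q = hcoeff (hscale r f * hscale r g) q"
  proof (cases "0 < r")
    case True
    then show ?thesis
      unfolding hcoeff_hscale[OF True] times_hahn.rep_eq
      by (intro sum.reindex_bij_witness[of _ "\<lambda>a. a / r" "\<lambda>a. a * r"]) (auto simp: diff_divide_distrib)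
  qed (simp add: hscale.rep_eq times_hahn.rep_eq)
qed

lemma hscale_1: "hscale r 1 = 1"
  by (rule hahn_eqI) (simp add: hscale.rep_eq one_hahn.rep_eq)

lemma hscale_power: "hscale r (f ^ n) = hscale r f ^ n"
  by (induction n) (simp_all add: hscale_1 hscale_mult)

lemma hscale_of_nat_mult: "hscale r (of_nat n * f) = of_nat n * hscale r f"
  by (rule hahn_eqI) (simp add: hscale.rep_eq hcoeff_of_nat_mult)

lemma hscale_hmonom: "0 < r \<Longrightarrow> hscale r (hmonom s c) = hmonom (r * s) c"
  by (rule hahn_eqI) (auto simp: hscale.rep_eq hmonom.rep_eq)

lemma hscale_hscale: "0 < r \<Longrightarrow> 0 < s \<Longrightarrow> hscale r (hscale s f) = hscale (r * s) f"
  by (rule hahn_eqI) (simp add: hscale.rep_eq)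

lemma hscale_one_left: "hscale 1 f = f"
  by (rule hahn_eqI) (simp add: hscale.rep_eq)

lemma hge_hscale: "0 < r \<Longrightarrow> hge c f \<Longrightarrow> hge (r * c) (hscale r f)"
  by (auto simp: hge_def hcoeff_hscale divide_less_eq mult.commute)

lift_definition hahn_of_int :: "int hahn \<Rightarrow> 'a::comm_ring_1 hahn" is "\<lambda>f q. of_int (f q)"
  by (erule wfp_on_subset) auto

lemma hahn_of_int_add: "hahn_of_int (f + g) = hahn_of_int f + hahn_of_int g"
  by (rule hahn_eqI) (simp add: hahn_of_int.rep_eq plus_hahn.rep_eq)

lemma hahn_of_int_uminus: "hahn_of_int (- f) = - hahn_of_int f"
  by (rule hahn_eqI) (simp add: hahn_of_int.rep_eq uminus_hahn.rep_eq)

lemma hahn_of_int_mult: "hahn_of_int (f * g) = hahn_of_int f * hahn_of_int g"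
proof (rule hahn_eqI)
  fix q
  show "hcoeff (hahn_of_int (f * g)) q = hcoeff (hahn_of_int f * hahn_of_int g :: 'a hahn) q"
    by (subst hcoeff_times_superset[OF finite_hahn_antidiagonal[of f g q]])
      (auto simp: hahn_of_int.rep_eq times_hahn.rep_eq)
qed

lemma hahn_of_int_1: "hahn_of_int 1 = 1"
  by (rule hahn_eqI) (simp add: hahn_of_int.rep_eq one_hahn.rep_eq)

lemma hahn_of_int_power: "hahn_of_int (f ^ n) = hahn_of_int f ^ n"
  by (induction n) (simp_all add: hahn_of_int_1 hahn_of_int_mult)

lemma hahn_of_int_of_nat_mult: "hahn_of_int (of_nat n * f) = of_nat n * hahn_of_int f"
  by (rule hahn_eqI) (simp add: hahn_of_int.rep_eq hcoeff_of_nat_mult)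

lemma hahn_of_int_hmonom: "hahn_of_int (hmonom r c) = hmonom r (of_int c)"
  by (rule hahn_eqI) (simp add: hahn_of_int.rep_eq hmonom.rep_eq)

lemma hge_hahn_of_int: "hge c f \<Longrightarrow> hge c (hahn_of_int f)"
  by (simp add: hge_def hahn_of_int.rep_eq)

section \<open>Hahn series modulo \<open>p - t\<close>\<close>

text \<open>The field of \<open>p\<close>-adic Hahn series is the quotient by the multiples of this element, and almost all
  computations in the quotient are done as divisibility statements in the ring of Hahn series.\<close>

definition p_minus_t :: "nat \<Rightarrow> 'w::comm_ring_1 hahn" where
  "p_minus_t p = of_nat p - hmonom 1 1"

lemma hcoeff_p_minus_t_mult:
  "hcoeff (p_minus_t p * g) q = of_nat p * hcoeff g q - hcoeff g (q - 1)"
  by (simp add: p_minus_t_def left_diff_distrib minus_hahn.rep_eq hcoeff_of_nat_mult hcoeff_hmonom_mult)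

lemma p_minus_t_dvdI:
  "(\<And>q. hcoeff f q = of_nat p * hcoeff g q - hcoeff g (q - 1)) \<Longrightarrow> p_minus_t p dvd f"
  by (rule dvdI[of _ _ g], rule hahn_eqI) (simp add: hcoeff_p_minus_t_mult)

text \<open>Carrying moves coefficients upwards by integers, so this set contains the support of everything produced by
  it.\<close>

lemma wfp_on_hahn_support_plus_nat: "wfp_on {q. \<exists>n::nat. hcoeff f (q - of_nat n) \<noteq> 0} (<)"
proof (rule wfp_on_subset)
  have "wfp_on (range (of_nat :: nat \<Rightarrow> rat)) (<)"
    by (subst wfp_on_image) simp
  then show "wfp_on {a + b |a b. a \<in> {q. hcoeff f q \<noteq> 0} \<and> b \<in> range of_nat} (<)"
    by (rule wfp_on_less_sumset[OF wfp_on_hcoeff])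
  show "{q. \<exists>n::nat. hcoeff f (q - of_nat n) \<noteq> 0} \<subseteq> {a + b |a b. a \<in> {q. hcoeff f q \<noteq> 0} \<and> b \<in> range of_nat}"
  proof clarify
    fix q and n :: nat
    assume "hcoeff f (q - of_nat n) \<noteq> 0"
    then show "\<exists>a b. q = a + b \<and> a \<in> {q. hcoeff f q \<noteq> 0} \<and> b \<in> range of_nat"
      by (intro exI[of _ "q - of_nat n"] exI[of _ "of_nat n"]) auto
  qed
qed

text \<open>A well-ordered set meets a coset of the integers in a set bounded below: recursions from \<open>q - 1\<close> to \<open>q\<close>
  have a starting point.\<close>

lemma ex_coset_bottom:
  fixes f :: "'a::comm_ring_1 hahn"
  shows "\<exists>n::nat. \<forall>m\<ge>n. hcoeff f (q - of_nat m) = 0"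
proof -
  obtain c where c: "hge c f"
    using ex_hge by blast
  obtain n :: nat where n: "q - c < of_nat n"
    using reals_Archimedean2 by blast
  have "hcoeff f (q - of_nat m) = 0" if "m \<ge> n" for m
  proof -
    have "of_nat n \<le> (of_nat m :: rat)"
      using that by simp
    then show ?thesis
      using c n by (auto simp: hge_def)
  qed
  then show ?thesis
    by blast
qed

text \<open>Adding with carry: \<open>hcoeff g q\<close> is what is carried from position \<open>q\<close> to position \<open>q + 1\<close>. The
  recursion runs along each coset of the integers and starts below the support of \<open>f\<close>, where no carry occurs
  because of \<open>Q 0 = 0\<close>.\<close>

lemma carry_recursion:
  fixes f :: "'w::comm_ring_1 hahn" and Q :: "'w \<Rightarrow> 'w"
  assumes Q0: "Q 0 = 0"
  obtains g where "\<And>q. hcoeff g q = Q (hcoeff f q + hcoeff g (q - 1))"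
    and "\<And>q. (\<And>n::nat. hcoeff f (q - of_nat n) = 0) \<Longrightarrow> hcoeff g q = 0"
proof -
  define step where "step n G q = Q (hcoeff f q + G (q - 1))" for n :: nat and G :: "rat \<Rightarrow> 'w" and q
  define G where "G n = rec_nat (\<lambda>q::rat. 0) step n" for n
  have G0: "G 0 q = 0" and GS: "G (Suc n) q = Q (hcoeff f q + G n (q - 1))" for n q
    by (simp_all add: G_def step_def)
  have zero: "G n q = 0" if "\<And>m::nat. hcoeff f (q - of_nat m) = 0" for n q
    using that
  proof (induction n arbitrary: q)
    case (Suc n)
    have "hcoeff f (q - 1 - of_nat m) = 0" for m
      using Suc.prems[of "Suc m"] by (simp add: algebra_simps)
    then show ?case
      using Suc.IH[of "q - 1"] Suc.prems[of 0] by (simp add: GS Q0)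
  qed (simp add: G0)
  have stable: "G k q = G n q" if "\<forall>m\<ge>n. hcoeff f (q - of_nat m) = 0" "n \<le> k" for n k q
    using that
  proof (induction n arbitrary: q k)
    case 0
    then show ?case
      using zero by (simp add: G0)
  next
    case (Suc n)
    then obtain k' where k': "k = Suc k'" "n \<le> k'"
      by (cases k) auto
    have "\<forall>m\<ge>n. hcoeff f (q - 1 - of_nat m) = 0"
    proof (intro allI impI)
      fix m assume "m \<ge> n"
      then show "hcoeff f (q - 1 - of_nat m) = 0"
        using Suc.prems(1)[rule_format, of "Suc m"] by (simp add: algebra_simps)
    qed
    then show ?case
      using Suc.IH[of "q - 1" k'] k' by (simp add: GS)
  qed
  \<comment> \<open>\<open>G n q\<close> is the carry at \<open>q\<close> if the recursion starts \<open>n\<close> steps below; \<open>N q\<close> steps suffice.\<close>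
  define N where "N q = (LEAST n. \<forall>m\<ge>n. hcoeff f (q - of_nat m) = 0)" for q
  have N: "\<forall>m\<ge>N q. hcoeff f (q - of_nat m) = 0" for q
    unfolding N_def by (rule LeastI_ex[OF ex_coset_bottom])
  define g where "g q = G (N q) q" for q
  have g: "g q = G n q" if "\<forall>m\<ge>n. hcoeff f (q - of_nat m) = 0" for n q
    using that unfolding g_def N_def by (intro stable[symmetric] Least_le N[unfolded N_def])
  have rec: "g q = Q (hcoeff f q + g (q - 1))" for q
  proof -
    have "\<forall>m\<ge>Suc (N (q - 1)). hcoeff f (q - of_nat m) = 0"
    proof (intro allI impI)
      fix m assume "m \<ge> Suc (N (q - 1))"
      then obtain m' where "m = Suc m'" "m' \<ge> N (q - 1)"
        by (cases m) auto
      then show "hcoeff f (q - of_nat m) = 0"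
        using N[of "q - 1"] by (simp add: algebra_simps)
    qed
    from g[OF this] show ?thesis
      by (simp add: GS g_def)
  qed
  have g_zero: "g q = 0" if "\<And>n::nat. hcoeff f (q - of_nat n) = 0" for q
    using zero[OF that] by (simp add: g_def)
  have "wfp_on {q. g q \<noteq> 0} (<)"
    by (rule wfp_on_subset[OF wfp_on_hahn_support_plus_nat[of f]]) (use g_zero in blast)
  then have Abs: "hcoeff (Abs_hahn g) = g"
    by (rule hcoeff_Abs)
  show ?thesis
    by (rule that[of "Abs_hahn g"]; unfold Abs; rule rec g_zero)
qed

text \<open>What is needed of the ring of Witt vectors of a perfect field of characteristic \<open>p\<close>: it is \<open>p\<close>-torsion
  free and \<open>T\<close> is a multiplicative system of representatives of the residue classes modulo \<open>p\<close>.\<close>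

locale residue_lift =
  fixes p :: nat and T :: "'k::field \<Rightarrow> 'w::comm_ring_1"
  assumes p_prime: "prime p"
    and T_mult: "T (a * b) = T a * T b"
    and T_0 [simp]: "T 0 = 0"
    and T_1 [simp]: "T 1 = 1"
    and p_torsion_free: "of_nat p * w = 0 \<Longrightarrow> w = 0"
    and ex_residue: "\<exists>a. of_nat p dvd w - T a"
    and T_inj_mod_p: "of_nat p dvd T a - T b \<Longrightarrow> a = b"
begin

lemma p_power_torsion_free: "of_nat p ^ n * w = 0 \<Longrightarrow> w = 0" for w :: 'w
proof (induction n)
  case (Suc n)
  then show ?case
    using p_torsion_free[of "of_nat p ^ n * w"] by (simp add: mult.assoc)
qed simp

lemma p_power_cancel: "of_nat p ^ n * v = of_nat p ^ n * w \<Longrightarrow> v = w" for v w :: 'w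
  using p_power_torsion_free[of n "v - w"] by (simp add: right_diff_distrib)

lemma T_eq_0_iff: "T a = 0 \<longleftrightarrow> a = 0"
  using T_inj_mod_p[of a 0] by auto

lemma wfp_on_T: "wfp_on {q. r q \<noteq> 0} (<) \<Longrightarrow> wfp_on {q. T (r q) \<noteq> 0} (<)"
  by (simp add: T_eq_0_iff)

text \<open>At each exponent split off the Teichmueller digit of coefficient plus incoming carry, and carry the rest divided
  by \<open>p\<close>. The digits start where \<open>f\<close> starts, so the lower bound of the support is kept.\<close>

lemma ex_standard_expansion:
  assumes "hge c f"
  obtains r where "wfp_on {q. r q \<noteq> 0} (<)" "\<And>q. q < c \<Longrightarrow> r q = 0"
    "p_minus_t p dvd f - Abs_hahn (\<lambda>q. T (r q))"
proof -
  define digit where "digit w = (SOME a. of_nat p dvd w - T a)" for w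
  have digit: "of_nat p dvd w - T (digit w)" for w
    unfolding digit_def by (rule someI_ex[OF ex_residue])
  have digit_0: "digit 0 = 0"
    using digit[of 0] T_inj_mod_p[of 0 "digit 0"] by simp
  define Q where "Q w = (SOME v. w - T (digit w) = of_nat p * v)" for w
  have Q: "w - T (digit w) = of_nat p * Q w" for w
    unfolding Q_def by (rule someI_ex) (use digit[of w] in \<open>auto elim: dvdE\<close>)
  have "Q 0 = 0"
    using Q[of 0] p_torsion_free[of "Q 0"] by (simp add: digit_0)
  then obtain g where g: "\<And>q. hcoeff g q = Q (hcoeff f q + hcoeff g (q - 1))"
      "\<And>q. (\<And>n::nat. hcoeff f (q - of_nat n) = 0) \<Longrightarrow> hcoeff g q = 0"
    by (rule carry_recursion[of Q f]) blast
  define r where "r q = digit (hcoeff f q + hcoeff g (q - 1))" for q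
  have r_zero: "r q = 0" if *: "\<And>n::nat. hcoeff f (q - of_nat n) = 0" for q
  proof -
    have "hcoeff g (q - 1) = 0"
    proof (rule g(2))
      fix n :: nat
      show "hcoeff f (q - 1 - of_nat n) = 0"
        using *[of "Suc n"] by (simp add: algebra_simps)
    qed
    then show ?thesis
      using *[of 0] by (simp add: r_def digit_0)
  qed
  have wf: "wfp_on {q. r q \<noteq> 0} (<)"
    by (rule wfp_on_subset[OF wfp_on_hahn_support_plus_nat[of f]]) (use r_zero in blast)
  show thesis
  proof
    show "r q = 0" if "q < c" for q
      by (rule r_zero) (use assms that in \<open>auto simp: hge_def\<close>)
    show "p_minus_t p dvd f - Abs_hahn (\<lambda>q. T (r q))"
    proof (rule p_minus_t_dvdI[of _ _ g])
      fix q
      show "hcoeff (f - Abs_hahn (\<lambda>q. T (r q))) q = of_nat p * hcoeff g q - hcoeff g (q - 1)"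
        using Q[of "hcoeff f q + hcoeff g (q - 1)", folded r_def] g(1)[of q]
        by (simp add: minus_hahn.rep_eq hcoeff_Abs[OF wfp_on_T[OF wf]] algebra_simps)
    qed
  qed (fact wf)
qed

text \<open>The coefficients of \<open>g\<close> at or below \<open>q\<close> are determined by \<open>hcoeff g q\<close> through multiplication by powers of \<open>p\<close>,
  and far below \<open>q\<close> they are zero; so \<open>hcoeff g q\<close> is torsion.\<close>

lemma carry_vanishes:
  fixes g :: "'w hahn"
  assumes "\<And>s. s \<le> q \<Longrightarrow> of_nat p * hcoeff g s = hcoeff g (s - 1)"
  shows "hcoeff g q = 0"
proof -
  have eq: "of_nat p ^ n * hcoeff g q = hcoeff g (q - of_nat n)" for n
  proof (induction n)
    case (Suc n)
    have "of_nat p ^ Suc n * hcoeff g q = of_nat p * (of_nat p ^ n * hcoeff g q)"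
      by (simp add: mult.assoc)
    also have "\<dots> = hcoeff g (q - of_nat n - 1)"
      using assms[of "q - of_nat n"] by (simp add: Suc.IH)
    finally show ?case
      by (simp add: algebra_simps)
  qed simp
  obtain n :: nat where "\<forall>m\<ge>n. hcoeff g (q - of_nat m) = 0"
    using ex_coset_bottom[of g q] by blast
  then show ?thesis
    using eq[of n] p_power_torsion_free by simp
qed

text \<open>At the smallest exponent \<open>q\<close> where the digits differ no carry arrives from below, so the two digits are
  congruent modulo \<open>p\<close>.\<close>

lemma standard_expansion_unique:
  assumes r: "wfp_on {q. r q \<noteq> 0} (<)" and s: "wfp_on {q. s q \<noteq> 0} (<)"
    and dvd: "p_minus_t p dvd Abs_hahn (\<lambda>q. T (r q)) - Abs_hahn (\<lambda>q. T (s q))"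
  shows "r = s"
proof (rule ccontr)
  assume "r \<noteq> s"
  then have "{q. r q \<noteq> s q} \<noteq> {}"
    by (auto simp: fun_eq_iff)
  moreover have "{q. r q \<noteq> s q} \<subseteq> {q. r q \<noteq> 0} \<union> {q. s q \<noteq> 0}"
    by auto
  ultimately have "\<exists>q\<in>{q. r q \<noteq> s q}. \<forall>u\<in>{q. r q \<noteq> s q}. q \<le> u"
    by (intro wfp_on_less_ex_least[OF wfp_on_less_Un[OF r s]])
  then obtain q where q: "r q \<noteq> s q" "\<forall>u. r u \<noteq> s u \<longrightarrow> q \<le> u"
    by auto
  then have less: "r u = s u" if "u < q" for u
    using that by (meson leD)
  obtain g where g: "Abs_hahn (\<lambda>q. T (r q)) - Abs_hahn (\<lambda>q. T (s q)) = p_minus_t p * g"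
    using dvd by (rule dvdE)
  have eq: "T (r u) - T (s u) = of_nat p * hcoeff g u - hcoeff g (u - 1)" for u
    using arg_cong[OF g, of "\<lambda>h. hcoeff h u"]
    by (simp add: minus_hahn.rep_eq hcoeff_p_minus_t_mult hcoeff_Abs wfp_on_T r s)
  have "hcoeff g (q - 1) = 0"
  proof (rule carry_vanishes)
    fix u assume "u \<le> q - 1"
    then show "of_nat p * hcoeff g u = hcoeff g (u - 1)"
      using eq[of u] less[of u] by simp
  qed
  then have "of_nat p dvd T (r q) - T (s q)"
    using eq[of q] by simp
  then show False
    using q(1) T_inj_mod_p by blast
qed

lemma not_p_minus_t_dvd_1: "\<not> p_minus_t p dvd (1 :: 'w hahn)"
proof
  assume "p_minus_t p dvd (1 :: 'w hahn)"
  moreover have "Abs_hahn (\<lambda>q. T (if q = 0 then 1 else 0)) = 1"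
    by (rule hahn_eqI, subst hcoeff_Abs)
      (auto simp: one_hahn.rep_eq intro!: wfp_on_T wfp_on_subset[OF wfp_on_singleton[of 0]] split: if_splits)
  moreover have "Abs_hahn (\<lambda>q. T 0) = 0"
    by (rule hahn_eqI) (simp add: zero_hahn.rep_eq hcoeff_Abs wfp_on_def)
  ultimately have "(\<lambda>q::rat. if q = 0 then 1 else 0) = (\<lambda>q. 0 :: 'k)"
    by (intro standard_expansion_unique)
      (auto intro!: wfp_on_subset[OF wfp_on_singleton[of 0]] split: if_splits simp: wfp_on_def)
  then show False
    by (auto simp: fun_eq_iff split: if_splits)
qed

text \<open>Replace \<open>f\<close> by its standard expansion. Dividing by the leading term, whose coefficient is a unit because
  it is a Teichmueller representative, leaves \<open>1 - v\<close> with \<open>v\<close> of positive valuation; the inverse of \<open>1 - v\<close> is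
  the fixed point of \<open>w \<mapsto> 1 + v w\<close>.\<close>

lemma ex_inverse_mod_p_minus_t:
  fixes f :: "'w hahn"
  assumes f: "\<not> p_minus_t p dvd f"
  shows "\<exists>g. p_minus_t p dvd f * g - 1"
proof -
  obtain c where "hge c f"
    using ex_hge by blast
  then obtain r where r: "wfp_on {q. r q \<noteq> 0} (<)" "p_minus_t p dvd f - Abs_hahn (\<lambda>q. T (r q))"
    by (rule ex_standard_expansion)
  define F where "F = Abs_hahn (\<lambda>q. T (r q))"
  have F: "hcoeff F q = T (r q)" for q
    by (simp add: F_def hcoeff_Abs wfp_on_T r(1))
  have "F \<noteq> 0"
    using r(2) f unfolding F_def[symmetric] by auto
  then obtain q where q: "hcoeff F q \<noteq> 0" "hge q F"
    by (rule ex_min_support)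
  define u where "u = hmonom (- q) (T (inverse (r q)))"
  define v where "v = 1 - u * F"
  have "r q \<noteq> 0"
    using q(1) by (auto simp: F)
  have v: "hcoeff v s = (if s = 0 then 1 else 0) - T (inverse (r q)) * T (r (s + q))" for s
    by (simp add: v_def u_def minus_hahn.rep_eq one_hahn.rep_eq hcoeff_hmonom_mult F)
  have "hcoeff v s = 0" if "s \<le> 0" for s
  proof (cases "s = 0")
    case True
    then show ?thesis
      using \<open>r q \<noteq> 0\<close> by (simp add: v T_mult[symmetric])
  next
    case False
    then have "s + q < q"
      using that by simp
    then have "hcoeff F (s + q) = 0"
      using q(2) unfolding hge_def by blast
    then show ?thesis
      using False by (simp add: v F)
  qed
  then have "\<exists>\<delta>>0. hge \<delta> v"
    using ex_min_support[of v] by (metis hge_0 not_le zero_less_one)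
  then obtain \<delta> where \<delta>: "\<delta> > 0" "hge \<delta> v"
    by blast
  obtain w where w: "1 + v * w = w"
  proof (rule hahn_contraction_fixpoint[of \<delta> 0 "\<lambda>w. 1 + v * w"])
    show "hge 0 (1 + v * w)" if "hge 0 w" for w
      using hge_mult[OF \<delta>(2) that] \<delta>(1) by (auto intro!: hge_add elim: hge_mono)
    show "hge (d + \<delta>) (1 + v * w - (1 + v * w'))" if "hge d (w - w')" for w w' d
      using hge_mult[OF \<delta>(2) that] by (simp add: algebra_simps)
  qed (use \<delta> in auto)
  then have inv: "F * (u * w) = 1"
    by (simp add: v_def algebra_simps)
  have "f * (u * w) - 1 = (f - F) * (u * w)"
    by (simp only: left_diff_distrib inv)
  then show ?thesis
    using r(2)[folded F_def] by (intro exI[of _ "u * w"]) simp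
qed

text \<open>The condition defining the null series, for coefficients in a type with ring operations.\<close>

definition padic_sum_null :: "(int \<Rightarrow> 'w) \<Rightarrow> bool" where
  "padic_sum_null c \<longleftrightarrow> (\<exists>m::nat. (\<forall>n < - int m. c n = 0) \<and>
     (\<forall>N. \<exists>M. \<forall>J\<ge>M. of_nat p ^ N dvd (\<Sum>j<J. of_nat p ^ j * c (int j - int m))))"

text \<open>For a multiple of \<open>p - t\<close> the partial sums telescope.\<close>

lemma padic_sum_null_of_dvd:
  assumes "p_minus_t p dvd f"
  shows "padic_sum_null (\<lambda>n. hcoeff f (q + of_int n))"
proof -
  obtain g where g: "f = p_minus_t p * g"
    using assms by (rule dvdE)
  obtain m1 :: nat where m1: "\<forall>m\<ge>m1. hcoeff g (q - of_nat m) = 0"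
    using ex_coset_bottom[of g q] by blast
  obtain m2 :: nat where m2: "\<forall>m\<ge>m2. hcoeff f (q - of_nat m) = 0"
    using ex_coset_bottom[of f q] by blast
  define m where "m = max m1 m2"
  have start: "hcoeff g (q - of_nat m - 1) = 0"
    using m1[rule_format, of "Suc m"] by (simp add: m_def algebra_simps)
  have low: "hcoeff f (q + of_int n) = 0" if "n < - int m" for n
  proof -
    have "n = - int (nat (- n))" "nat (- n) \<ge> m2"
      using that by (auto simp: m_def)
    then show ?thesis
      using m2 by (metis of_int_minus of_int_of_nat_eq uminus_add_conv_diff add.commute)
  qed
  have tele: "(\<Sum>j<J. of_nat p ^ j * hcoeff f (q + of_int (int j - int m)))
      = of_nat p ^ J * hcoeff g (q + of_nat J - of_nat m - 1)" for J
  proof (induction J)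
    case 0
    then show ?case
      using start by simp
  next
    case (Suc J)
    have J: "q + of_int (int J - int m) = q + of_nat J - of_nat m"
      by simp
    have "hcoeff f (q + of_int (int J - int m))
        = of_nat p * hcoeff g (q + of_nat J - of_nat m) - hcoeff g (q + of_nat J - of_nat m - 1)"
      unfolding g J hcoeff_p_minus_t_mult ..
    then have "of_nat p ^ J * (hcoeff f (q + of_int (int J - int m)) + hcoeff g (q + of_nat J - of_nat m - 1))
        = of_nat p ^ J * (of_nat p * hcoeff g (q + of_nat J - of_nat m))"
      by simp
    then show ?case
      using Suc by (simp add: algebra_simps)
  qed
  show ?thesis
    unfolding padic_sum_null_def
  proof (rule exI[of _ m], intro conjI allI impI)
    fix N
    show "\<exists>M. \<forall>J\<ge>M. of_nat p ^ N dvd (\<Sum>j<J. of_nat p ^ j * hcoeff f (q + of_int (int j - int m)))"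
      by (intro exI[of _ N]) (auto simp only: tele intro: dvd_mult2 le_imp_power_dvd)
  qed (use low in auto)
qed

text \<open>The quotient \<open>g\<close> is found by carrying from below, \<open>p g(q) = f(q) + g(q - 1)\<close>. At each step the
  right-hand side has to be divisible by \<open>p\<close>. Unfolding the recursion, \<open>p\<^sup>m\<close> times this right-hand side is a partial
  sum of \<open>\<Sum>n. f(q + n) p\<^sup>n\<close>, multiplied by \<open>p\<^sup>m\<close>, up to the index \<open>n = 0\<close>; all later terms are divisible
  by \<open>p\<^bsup>m+1\<^esup>\<close> and the whole sum is null, hence the partial sum is divisible by \<open>p\<^bsup>m+1\<^esup>\<close>.\<close>

lemma dvd_of_padic_sum_null:
  assumes null: "\<And>q. padic_sum_null (\<lambda>n. hcoeff f (q + of_int n))"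
  shows "p_minus_t p dvd f"
proof -
  define Q where "Q w = (if w = 0 then 0 else (SOME v. w = of_nat p * v))" for w :: 'w
  have Q0: "Q 0 = 0"
    by (simp add: Q_def)
  have Q: "w = of_nat p * Q w" if dvd: "of_nat p dvd w" for w
  proof (cases "w = 0")
    case False
    have "\<exists>v. w = of_nat p * v"
      using dvd by (auto elim: dvdE)
    then have "w = of_nat p * (SOME v. w = of_nat p * v)"
      by (rule someI_ex)
    then show ?thesis
      using False by (simp add: Q_def)
  qed (simp add: Q_def)
  obtain g where g: "\<And>q. hcoeff g q = Q (hcoeff f q + hcoeff g (q - 1))"
      "\<And>q. (\<And>n::nat. hcoeff f (q - of_nat n) = 0) \<Longrightarrow> hcoeff g q = 0"
    by (rule carry_recursion[of Q f, OF Q0]) blast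
  have div: "of_nat p dvd hcoeff f q + hcoeff g (q - 1)" if "\<forall>n\<ge>k. hcoeff f (q - of_nat n) = 0" for q k
    using that
  proof (induction k arbitrary: q)
    case 0
    have "hcoeff g (q - 1) = 0"
    proof (rule g(2))
      fix n :: nat
      show "hcoeff f (q - 1 - of_nat n) = 0"
        using 0[rule_format, of "Suc n"] by (simp add: algebra_simps)
    qed
    then show ?case
      using 0[rule_format, of 0] by simp
  next
    case (Suc k)
    have lower: "of_nat p * hcoeff g (q - of_nat i) = hcoeff f (q - of_nat i) + hcoeff g (q - of_nat i - 1)"
      if "i > 0" for i
    proof -
      have "\<forall>n\<ge>k. hcoeff f (q - of_nat i - of_nat n) = 0"
      proof (intro allI impI)
        fix n assume "n \<ge> k"
        then show "hcoeff f (q - of_nat i - of_nat n) = 0"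
          using Suc.prems[rule_format, of "i + n"] that by (simp add: algebra_simps)
      qed
      from Q[OF Suc.IH[OF this]] show ?thesis
        by (simp add: g(1)[of "q - of_nat i"])
    qed
    obtain m where low: "\<And>n. n < - int m \<Longrightarrow> hcoeff f (q + of_int n) = 0"
      and null_m: "\<And>N. \<exists>M. \<forall>J\<ge>M. of_nat p ^ N dvd (\<Sum>j<J. of_nat p ^ j * hcoeff f (q + of_int (int j - int m)))"
      using null[of q] unfolding padic_sum_null_def by blast
    let ?t = "\<lambda>j. of_nat p ^ j * hcoeff f (q + of_int (int j - int m))"
    have partial: "(\<Sum>j<J. ?t j) = of_nat p ^ J * hcoeff g (q + of_nat J - of_nat m - 1)" if "J \<le> m" for J
      using that
    proof (induction J)
      case 0
      have "hcoeff g (q - of_nat m - 1) = 0"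
      proof (rule g(2))
        fix n :: nat
        show "hcoeff f (q - of_nat m - 1 - of_nat n) = 0"
          using low[of "- int m - 1 - int n"] by (simp add: algebra_simps)
      qed
      then show ?case
        by simp
    next
      case (Suc J)
      have J: "q - of_nat (m - J) = q + of_nat J - of_nat m"
        using Suc.prems by (simp add: of_nat_diff)
      have "of_nat p ^ J * (of_nat p * hcoeff g (q + of_nat J - of_nat m))
          = of_nat p ^ J * (hcoeff f (q + of_nat J - of_nat m) + hcoeff g (q + of_nat J - of_nat m - 1))"
        using lower[of "m - J", unfolded J] Suc.prems by simp
      moreover have "(\<Sum>j<Suc J. ?t j) = of_nat p ^ J * (hcoeff f (q + of_nat J - of_nat m) + hcoeff g (q + of_nat J - of_nat m - 1))"
        using Suc by (simp add: algebra_simps)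
      ultimately show ?case
        by (simp add: algebra_simps)
    qed
    have sum_m: "(\<Sum>j<Suc m. ?t j) = of_nat p ^ m * (hcoeff f q + hcoeff g (q - 1))"
      using partial[of m] by (simp add: algebra_simps)
    obtain M where M: "\<And>J. J \<ge> M \<Longrightarrow> of_nat p ^ Suc m dvd (\<Sum>j<J. ?t j)"
      using null_m[of "Suc m"] by blast
    define J where "J = M + Suc m"
    have "(\<Sum>j<J. ?t j) = (\<Sum>j<Suc m. ?t j) + (\<Sum>j\<in>{Suc m..<J}. ?t j)"
    proof -
      have eq: "{..<J} = {..<Suc m} \<union> {Suc m..<J}"
        by (auto simp: J_def)
      have disjoint: "{..<Suc m} \<inter> {Suc m..<J} = {}"
        by auto
      show ?thesis
        unfolding eq by (rule sum.union_disjoint[OF finite_lessThan finite_atLeastLessThan disjoint])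
    qed
    moreover have "of_nat p ^ Suc m dvd (\<Sum>j\<in>{Suc m..<J}. ?t j)"
      by (intro dvd_sum dvd_mult2 le_imp_power_dvd) auto
    moreover have "of_nat p ^ Suc m dvd (\<Sum>j<J. ?t j)"
      by (rule M) (simp add: J_def)
    ultimately have "of_nat p ^ Suc m dvd (\<Sum>j<Suc m. ?t j)"
      by (simp only: dvd_add_left_iff)
    then obtain v where "of_nat p ^ m * (hcoeff f q + hcoeff g (q - 1)) = of_nat p ^ Suc m * v"
      unfolding sum_m by (rule dvdE)
    then have "of_nat p ^ m * (hcoeff f q + hcoeff g (q - 1)) = of_nat p ^ m * (of_nat p * v)"
      by (simp add: algebra_simps)
    from p_power_cancel[OF this] show ?case
      by simp
  qed
  show ?thesis
  proof (rule p_minus_t_dvdI[of _ _ g])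
    fix q
    obtain k :: nat where "\<forall>n\<ge>k. hcoeff f (q - of_nat n) = 0"
      using ex_coset_bottom[of f q] by blast
    from Q[OF div[OF this]] show "hcoeff f q = of_nat p * hcoeff g q - hcoeff g (q - 1)"
      by (simp add: g(1)[of q])
  qed
qed

end

section \<open>The Frobenius lift \<open>t \<mapsto> t\<^sup>p\<close> on integral Hahn series\<close>

text \<open>The polynomial \<open>((x + y)\<^sup>p - x\<^sup>p - y\<^sup>p) / p\<close> for prime \<open>p\<close>.\<close>

definition frob_defect :: "nat \<Rightarrow> 'a::comm_ring_1 \<Rightarrow> 'a \<Rightarrow> 'a" where
  "frob_defect p x y = (\<Sum>k\<in>{1..<p}. of_nat ((p choose k) div p) * x ^ k * y ^ (p - k))"

lemma prime_power_add:
  fixes x y :: "'a::comm_ring_1"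
  assumes "prime p"
  shows "(x + y) ^ p = x ^ p + y ^ p + of_nat p * frob_defect p x y"
proof -
  have p: "p > 0"
    using assms by (rule prime_gt_0_nat)
  have choose: "of_nat (p choose k) = (of_nat p * of_nat ((p choose k) div p) :: 'a)" if "k \<in> {1..<p}" for k
  proof -
    have "p dvd p choose k"
      using that assms by (intro dvd_choose_prime) auto
    then have "p choose k = p * ((p choose k) div p)"
      by simp
    then show ?thesis
      by (metis of_nat_mult)
  qed
  have "(x + y) ^ p = (\<Sum>k\<le>p. of_nat (p choose k) * x ^ k * y ^ (p - k))"
    by (rule binomial_ring)
  also have "{..p} = insert 0 (insert p {1..<p})"
    using p by auto
  also have "(\<Sum>k\<in>\<dots>. of_nat (p choose k) * x ^ k * y ^ (p - k))
      = y ^ p + (x ^ p + (\<Sum>k\<in>{1..<p}. of_nat (p choose k) * x ^ k * y ^ (p - k)))"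
    using p by simp
  also have "(\<Sum>k\<in>{1..<p}. of_nat (p choose k) * x ^ k * y ^ (p - k)) = of_nat p * frob_defect p x y"
    unfolding frob_defect_def sum_distrib_left
    by (rule sum.cong) (simp_all add: choose mult.assoc)
  finally show ?thesis
    by (simp add: algebra_simps)
qed

lemma frob_defect_0_left: "frob_defect p 0 y = 0"
  unfolding frob_defect_def by (rule sum.neutral) (auto simp: power_0_left)

text \<open>The differences \<open>u\<^sup>k - v\<^sup>k\<close> are as small as \<open>u - v\<close>, and each of the fewer than \<open>p\<close> factors
  \<open>z\<close> costs at most \<open>e\<close>.\<close>

lemma hge_frob_defect_diff:
  assumes "0 \<le> c" "0 \<le> e" "hge c u" "hge c v" "hge (- e) z" "hge d (u - v)"
  shows "hge (d - of_nat p * e) (frob_defect p u z - frob_defect p v z)"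
  unfolding frob_defect_def sum_subtractf[symmetric]
proof (rule hge_sum)
  fix k assume k: "k \<in> {1..<p}"
  have "(of_nat (p - k) :: rat) * e \<le> of_nat p * e"
    using assms(2) by (intro mult_right_mono) auto
  then have "hge (d - of_nat p * e) ((u ^ k - v ^ k) * z ^ (p - k))"
    by (intro hge_mono[OF hge_mult[OF hge_power_diff[OF assms(1,3,4,6)] hge_power[OF assms(5)]]]) simp
  then have "hge (d - of_nat p * e) (of_nat ((p choose k) div p) * ((u ^ k - v ^ k) * z ^ (p - k)))"
    by (rule hge_of_nat_mult)
  then show "hge (d - of_nat p * e) (of_nat ((p choose k) div p) * u ^ k * z ^ (p - k)
      - of_nat ((p choose k) div p) * v ^ k * z ^ (p - k))"
    by (simp add: algebra_simps)
qed

lemma hge_frob_defect: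
  assumes "0 \<le> c" "0 \<le> e" "hge c u" "hge (- e) z"
  shows "hge (c - of_nat p * e) (frob_defect p u z)"
  using hge_frob_defect_diff[OF assms(1,2,3) hge_0 assms(4), of c p] assms(3)
  by (simp add: frob_defect_0_left)

lemma int_prime_dvd_power_minus_self:
  fixes a :: int
  assumes "prime p"
  shows "int p dvd a ^ p - a"
proof -
  have nat: "int p dvd int n ^ p - int n" for n
  proof (induction n)
    case 0
    then show ?case
      using prime_gt_0_nat[OF assms] by (simp add: power_0_left)
  next
    case (Suc n)
    have "int (Suc n) ^ p - int (Suc n) = (int n ^ p - int n) + int p * frob_defect p (int n) 1"
      unfolding of_nat_Suc add.commute[of 1 "int n"] prime_power_add[OF assms, of "int n" 1] by simp
    then show ?case
      using Suc by (simp only: dvd_add_left_iff[OF dvd_triv_left])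
  qed
  define n where "n = nat (a mod int p)"
  have "int n = a mod int p"
    using prime_gt_0_nat[OF assms] by (simp add: n_def)
  then have "a mod int p = int n mod int p"
    by simp
  then have "(a ^ p - a) mod int p = (int n ^ p - int n) mod int p"
    by (metis mod_diff_cong power_mod)
  then show ?thesis
    using nat[of n] by (metis dvd_eq_mod_eq_0)
qed

lemma hcoeff_times_nonzero:
  assumes "hcoeff (f * g) q \<noteq> 0"
  obtains a where "hcoeff f a \<noteq> 0" "hcoeff g (q - a) \<noteq> 0"
  using assms that unfolding times_hahn.rep_eq by (blast dest: ex_nonzero_of_sum_nonzero)

lemma support_power_less:
  assumes "\<And>a. hcoeff f a \<noteq> 0 \<Longrightarrow> a < c"
  shows "hcoeff (f ^ Suc n) q \<noteq> 0 \<Longrightarrow> q < of_nat (Suc n) * c"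
proof (induction n arbitrary: q)
  case 0
  then show ?case
    using assms[of q] by simp
next
  case (Suc n)
  then obtain a where "hcoeff f a \<noteq> 0" "hcoeff (f ^ Suc n) (q - a) \<noteq> 0"
    by (auto elim: hcoeff_times_nonzero simp only: power_Suc[of f "Suc n"])
  then show ?case
    using assms[of a] Suc.IH[of "q - a"] by (simp add: algebra_simps)
qed

lemma support_power_greater:
  assumes "\<And>a. hcoeff f a \<noteq> 0 \<Longrightarrow> c < a"
  shows "hcoeff (f ^ Suc n) q \<noteq> 0 \<Longrightarrow> of_nat (Suc n) * c < q"
proof (induction n arbitrary: q)
  case 0
  then show ?case
    using assms[of q] by simp
next
  case (Suc n)
  then obtain a where "hcoeff f a \<noteq> 0" "hcoeff (f ^ Suc n) (q - a) \<noteq> 0"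
    by (auto elim: hcoeff_times_nonzero simp only: power_Suc[of f "Suc n"])
  then show ?case
    using assms[of a] Suc.IH[of "q - a"] by (simp add: algebra_simps)
qed

text \<open>To compute the coefficient of \<open>x\<^sup>p\<close> at \<open>s\<close> modulo \<open>p\<close>, cut \<open>x\<close> at the exponent \<open>b = s / p\<close>. The part below
  \<open>b\<close> has a \<open>p\<close>-th power supported below \<open>s\<close>, the part above \<open>b\<close> has one supported above \<open>s\<close>, and
  mixed terms are divisible by \<open>p\<close>. Only the \<open>p\<close>-th power of the coefficient at \<open>b\<close> remains, and Fermat's little
  theorem compares it with that coefficient.\<close>

lemma frobenius_lift_coeff_dvd:
  fixes x :: "int hahn"
  assumes p: "prime p"
  shows "int p dvd hcoeff (hscale (of_nat p) x - x ^ p) s"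
proof -
  have p_pos: "p > 0"
    using p by (rule prime_gt_0_nat)
  then obtain m where m: "p = Suc m"
    by (cases p) auto
  define b where "b = s / of_nat p"
  have s: "s = of_nat p * b"
    using p_pos by (simp add: b_def)
  define lo where "lo = Abs_hahn (\<lambda>q. if q < b then hcoeff x q else 0)"
  have lo: "hcoeff lo q = (if q < b then hcoeff x q else 0)" for q
    unfolding lo_def by (subst hcoeff_Abs, rule wfp_on_subset[OF wfp_on_hcoeff[of x]]) auto
  define mid where "mid = hmonom b (hcoeff x b)"
  define hi where "hi = x - lo - mid"
  have hi: "hcoeff hi q = (if b < q then hcoeff x q else 0)" for q
    by (auto simp: hi_def mid_def lo minus_hahn.rep_eq hmonom.rep_eq)
  have "hcoeff (lo ^ Suc m) s = 0"
  proof (rule ccontr)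
    assume "hcoeff (lo ^ Suc m) s \<noteq> 0"
    then have "s < of_nat (Suc m) * b"
      by (rule support_power_less[rotated]) (simp add: lo split: if_splits)
    then show False
      by (simp add: s m)
  qed
  then have lo_s: "hcoeff (lo ^ p) s = 0"
    by (simp only: m)
  have "hcoeff (hi ^ Suc m) s = 0"
  proof (rule ccontr)
    assume "hcoeff (hi ^ Suc m) s \<noteq> 0"
    then have "of_nat (Suc m) * b < s"
      by (rule support_power_greater[rotated]) (simp add: hi split: if_splits)
    then show False
      by (simp add: s m)
  qed
  then have hi_s: "hcoeff (hi ^ p) s = 0"
    by (simp only: m)
  have mid_s: "hcoeff (mid ^ p) s = hcoeff x b ^ p"
    by (simp add: mid_def hmonom_power hmonom.rep_eq s)
  have "x = (lo + mid) + hi"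
    by (simp add: hi_def)
  then have "x ^ p = (lo ^ p + mid ^ p + of_nat p * frob_defect p lo mid) + hi ^ p
      + of_nat p * frob_defect p (lo + mid) hi"
    by (metis prime_power_add[OF p])
  then have "hcoeff (x ^ p) s
      = hcoeff x b ^ p + int p * hcoeff (frob_defect p lo mid) s + int p * hcoeff (frob_defect p (lo + mid) hi) s"
    by (simp add: plus_hahn.rep_eq hcoeff_of_nat_mult lo_s mid_s hi_s)
  moreover have "hcoeff (hscale (of_nat p) x) s = hcoeff x b"
    using p_pos by (simp add: hcoeff_hscale b_def)
  ultimately have "hcoeff (hscale (of_nat p) x - x ^ p) s = - (hcoeff x b ^ p - hcoeff x b)
      - int p * (hcoeff (frob_defect p lo mid) s + hcoeff (frob_defect p (lo + mid) hi) s)"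
    by (simp add: minus_hahn.rep_eq algebra_simps)
  then show ?thesis
    using int_prime_dvd_power_minus_self[OF p, of "hcoeff x b"] by (simp only: dvd_diff dvd_minus_iff dvd_triv_left)
qed

lemma frobenius_lift:
  fixes x :: "int hahn"
  assumes "prime p"
  obtains d where "hscale (of_nat p) x = x ^ p + of_nat p * d"
proof -
  let ?f = "hscale (of_nat p) x - x ^ p"
  define d where "d = Abs_hahn (\<lambda>q. hcoeff ?f q div int p)"
  have "hcoeff d q = hcoeff ?f q div int p" for q
    unfolding d_def by (subst hcoeff_Abs, rule wfp_on_subset[OF wfp_on_hcoeff[of ?f]]) auto
  then have "of_nat p * d = ?f"
    using frobenius_lift_coeff_dvd[OF assms]
    by (intro hahn_eqI) (auto simp: hcoeff_of_nat_mult)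
  then show ?thesis
    using that[of d] by (simp add: algebra_simps)
qed

lemma int_hahn_of_nat_cancel:
  fixes f g :: "int hahn"
  assumes "of_nat p * f = of_nat p * g" "p > 0"
  shows "f = g"
proof (rule hahn_eqI)
  fix q
  show "hcoeff f q = hcoeff g q"
    using arg_cong[OF assms(1), of "\<lambda>h. hcoeff h q"] assms(2) by (simp add: hcoeff_of_nat_mult)
qed

text \<open>The last rule adjoins solutions of \<open>\<phi> x - x = b\<close> for the substitution \<open>\<phi>: t \<mapsto> t\<^sup>p\<close>, which are
  approximate roots of Artin-Schreier polynomials. The element \<open>- 1\<close> is listed because together with products it
  provides all negatives.\<close>

inductive_set artin_schreier_closure :: "nat \<Rightarrow> int hahn set" for p :: nat where
  monom: "hmonom q 1 \<in> artin_schreier_closure p"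
| neg_one: "- 1 \<in> artin_schreier_closure p"
| add: "x \<in> artin_schreier_closure p \<Longrightarrow> y \<in> artin_schreier_closure p \<Longrightarrow> x + y \<in> artin_schreier_closure p"
| mult: "x \<in> artin_schreier_closure p \<Longrightarrow> y \<in> artin_schreier_closure p \<Longrightarrow> x * y \<in> artin_schreier_closure p"
| scale: "x \<in> artin_schreier_closure p \<Longrightarrow> hscale (1 / of_nat p) x \<in> artin_schreier_closure p"
| artin_schreier: "b \<in> artin_schreier_closure p \<Longrightarrow> hscale (of_nat p) x = x + b \<Longrightarrow> x \<in> artin_schreier_closure p"

lemma artin_schreier_closure_1: "1 \<in> artin_schreier_closure p"
  using artin_schreier_closure.monom[of 0 p] by (simp add: hmonom_0_1)

lemma artin_schreier_closure_0: "0 \<in> artin_schreier_closure p"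
  using artin_schreier_closure.add[OF artin_schreier_closure_1 artin_schreier_closure.neg_one, of p] by simp

lemma artin_schreier_closure_uminus: "x \<in> artin_schreier_closure p \<Longrightarrow> - x \<in> artin_schreier_closure p"
  using artin_schreier_closure.mult[OF artin_schreier_closure.neg_one, of x p] by simp

lemma artin_schreier_closure_diff: "x \<in> artin_schreier_closure p \<Longrightarrow> y \<in> artin_schreier_closure p \<Longrightarrow> x - y \<in> artin_schreier_closure p"
  using artin_schreier_closure.add[OF _ artin_schreier_closure_uminus, of x p y] by simp

lemma artin_schreier_closure_of_nat: "of_nat n \<in> artin_schreier_closure p"
  by (induction n) (auto intro: artin_schreier_closure_0 artin_schreier_closure_1 artin_schreier_closure.add)

lemma artin_schreier_closure_power: "x \<in> artin_schreier_closure p \<Longrightarrow> x ^ n \<in> artin_schreier_closure p"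
  by (induction n) (auto intro: artin_schreier_closure_1 artin_schreier_closure.mult)

lemma artin_schreier_closure_sum: "(\<And>i. i \<in> I \<Longrightarrow> f i \<in> artin_schreier_closure p) \<Longrightarrow> sum f I \<in> artin_schreier_closure p"
  by (induction I rule: infinite_finite_induct) (auto intro: artin_schreier_closure_0 artin_schreier_closure.add)

lemma artin_schreier_closure_frob_defect: "x \<in> artin_schreier_closure p \<Longrightarrow> y \<in> artin_schreier_closure p \<Longrightarrow> frob_defect n x y \<in> artin_schreier_closure p"
  unfolding frob_defect_def
  by (intro artin_schreier_closure_sum artin_schreier_closure.mult artin_schreier_closure_of_nat artin_schreier_closure_power)

text \<open>The operation \<open>\<delta>(x) = (\<phi> x - x\<^sup>p) / p\<close> is a polynomial expression on sums and products and commutes with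
  \<open>\<phi>\<close>. Hence for \<open>\<phi> x = x + b\<close> it satisfies \<open>\<phi> \<delta>(x) - \<delta>(x) = \<delta>(b) - frob_defect p x b\<close>, and
  \<open>\<delta>(x)\<close> is adjoined by the Artin-Schreier rule as well.\<close>

lemma artin_schreier_closure_delta:
  assumes p: "prime p" and "x \<in> artin_schreier_closure p"
  shows "\<exists>d\<in>artin_schreier_closure p. hscale (of_nat p) x = x ^ p + of_nat p * d"
  using assms(2)
proof induction
  case (monom q)
  then show ?case
    using prime_gt_0_nat[OF p] by (intro bexI[of _ 0] artin_schreier_closure_0) (simp add: hscale_hmonom hmonom_power)
next
  case neg_one
  show ?case
  proof (cases "even p")
    case True
    then have "p = 2"
      using p primes_dvd_imp_eq two_is_prime_nat by blast
    then show ?thesis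
      by (intro bexI[of _ "- 1"] artin_schreier_closure.neg_one) (simp add: hscale_uminus hscale_1)
  next
    case False
    then show ?thesis
      by (intro bexI[of _ 0] artin_schreier_closure_0) (simp add: hscale_uminus hscale_1)
  qed
next
  case (add x y)
  then obtain d e where d: "d \<in> artin_schreier_closure p" "hscale (of_nat p) x = x ^ p + of_nat p * d"
    and e: "e \<in> artin_schreier_closure p" "hscale (of_nat p) y = y ^ p + of_nat p * e"
    by auto
  show ?case
  proof
    show "d + e - frob_defect p x y \<in> artin_schreier_closure p"
      using d e add.hyps by (intro artin_schreier_closure_diff artin_schreier_closure.add artin_schreier_closure_frob_defect)
    show "hscale (of_nat p) (x + y) = (x + y) ^ p + of_nat p * (d + e - frob_defect p x y)"
      by (simp add: hscale_add d e prime_power_add[OF p] algebra_simps)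
  qed
next
  case (mult x y)
  then obtain d e where d: "d \<in> artin_schreier_closure p" "hscale (of_nat p) x = x ^ p + of_nat p * d"
    and e: "e \<in> artin_schreier_closure p" "hscale (of_nat p) y = y ^ p + of_nat p * e"
    by auto
  show ?case
  proof
    show "x ^ p * e + d * y ^ p + of_nat p * (d * e) \<in> artin_schreier_closure p"
      using d e mult.hyps by (intro artin_schreier_closure.add artin_schreier_closure.mult artin_schreier_closure_power artin_schreier_closure_of_nat)
    show "hscale (of_nat p) (x * y) = (x * y) ^ p + of_nat p * (x ^ p * e + d * y ^ p + of_nat p * (d * e))"
      by (simp add: hscale_mult d e power_mult_distrib algebra_simps)
  qed
next
  case (scale x)
  then obtain d where d: "d \<in> artin_schreier_closure p" "hscale (of_nat p) x = x ^ p + of_nat p * d"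
    by auto
  have "hscale (of_nat p) (hscale (1 / of_nat p) x) = hscale (1 / of_nat p) (hscale (of_nat p) x)"
    using prime_gt_0_nat[OF p] by (simp add: hscale_hscale)
  then show ?case
    using d by (intro bexI[of _ "hscale (1 / of_nat p) d"] artin_schreier_closure.scale)
      (simp_all add: hscale_add hscale_of_nat_mult hscale_power)
next
  case (artin_schreier b x)
  then obtain e where e: "e \<in> artin_schreier_closure p" "hscale (of_nat p) b = b ^ p + of_nat p * e"
    by auto
  obtain d where d: "hscale (of_nat p) x = x ^ p + of_nat p * d"
    using frobenius_lift[OF p] .
  have "of_nat p * hscale (of_nat p) d = hscale (of_nat p) (hscale (of_nat p) x - x ^ p)"
    by (simp add: d hscale_of_nat_mult)
  also have "\<dots> = hscale (of_nat p) x + hscale (of_nat p) b - (x + b) ^ p"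
    by (simp add: artin_schreier.hyps hscale_diff hscale_add hscale_power)
  also have "\<dots> = of_nat p * (d + (e - frob_defect p x b))"
    unfolding prime_power_add[OF p, of x b] d e by (simp add: algebra_simps)
  finally have "hscale (of_nat p) d = d + (e - frob_defect p x b)"
    using prime_gt_0_nat[OF p] by (rule int_hahn_of_nat_cancel)
  moreover have "x \<in> artin_schreier_closure p"
    using artin_schreier.hyps by (rule artin_schreier_closure.artin_schreier)
  then have "e - frob_defect p x b \<in> artin_schreier_closure p"
    using artin_schreier.hyps(1) e(1) by (intro artin_schreier_closure_diff artin_schreier_closure_frob_defect)
  ultimately have "d \<in> artin_schreier_closure p"
    by (rule artin_schreier_closure.artin_schreier[rotated])
  then show ?case
    using d by blast
qed

section \<open>Approximation by algebraic elements\<close>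

text \<open>\<open>Alg f\<close> stands for algebraicity of the class of \<open>f\<close> modulo \<open>p - t\<close>.\<close>

locale algebraic_residues = residue_lift p T
  for p :: nat and T :: "'k::field \<Rightarrow> 'w::comm_ring_1" +
  fixes Alg :: "'w hahn \<Rightarrow> bool"
  assumes Alg_add: "Alg f \<Longrightarrow> Alg g \<Longrightarrow> Alg (f + g)"
    and Alg_mult: "Alg f \<Longrightarrow> Alg g \<Longrightarrow> Alg (f * g)"
    and Alg_uminus: "Alg f \<Longrightarrow> Alg (- f)"
    and Alg_monom: "Alg (hmonom q 1)"
    and Alg_artin_schreier: "Alg b \<Longrightarrow> p_minus_t p dvd x ^ p - x - b \<Longrightarrow> Alg x"
begin

text \<open>The class of \<open>f\<close> lies within valuation \<open>c\<close> of an algebraic element.\<close>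

definition near :: "rat \<Rightarrow> 'w hahn \<Rightarrow> bool" where
  "near c f \<longleftrightarrow> (\<exists>g h. Alg g \<and> hge c h \<and> p_minus_t p dvd f - (g + h))"

lemma nearI: "Alg g \<Longrightarrow> hge c h \<Longrightarrow> p_minus_t p dvd f - (g + h) \<Longrightarrow> near c f"
  by (auto simp: near_def)

lemma nearE:
  assumes "near c f"
  obtains g h k where "Alg g" "hge c h" "f = g + h + p_minus_t p * k"
proof -
  obtain g h where "Alg g" "hge c h" "p_minus_t p dvd f - (g + h)"
    using assms by (auto simp: near_def)
  moreover then obtain k where "f - (g + h) = p_minus_t p * k"
    by (auto elim: dvdE)
  then have "f = g + h + p_minus_t p * k"
    by (simp add: algebra_simps)
  ultimately show ?thesis
    using that by blast
qed

lemma near_mono: "near d f \<Longrightarrow> c \<le> d \<Longrightarrow> near c f"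
  unfolding near_def by (blast intro: hge_mono)

lemma Alg_1: "Alg 1"
  using Alg_monom[of 0] by (simp add: hmonom_0_1)

lemma Alg_power: "Alg f \<Longrightarrow> Alg (f ^ n)"
  by (induction n) (simp_all add: Alg_1 Alg_mult)

lemma near_Alg: "Alg f \<Longrightarrow> near c f"
  by (rule nearI[of f c 0]) simp_all

lemma near_add:
  assumes "near c f" "near c f'"
  shows "near c (f + f')"
proof -
  obtain g h k where f: "Alg g" "hge c h" "f = g + h + p_minus_t p * k"
    using assms(1) by (rule nearE)
  obtain g' h' k' where f': "Alg g'" "hge c h'" "f' = g' + h' + p_minus_t p * k'"
    using assms(2) by (rule nearE)
  have "f + f' - ((g + g') + (h + h')) = p_minus_t p * (k + k')"
    unfolding f f' by (simp add: algebra_simps)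
  then show ?thesis
    by (intro nearI[of "g + g'" c "h + h'"] Alg_add hge_add f f') simp
qed

lemma near_mult:
  assumes "0 \<le> e" "0 \<le> c" "hge (- e) f" "hge (- e) f'" "near c f" "near c f'"
  shows "near (c - e) (f * f')"
proof -
  obtain g h k where f: "Alg g" "hge c h" "f = g + h + p_minus_t p * k"
    using assms(5) by (rule nearE)
  obtain g' h' k' where f': "Alg g'" "hge c h'" "f' = g' + h' + p_minus_t p * k'"
    using assms(6) by (rule nearE)
  let ?h = "f * h' + h * f' - h * h'"
  have "hge (c - e) (f * h')" "hge (c - e) (h * f')" "hge (c - e) (h * h')"
    using hge_mult[OF assms(3) f'(2)] hge_mult[OF f(2) assms(4)] hge_mult[OF f(2) f'(2)] assms(1,2)
    by (auto elim: hge_mono)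
  then have "hge (c - e) ?h"
    by (intro hge_add hge_diff)
  moreover have "f * f' - (g * g' + ?h) = p_minus_t p * (k * g' + g * k' + p_minus_t p * k * k')"
    unfolding f f' by (simp add: algebra_simps)
  ultimately show ?thesis
    by (intro nearI[of "g * g'" "c - e" ?h] Alg_mult f f') simp_all
qed

text \<open>Multiplication by \<open>p\<close> raises the \<open>t\<close>-adic valuation by one modulo \<open>p - t\<close>.\<close>

lemma of_nat_p_eq: "of_nat p * f = hmonom 1 1 * f + p_minus_t p * f"
  by (simp add: p_minus_t_def algebra_simps)

lemma near_p_mult:
  assumes "near c f"
  shows "near (c + 1) (of_nat p * f)"
proof -
  obtain g h k where f: "Alg g" "hge c h" "f = g + h + p_minus_t p * k"
    using assms by (rule nearE)
  have "hge (c + 1) (hmonom 1 1 * h)"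
    using hge_mult[OF hge_hmonom f(2), of 1 1] by (simp add: add.commute)
  moreover have "of_nat p * f - (hmonom 1 1 * g + hmonom 1 1 * h) = p_minus_t p * (f + hmonom 1 1 * k)"
    unfolding of_nat_p_eq unfolding f by (simp add: algebra_simps)
  ultimately show ?thesis
    using f(1) by (intro nearI[of "hmonom 1 1 * g" _ "hmonom 1 1 * h"]) (auto intro: Alg_mult Alg_monom)
qed

text \<open>Writing \<open>f = h + (f - h)\<close> with \<open>f - h\<close> algebraic and \<open>h\<close> small, the error of \<open>(f - h)\<^sup>p\<close> consists of
  \<open>h\<^sup>p\<close> and of mixed terms, which carry a factor \<open>p\<close>.\<close>

lemma near_p_power:
  assumes "0 \<le> c" "0 \<le> e" "c' \<le> c + 1 - of_nat p * e" "c' \<le> 2 * c" "hge (- e) f" "near c f"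
  shows "near c' (f ^ p)"
proof -
  obtain g h k where f: "Alg g" "hge c h" "f = g + h + p_minus_t p * k"
    using assms(6) by (rule nearE)
  have p2: "p \<ge> 2"
    using p_prime by (rule prime_ge_2_nat)
  let ?d = "frob_defect p h (f - h)"
  let ?h = "h ^ p + hmonom 1 1 * ?d"
  have "hge (- e) (f - h)"
    using assms(1,2,5) f(2) by (intro hge_diff) (auto elim: hge_mono)
  then have "hge (c - of_nat p * e) ?d"
    using assms(1,2) f(2) by (intro hge_frob_defect)
  from hge_mult[OF hge_hmonom this, of 1 1] have "hge c' (hmonom 1 1 * ?d)"
    by (rule hge_mono) (use assms(3) in simp)
  moreover have "2 * c \<le> of_nat p * c"
    using p2 assms(1) by (intro mult_right_mono) auto
  then have "hge c' (h ^ p)"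
    using assms(4) by (intro hge_mono[OF hge_power[OF f(2)]]) simp
  ultimately have "hge c' ?h"
    by (intro hge_add)
  moreover have "p_minus_t p dvd f ^ p - (g ^ p + ?h)"
  proof -
    have "f ^ p = (h + (f - h)) ^ p"
      by simp
    also have "\<dots> = h ^ p + (f - h) ^ p + of_nat p * ?d"
      by (rule prime_power_add[OF p_prime])
    finally have "f ^ p - (g ^ p + ?h) = ((f - h) ^ p - g ^ p) + p_minus_t p * ?d"
      by (simp add: of_nat_p_eq[of ?d])
    moreover have "p_minus_t p dvd (f - h) - g"
      by (simp add: f)
    then have "p_minus_t p dvd (f - h) ^ p - g ^ p"
      by (rule dvd_trans) (simp add: power_diff_sumr2)
    ultimately show ?thesis
      by (simp only: dvd_add dvd_triv_left)
  qed
  ultimately show ?thesis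
    by (intro nearI[of "g ^ p" c' ?h] Alg_power f)
qed

text \<open>Hensel's lemma for \<open>X\<^sup>p - X - g\<close> at the approximate root \<open>z\<close>, where \<open>g\<close> is an algebraic approximation of
  \<open>b\<close>. The correction \<open>u\<close> is a fixed point of \<open>u \<mapsto> e0 + u\<^sup>p + t frob_defect p u z\<close>. Using \<open>t\<close> instead of the
  congruent \<open>p\<close> makes this map contracting for the \<open>t\<close>-adic valuation. The condition on \<open>e\<close> keeps the powers of
  \<open>z\<close>, whose valuation may be negative, from consuming the factor \<open>t\<close>.\<close>

lemma near_artin_schreier:
  assumes c: "0 < c" "c \<le> 1 - e" and e: "0 \<le> e" "2 * of_nat p * e \<le> 1"
    and z: "hge (- e) z" and d: "hge (- e) d" and b: "near c b"
    and eq: "z ^ p + of_nat p * d = z + b"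
  shows "near c z"
proof -
  obtain g h k where b: "Alg g" "hge c h" "b = g + h + p_minus_t p * k"
    using b by (rule nearE)
  have p2: "p \<ge> 2"
    using p_prime by (rule prime_ge_2_nat)
  then obtain m where m: "p = Suc (Suc m)"
    by (metis Suc_le_D numeral_2_eq_2 Suc_le_mono)
  define e0 where "e0 = h - hmonom 1 1 * d"
  have e0: "hge c e0"
    unfolding e0_def using c(2) hge_mult[OF hge_hmonom d, of 1 1]
    by (intro hge_diff b) (auto elim: hge_mono)
  let ?F = "\<lambda>u. frob_defect p u z"
  define \<Phi> where "\<Phi> u = e0 + (u ^ p + hmonom 1 1 * ?F u)" for u
  \<comment> \<open>\<open>u\<^sup>p\<close> contracts by \<open>c\<close>, the term with the factor \<open>t\<close> by at least \<open>1 - p e \<ge> 1 / 2\<close>.\<close>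
  define \<delta> where "\<delta> = min c (1 / 2)"
  have \<delta>: "0 < \<delta>" "\<delta> \<le> c" "\<delta> \<le> 1 / 2"
    using c(1) by (auto simp: \<delta>_def)
  obtain u where u: "hge c u" "\<Phi> u = u"
  proof (rule hahn_contraction_fixpoint[OF \<delta>(1), of c \<Phi>])
    fix u v :: "'w hahn" and d
    assume uv: "hge c u" "hge c v" "c \<le> d" "hge d (u - v)"
    have "u ^ p - v ^ p = u * (u ^ Suc m - v ^ Suc m) + (u - v) * v ^ Suc m"
      unfolding m by (simp add: algebra_simps)
    moreover have "hge (c + d) (u * (u ^ Suc m - v ^ Suc m))"
      using uv c(1) by (intro hge_mult hge_power_diff[of c]) auto
    moreover have "hge c (v ^ Suc m)"
      using hge_power[OF uv(2), of "Suc m"] by (rule hge_mono) (use c(1) in \<open>simp add: mult_le_cancel_right1\<close>)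
    then have "hge (d + c) ((u - v) * v ^ Suc m)"
      using uv by (intro hge_mult)
    ultimately have "hge (d + \<delta>) (u ^ p - v ^ p)"
      using \<delta>(2) by (auto intro!: hge_add elim: hge_mono)
    moreover have "hge (1 + (d - of_nat p * e)) (hmonom 1 1 * (?F u - ?F v))"
      using uv c(1) e(1) z by (intro hge_mult hge_hmonom hge_frob_defect_diff[of c]) auto
    then have "hge (d + \<delta>) (hmonom 1 1 * (?F u - ?F v))"
      by (rule hge_mono) (use \<delta>(3) e(2) in simp)
    ultimately have "hge (d + \<delta>) ((u ^ p - v ^ p) + hmonom 1 1 * (?F u - ?F v))"
      by (rule hge_add)
    then show "hge (d + \<delta>) (\<Phi> u - \<Phi> v)"
      by (simp add: \<Phi>_def algebra_simps)
  next
    fix u :: "'w hahn"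
    assume u: "hge c u"
    have "hge c (u ^ p)"
      using hge_power[OF u, of p] by (rule hge_mono) (use p2 c(1) in \<open>simp add: mult_le_cancel_right1\<close>)
    moreover have "hge (1 + (c - of_nat p * e)) (hmonom 1 1 * ?F u)"
      using u c(1) e(1) z by (intro hge_mult hge_hmonom hge_frob_defect) auto
    then have "hge c (hmonom 1 1 * ?F u)"
      by (rule hge_mono) (use e(2) in simp)
    ultimately show "hge c (\<Phi> u)"
      unfolding \<Phi>_def by (intro hge_add e0)
  qed
  have "(u + z) ^ p - (u + z) - g = (u ^ p + z ^ p + of_nat p * ?F u) - (u + z) - g"
    by (simp only: prime_power_add[OF p_prime])
  also have "\<dots> = (u ^ p + hmonom 1 1 * ?F u - u) + (z ^ p - z) - g + p_minus_t p * ?F u"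
    by (simp add: of_nat_p_eq[of "?F u"] algebra_simps)
  also have "z ^ p - z = b - of_nat p * d"
    using eq by (simp add: algebra_simps)
  also have "u ^ p + hmonom 1 1 * ?F u - u = - e0"
    using u(2) by (simp add: \<Phi>_def algebra_simps)
  also have "- e0 + (b - of_nat p * d) - g + p_minus_t p * ?F u = p_minus_t p * (k - d + ?F u)"
    by (simp add: e0_def b p_minus_t_def algebra_simps)
  finally have "Alg (u + z)"
    using Alg_artin_schreier[OF b(1)] by simp
  then show ?thesis
    using u(1) by (intro nearI[of "u + z" c "- u"] hge_uminus) simp_all
qed

text \<open>The \<open>n\<close>-fold inverse Frobenius lift \<open>\<phi>\<^sup>-\<^sup>n\<close>, followed by the change of coefficients.\<close>

abbreviation shrink :: "nat \<Rightarrow> int hahn \<Rightarrow> 'w hahn" where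
  "shrink n x \<equiv> hahn_of_int (hscale (1 / of_nat p ^ n) x)"

lemma p_pos: "0 < (of_nat p :: rat)"
  using prime_gt_0_nat[OF p_prime] by simp

lemma hge_shrink_eventually:
  assumes "0 < e"
  shows "\<forall>\<^sub>F n in sequentially. hge (- e) (shrink n x)"
proof -
  obtain c where c: "c \<le> 0" "hge c x"
    using ex_hge by blast
  have p2: "(2 :: rat) \<le> of_nat p"
    using prime_ge_2_nat[OF p_prime] by (metis of_nat_le_iff of_nat_numeral)
  obtain N :: nat where N: "- c / e < of_nat N"
    using reals_Archimedean2 by blast
  have "hge (- e) (shrink n x)" if "n \<ge> N" for n
  proof -
    have "(of_nat n :: rat) \<le> 2 ^ n"
      by (metis less_exp less_imp_le of_nat_le_iff of_nat_numeral of_nat_power)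
    also have "(2 :: rat) ^ n \<le> of_nat p ^ n"
      using p2 by (rule power_mono) simp
    finally have "(of_nat N :: rat) \<le> of_nat p ^ n"
      using that by linarith
    then have "- c / e \<le> of_nat p ^ n"
      using N by linarith
    then have "- e \<le> 1 / of_nat p ^ n * c"
      using assms p_pos by (simp add: field_simps)
    moreover have "hge (1 / of_nat p ^ n * c) (shrink n x)"
      using p_pos c(2) by (intro hge_hahn_of_int hge_hscale) simp_all
    ultimately show ?thesis
      by (rule hge_mono[rotated])
  qed
  then show ?thesis
    by (auto simp: eventually_sequentially)
qed

lemma shrink_add: "shrink n (x + y) = shrink n x + shrink n y"
  by (simp only: hscale_add hahn_of_int_add)

lemma shrink_mult: "shrink n (x * y) = shrink n x * shrink n y"
  by (simp only: hscale_mult hahn_of_int_mult)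

lemma shrink_power: "shrink n (x ^ k) = shrink n x ^ k"
  by (simp only: hscale_power hahn_of_int_power)

lemma shrink_of_nat_mult: "shrink n (of_nat k * x) = of_nat k * shrink n x"
  by (simp only: hscale_of_nat_mult hahn_of_int_of_nat_mult)

lemma shrink_hscale_inverse: "shrink n (hscale (1 / of_nat p) x) = shrink (Suc n) x"
  using p_pos by (simp add: hscale_hscale mult.commute)

lemma shrink_Suc_hscale: "shrink (Suc n) (hscale (of_nat p) x) = shrink n x"
  using p_pos by (simp add: hscale_hscale)

lemma shrink_hmonom: "shrink n (hmonom q 1) = hmonom (q / of_nat p ^ n) 1"
  using p_pos by (simp add: hscale_hmonom hahn_of_int_hmonom)

text \<open>Products lose some of the precision, since the factors may have negative valuation; this loss tends to zero
  with growing \<open>n\<close>, so that all bounds less than 1 remain reachable through the finitely many steps of the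
  construction.\<close>

lemma near_shrink_less_1:
  assumes "x \<in> artin_schreier_closure p" "0 < c" "c < 1"
  shows "\<forall>\<^sub>F n in sequentially. near c (shrink n x)"
  using assms
proof (induction arbitrary: c)
  case (monom q)
  then show ?case
    by (simp add: shrink_hmonom near_Alg Alg_monom)
next
  case neg_one
  have "shrink n (- 1) = - 1" for n
    by (simp add: hscale_uminus hscale_1 hahn_of_int_uminus hahn_of_int_1)
  then show ?case
    by (simp add: near_Alg Alg_uminus Alg_1)
next
  case (add x y)
  from add.IH(1)[OF add.prems] add.IH(2)[OF add.prems] show ?case
    by eventually_elim (simp only: shrink_add near_add)
next
  case (mult x y)
  \<comment> \<open>Factors are approximated within \<open>c'\<close>, the product then within \<open>c' - e = c\<close>.\<close>
  define c' where "c' = (c + 1) / 2"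
  define e where "e = (1 - c) / 2"
  have ce: "0 < c'" "c' < 1" "0 < e" "c = c' - e"
    using mult.prems by (auto simp: c'_def e_def field_simps)
  from mult.IH(1)[OF ce(1,2)] mult.IH(2)[OF ce(1,2)]
    hge_shrink_eventually[OF ce(3), of x] hge_shrink_eventually[OF ce(3), of y] show ?case
  proof eventually_elim
    case (elim n)
    then show ?case
      using near_mult[of e c' "shrink n x" "shrink n y"] ce by (simp add: shrink_mult)
  qed
next
  case (scale x)
  then have "\<forall>\<^sub>F n in sequentially. near c (shrink (Suc n) x)"
    using eventually_sequentially_Suc[of "\<lambda>n. near c (shrink n x)"] by blast
  then show ?case
    by (simp only: shrink_hscale_inverse)
next
  case (artin_schreier b x)
  obtain d where d: "hscale (of_nat p) x = x ^ p + of_nat p * d"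
    using frobenius_lift[OF p_prime] .
  define e where "e = min (1 - c) (1 / (2 * of_nat p))"
  have "e \<le> 1 / (2 * of_nat p)"
    unfolding e_def by (rule min.cobounded2)
  then have "2 * of_nat p * e \<le> 2 * of_nat p * (1 / (2 * of_nat p))"
    using p_pos by (intro mult_left_mono) simp_all
  then have "2 * of_nat p * e \<le> 1"
    using p_pos by simp
  moreover have "e \<le> 1 - c"
    unfolding e_def by (rule min.cobounded1)
  ultimately have e: "0 < e" "c \<le> 1 - e" "2 * of_nat p * e \<le> 1"
    using artin_schreier.prems p_pos by (simp_all add: e_def)
  from artin_schreier.IH[OF artin_schreier.prems]
    hge_shrink_eventually[OF e(1), of x] hge_shrink_eventually[OF e(1), of d] show ?case
  proof eventually_elim
    case (elim n)
    have "x ^ p + of_nat p * d = x + b"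
      using d artin_schreier.hyps(2) by simp
    then have "shrink n (x ^ p + of_nat p * d) = shrink n (x + b)"
      by simp
    then have "shrink n x ^ p + of_nat p * shrink n d = shrink n x + shrink n b"
      by (simp only: shrink_add shrink_power shrink_of_nat_mult)
    then show ?case
      using near_artin_schreier[of c e "shrink n x" "shrink n d" "shrink n b"] artin_schreier.prems e elim
      by simp
  qed
qed

text \<open>Induction on \<open>N\<close>, raising the bound by one through \<open>\<phi>\<^sup>-\<^sup>n x = z\<^sup>p + p \<delta>(z)\<close> with
  \<open>z = \<phi>\<^sup>-\<^sup>n\<^sup>-\<^sup>1 x\<close>.\<close>

lemma near_shrink:
  assumes "x \<in> artin_schreier_closure p" "0 < c" "c < of_nat (Suc N)"
  shows "\<forall>\<^sub>F n in sequentially. near c (shrink n x)"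
  using assms
proof (induction N arbitrary: c x)
  case 0
  then show ?case
    by (auto intro: near_shrink_less_1)
next
  case (Suc N)
  obtain d where d: "d \<in> artin_schreier_closure p" "hscale (of_nat p) x = x ^ p + of_nat p * d"
    using artin_schreier_closure_delta[OF p_prime Suc.prems(1)] by blast
  \<comment> \<open>A bound \<open>c' > c - 1\<close> serves the terms with a factor \<open>p\<close>, and \<open>c' > c / 2\<close> the \<open>p\<close>-th power of the error.\<close>
  define l where "l = max (c - 1) (c / 2)"
  define c' where "c' = (l + of_nat (Suc N)) / 2"
  have l: "l < of_nat (Suc N)" "0 < l"
    using Suc.prems by (auto simp: l_def)
  have c': "l < c'" "c' < of_nat (Suc N)" "0 < c'"
    using l by (auto simp: c'_def field_simps)
  have c'2: "c < c' + 1" "c < 2 * c'"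
    using c'(1) by (auto simp: l_def)
  define e where "e = (c' + 1 - c) / of_nat p"
  have e: "0 < e" "c \<le> c' + 1 - of_nat p * e"
    using c'2 p_pos by (auto simp: e_def field_simps)
  have ev: "\<exists>M. \<forall>n\<ge>M. P (Suc n)" if "\<forall>\<^sub>F n in sequentially. P n" for P :: "nat \<Rightarrow> bool"
    using that unfolding eventually_sequentially by (meson le_SucI)
  have "\<forall>\<^sub>F n in sequentially. near c' (shrink n x)"
    by (rule Suc.IH[OF Suc.prems(1) c'(3,2)])
  from ev[OF this] obtain A where A: "\<forall>n\<ge>A. near c' (shrink (Suc n) x)"
    by blast
  have "\<forall>\<^sub>F n in sequentially. near c' (shrink n d)"
    by (rule Suc.IH[OF d(1) c'(3,2)])
  from ev[OF this] obtain B where B: "\<forall>n\<ge>B. near c' (shrink (Suc n) d)"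
    by blast
  have "\<forall>\<^sub>F n in sequentially. hge (- e) (shrink n x)"
    by (rule hge_shrink_eventually[OF e(1)])
  from ev[OF this] obtain C where C: "\<forall>n\<ge>C. hge (- e) (shrink (Suc n) x)"
    by blast
  have "near c (shrink n x)" if "n \<ge> max A (max B C)" for n
  proof -
    have elim: "near c' (shrink (Suc n) x)" "near c' (shrink (Suc n) d)" "hge (- e) (shrink (Suc n) x)"
      using A B C that by simp_all
    have "shrink n x = shrink (Suc n) (x ^ p + of_nat p * d)"
      unfolding d(2)[symmetric] by (simp only: shrink_Suc_hscale)
    also have "\<dots> = shrink (Suc n) x ^ p + of_nat p * shrink (Suc n) d"
      by (simp only: shrink_add shrink_power shrink_of_nat_mult)
    finally have eq: "shrink n x = shrink (Suc n) x ^ p + of_nat p * shrink (Suc n) d" .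
    have "near c (shrink (Suc n) x ^ p)"
      using c'(3) c'2 e elim by (intro near_p_power[of c' e]) auto
    moreover have "near c (of_nat p * shrink (Suc n) d)"
      using near_p_mult[OF elim(2)] c'2(1) by (auto elim: near_mono)
    ultimately show ?thesis
      unfolding eq by (rule near_add)
  qed
  then show ?case
    unfolding eventually_sequentially by blast
qed

text \<open>Applying \<open>\<phi>\<^sup>-\<^sup>1\<close> to \<open>x\<close> changes it only by a monomial, so an approximation of \<open>\<phi>\<^sup>-\<^sup>n x\<close> can be turned
  back into one of \<open>x\<close>.\<close>

lemma near_of_hscale_eq_add_monom:
  assumes "x \<in> artin_schreier_closure p" and eq: "hscale (of_nat p) x = x + hmonom q 1"
  shows "near c (hahn_of_int x)"
proof -
  obtain N :: nat where N: "max c 1 < of_nat N"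
    using reals_Archimedean2 by blast
  then have "\<forall>\<^sub>F n in sequentially. near (max c 1) (shrink n x)"
    by (intro near_shrink[OF assms(1), of _ N]) auto
  then obtain n where "near (max c 1) (shrink n x)"
    by (auto simp: eventually_sequentially)
  then have n: "near c (shrink n x)"
    by (rule near_mono) simp
  have "near c (shrink m x)" if "near c (shrink (Suc m) x)" for m
  proof -
    have "shrink m x = shrink (Suc m) (hscale (of_nat p) x)"
      by (simp only: shrink_Suc_hscale)
    also have "\<dots> = shrink (Suc m) x + hmonom (q / of_nat p ^ Suc m) 1"
      unfolding eq by (simp only: shrink_add shrink_hmonom)
    finally show ?thesis
      using that by (auto intro: near_add near_Alg Alg_monom)
  qed
  with n have "near c (shrink 0 x)"
    by (induction n) auto
  then show ?thesis
    by (simp add: hscale_one_left)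
qed

end

section \<open>The series of \<open>p\<close>-power roots\<close>

definition root_sum :: "nat \<Rightarrow> 'a::comm_ring_1 hahn" where
  "root_sum p = Abs_hahn (\<lambda>q. if \<exists>k\<ge>1. q = - (1 / of_nat p ^ k) then 1 else 0)"

lemma wfp_on_neg_inverse_powers:
  assumes "p \<ge> 2"
  shows "wfp_on (range (\<lambda>k::nat. - (1 / of_nat p ^ k :: rat))) (<)"
proof -
  have "- (1 / of_nat p ^ a :: rat) < - (1 / of_nat p ^ b) \<longleftrightarrow> a < b" for a b :: nat
  proof -
    have p: "(1 :: rat) < of_nat p"
      using assms by simp
    then have "- (1 / of_nat p ^ a :: rat) < - (1 / of_nat p ^ b) \<longleftrightarrow> (of_nat p ^ a :: rat) < of_nat p ^ b"
      by (simp add: field_simps)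
    also have "\<dots> \<longleftrightarrow> a < b"
      using p by (rule power_strict_increasing_iff)
    finally show ?thesis .
  qed
  then show ?thesis
    by (subst wfp_on_image) simp
qed

lemma hcoeff_root_sum:
  assumes "p \<ge> 2"
  shows "hcoeff (root_sum p) q = (if \<exists>k\<ge>1. q = - (1 / of_nat p ^ k) then 1 else 0)"
  unfolding root_sum_def
  by (subst hcoeff_Abs, rule wfp_on_subset[OF wfp_on_neg_inverse_powers[OF assms]]) (auto split: if_splits)

lemma hahn_of_int_root_sum: "p \<ge> 2 \<Longrightarrow> hahn_of_int (root_sum p) = root_sum p"
  by (rule hahn_eqI) (simp add: hahn_of_int.rep_eq hcoeff_root_sum)

text \<open>Substituting \<open>t\<^sup>p\<close> shifts the summands by one place and adds the new first summand \<open>1/t\<close>.\<close>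

lemma hscale_root_sum:
  assumes "p \<ge> 2"
  shows "hscale (of_nat p) (root_sum p :: 'a::comm_ring_1 hahn) = root_sum p + hmonom (- 1) 1"
proof (rule hahn_eqI)
  fix q :: rat
  have p: "(of_nat p :: rat) > 1"
    using assms by simp
  have "(\<exists>k\<ge>1. q / of_nat p = - (1 / of_nat p ^ k)) \<longleftrightarrow> (\<exists>k. q = - (1 / of_nat p ^ k))"
  proof
    assume "\<exists>k\<ge>1. q / of_nat p = - (1 / of_nat p ^ k)"
    then obtain k where "k \<ge> 1" "q / of_nat p = - (1 / of_nat p ^ k)"
      by blast
    then obtain j where "q / of_nat p = - (1 / of_nat p ^ Suc j)"
      by (metis Suc_le_D One_nat_def)
    then show "\<exists>k. q = - (1 / of_nat p ^ k)"
      using p by (intro exI[of _ j]) (simp add: field_simps)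
  next
    assume "\<exists>k. q = - (1 / of_nat p ^ k)"
    then obtain k where "q = - (1 / of_nat p ^ k)"
      by blast
    then show "\<exists>k\<ge>1. q / of_nat p = - (1 / of_nat p ^ k)"
      using p by (intro exI[of _ "Suc k"]) (simp add: field_simps)
  qed
  also have "\<dots> \<longleftrightarrow> (\<exists>k\<ge>1. q = - (1 / of_nat p ^ k)) \<or> q = - 1"
  proof
    assume "\<exists>k. q = - (1 / of_nat p ^ k)"
    then obtain k where k: "q = - (1 / of_nat p ^ k)"
      by blast
    then show "(\<exists>k\<ge>1. q = - (1 / of_nat p ^ k)) \<or> q = - 1"
      by (cases "k = 0") (auto simp: Suc_le_eq)
  next
    assume "(\<exists>k\<ge>1. q = - (1 / of_nat p ^ k)) \<or> q = - 1"
    then show "\<exists>k. q = - (1 / of_nat p ^ k)"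
      by (auto intro: exI[of _ 0])
  qed
  finally have iff: "(\<exists>k\<ge>1. q / of_nat p = - (1 / of_nat p ^ k)) \<longleftrightarrow> (\<exists>k\<ge>1. q = - (1 / of_nat p ^ k)) \<or> q = - 1" .
  have excl: "\<not> (\<exists>k\<ge>1. - 1 = - (1 / (of_nat p :: rat) ^ k))"
  proof
    assume "\<exists>k\<ge>1. - 1 = - (1 / (of_nat p :: rat) ^ k)"
    then obtain k where k: "k \<ge> 1" "(of_nat p :: rat) ^ k = 1"
      by (auto simp: field_simps)
    then show False
      using p one_less_power[of "of_nat p :: rat" k] by simp
  qed
  show "hcoeff (hscale (of_nat p) (root_sum p :: 'a hahn)) q = hcoeff (root_sum p + hmonom (- 1) 1) q"
  proof (cases "q = - 1")
    case True
    then show ?thesis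
      using p iff excl by (simp only: hcoeff_hscale hcoeff_root_sum[OF assms] plus_hahn.rep_eq hmonom.rep_eq) simp
  next
    case False
    then show ?thesis
      using p iff by (simp only: hcoeff_hscale hcoeff_root_sum[OF assms] plus_hahn.rep_eq hmonom.rep_eq) simp
  qed
qed

context algebraic_residues
begin

theorem near_root_sum: "near c (root_sum p)"
proof -
  have p2: "p \<ge> 2"
    using p_prime by (rule prime_ge_2_nat)
  have "root_sum p \<in> artin_schreier_closure p"
    by (rule artin_schreier_closure.artin_schreier[OF artin_schreier_closure.monom hscale_root_sum[OF p2]])
  from near_of_hscale_eq_add_monom[OF this hscale_root_sum[OF p2]] show ?thesis
    by (simp add: hahn_of_int_root_sum[OF p2])
qed

end

section \<open>Integer polynomials as a free commutative ring\<close>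

definition mono_eval :: "('v \<Rightarrow> 'a::comm_ring_1) \<Rightarrow> ('v \<Rightarrow>\<^sub>0 nat) \<Rightarrow> 'a" where
  "mono_eval a m = (\<Prod>v\<in>Poly_Mapping.keys m. a v ^ Poly_Mapping.lookup m v)"

lemma mono_eval_superset:
  "finite V \<Longrightarrow> Poly_Mapping.keys m \<subseteq> V \<Longrightarrow> mono_eval a m = (\<Prod>v\<in>V. a v ^ Poly_Mapping.lookup m v)"
  unfolding mono_eval_def by (rule prod.mono_neutral_left) (auto simp: in_keys_iff)

lemma mono_eval_add: "mono_eval a (m + n) = mono_eval a m * mono_eval a n"
proof -
  let ?V = "Poly_Mapping.keys m \<union> Poly_Mapping.keys n"
  have "Poly_Mapping.keys (m + n) \<subseteq> ?V"
    by (rule Poly_Mapping.keys_add)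
  then show ?thesis
    by (simp add: mono_eval_superset[of ?V] lookup_add power_add prod.distrib)
qed

lemma mono_eval_0 [simp]: "mono_eval a 0 = 1"
  by (simp add: mono_eval_def)

lemma mpoly_eval_mono: "mpoly_eval a f = (\<Sum>m\<in>Poly_Mapping.keys f. of_int (Poly_Mapping.lookup f m) * mono_eval a m)"
  by (simp add: mpoly_eval_def mono_eval_def)

lemma mpoly_eval_add: "mpoly_eval a (f + g) = mpoly_eval a f + mpoly_eval a g"
  unfolding mpoly_eval_mono
  by (rule setsum_keys_plus_distrib[of "\<lambda>m c. of_int c * mono_eval a m"]) (simp_all add: distrib_right)

lemma mpoly_eval_0 [simp]: "mpoly_eval a 0 = 0"
  by (simp add: mpoly_eval_mono)

lemma mpoly_eval_single: "mpoly_eval a (Poly_Mapping.single m c) = of_int c * mono_eval a m"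
  by (cases "c = 0") (simp_all add: mpoly_eval_mono)

lemma int_mpoly_single_induct [case_names single add]:
  fixes f :: "'v int_mpoly"
  assumes single: "\<And>m c. P (Poly_Mapping.single m c)"
    and add: "\<And>f g. P f \<Longrightarrow> P g \<Longrightarrow> P (f + g)"
  shows "P f"
proof (induction f rule: Poly_Mapping.update_induct)
  case const
  show ?case
    using single[of 0 0] by simp
next
  case (update f m c)
  have "Poly_Mapping.update m c f = f + Poly_Mapping.single m c"
    using update.hyps(1)
    by (intro poly_mapping_eqI) (auto simp: lookup_update lookup_add lookup_single when_def in_keys_iff)
  then show ?case
    using add[OF update.IH single] by simp
qed

lemma mpoly_eval_mult: "mpoly_eval a (f * g) = mpoly_eval a f * mpoly_eval a g"
proof (induction f rule: int_mpoly_single_induct)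
  case (single m c)
  show ?case
  proof (induction g rule: int_mpoly_single_induct)
    case (single n d)
    then show ?case
      by (simp add: mult_single mpoly_eval_single mono_eval_add algebra_simps)
  qed (simp add: distrib_left mpoly_eval_add)
qed (simp add: distrib_right mpoly_eval_add)

lemma single_0_eq_of_int: "Poly_Mapping.single 0 c = (of_int c :: 'v int_mpoly)"
proof -
  have "Poly_Mapping.single 0 (of_int c :: int) = (of_int c :: 'v int_mpoly)"
    by (rule single_of_int)
  then show ?thesis
    by (simp only: of_int_eq_id id_apply)
qed

lemma mpoly_eval_of_int [simp]: "mpoly_eval a (of_int c) = of_int c"
  using mpoly_eval_single[of a 0 c] by (simp add: single_0_eq_of_int)

lemma mpoly_eval_1 [simp]: "mpoly_eval a 1 = 1"
  using mpoly_eval_of_int[of a 1] by simp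

lemma mpoly_eval_of_nat [simp]: "mpoly_eval a (of_nat n) = of_nat n"
  using mpoly_eval_of_int[of a "int n"] by simp

lemma mpoly_eval_uminus: "mpoly_eval a (- f) = - mpoly_eval a f"
  using mpoly_eval_add[of a f "- f"] by (simp add: eq_neg_iff_add_eq_0 add.commute)

lemma mpoly_eval_diff: "mpoly_eval a (f - g) = mpoly_eval a f - mpoly_eval a g"
  using mpoly_eval_add[of a f "- g"] by (simp add: mpoly_eval_uminus)

lemma mpoly_eval_power: "mpoly_eval a (f ^ n) = mpoly_eval a f ^ n"
  by (induction n) (simp_all add: mpoly_eval_mult)

lemma mpoly_eval_sum: "mpoly_eval a (\<Sum>i\<in>I. f i) = (\<Sum>i\<in>I. mpoly_eval a (f i))"
  by (induction I rule: infinite_finite_induct) (simp_all add: mpoly_eval_add)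

lemma mpoly_eval_var [simp]: "mpoly_eval a (mpoly_var v) = a v"
  by (simp add: mpoly_var_def mpoly_eval_single mono_eval_def)

lemma mpoly_var_power: "mpoly_var v ^ k = Poly_Mapping.single (Poly_Mapping.single v k) 1"
proof (induction k)
  case (Suc k)
  then show ?case
    by (simp add: mpoly_var_def mult_single single_add[symmetric])
qed simp

text \<open>Integer polynomials are generated as a ring by the variables, so ring homomorphisms on them are determined by
  the images of the variables.\<close>

lemma int_mpoly_induct [case_names of_int var add mult]:
  fixes f :: "'v int_mpoly"
  assumes of_int: "\<And>c. P (of_int c)" and var: "\<And>v. P (mpoly_var v)"
    and add: "\<And>f g. P f \<Longrightarrow> P g \<Longrightarrow> P (f + g)" and mult: "\<And>f g. P f \<Longrightarrow> P g \<Longrightarrow> P (f * g)"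
  shows "P f"
proof (induction f rule: int_mpoly_single_induct)
  case (single m c)
  have power: "P (mpoly_var v ^ k)" for v k
    using of_int[of 1] by (induction k) (auto intro: mult var)
  show ?case
  proof (induction m rule: Poly_Mapping.update_induct)
    case const
    then show ?case
      using of_int[of c] by (simp add: single_0_eq_of_int)
  next
    case (update m v k)
    have "Poly_Mapping.update v k m = Poly_Mapping.single v k + m"
      using update.hyps(1)
      by (intro poly_mapping_eqI) (auto simp: lookup_update lookup_add lookup_single when_def in_keys_iff)
    then have "Poly_Mapping.single (Poly_Mapping.update v k m) c = mpoly_var v ^ k * Poly_Mapping.single m c"
      by (simp add: mpoly_var_power mult_single)
    then show ?case
      using mult[OF power update.IH] by simp
  qed
qed (rule add)

lemma mpoly_eval_mpoly_eval: "mpoly_eval b (mpoly_eval a f) = mpoly_eval (\<lambda>v. mpoly_eval b (a v)) f"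
  by (induction f rule: int_mpoly_induct) (simp_all add: mpoly_eval_add mpoly_eval_mult)

lemma lookup_of_nat_mult:
  fixes f :: "'v int_mpoly"
  shows "Poly_Mapping.lookup (of_nat n * f) m = int n * Poly_Mapping.lookup f m"
  by (induction n) (simp_all add: distrib_right lookup_add)

lemma int_mpoly_of_nat_cancel:
  fixes f g :: "'v int_mpoly"
  assumes "of_nat n * f = of_nat n * g" "n > 0"
  shows "f = g"
proof (rule poly_mapping_eqI)
  fix m
  show "Poly_Mapping.lookup f m = Poly_Mapping.lookup g m"
    using arg_cong[OF assms(1), of "\<lambda>h. Poly_Mapping.lookup h m"] assms(2) by (simp add: lookup_of_nat_mult)
qed

lemma int_mpoly_of_nat_power_cancel:
  fixes f g :: "'v int_mpoly"
  assumes "of_nat n ^ k * f = of_nat n ^ k * g" "n > 0"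
  shows "f = g"
  using int_mpoly_of_nat_cancel[of "n ^ k" f g] assms by simp

section \<open>Ghost components and Dwork's congruences\<close>

text \<open>Each \<open>p\<close>-th power improves a congruence by one factor \<open>p\<close>.\<close>

lemma p_power_dvd_power_diff:
  fixes a b :: "'a::comm_ring_1"
  assumes p: "prime p" and ab: "of_nat p dvd a - b"
  shows "of_nat p ^ Suc m dvd a ^ (p ^ m) - b ^ (p ^ m)"
proof (induction m)
  case 0
  then show ?case
    using ab by simp
next
  case (Suc m)
  let ?A = "a ^ (p ^ m)" and ?B = "b ^ (p ^ m)"
  obtain c where c: "?A - ?B = of_nat p ^ Suc m * c"
    using Suc by (rule dvdE)
  define x where "x = of_nat p ^ Suc m * c"
  have "?A = x + ?B"
    using c by (simp add: x_def algebra_simps)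
  then have eq: "?A ^ p - ?B ^ p = x ^ p + of_nat p * frob_defect p x ?B"
    using prime_power_add[OF p, of x ?B] by simp
  have "Suc (Suc m) \<le> Suc m * p"
    using prime_ge_2_nat[OF p] by (metis mult_le_mono2 mult_2_right add_Suc_right le_add1 le_trans Suc_le_mono add_Suc)
  then have "of_nat p ^ Suc (Suc m) dvd x ^ p"
    unfolding x_def power_mult_distrib power_mult[symmetric] by (intro dvd_mult2 le_imp_power_dvd)
  moreover have "of_nat p ^ Suc m dvd frob_defect p x ?B"
    unfolding frob_defect_def
  proof (rule dvd_sum, rule dvd_mult2, rule dvd_mult)
    fix k assume "k \<in> {1..<p}"
    then have "x dvd x ^ k"
      by (intro dvd_power) auto
    then show "of_nat p ^ Suc m dvd x ^ k"
      unfolding x_def by (rule dvd_mult_left)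
  qed
  then have "of_nat p ^ Suc (Suc m) dvd of_nat p * frob_defect p x ?B"
    by (simp add: mult_dvd_mono)
  ultimately have "of_nat p ^ Suc (Suc m) dvd ?A ^ p - ?B ^ p"
    unfolding eq by (rule dvd_add)
  then show ?case
    by (simp add: power_mult[symmetric] mult.commute)
qed

lemma ghost_0 [simp]: "ghost p x 0 = x 0"
  by (simp add: ghost_def)

lemma ghost_split: "ghost p x n = (\<Sum>i<n. of_nat p ^ i * x i ^ (p ^ (n - i))) + of_nat p ^ n * x n"
  by (simp add: ghost_def lessThan_Suc_atMost[symmetric])

lemma mpoly_eval_ghost: "mpoly_eval e (ghost p x n) = ghost p (\<lambda>i. mpoly_eval e (x i)) n"
  by (simp add: ghost_def mpoly_eval_sum mpoly_eval_mult mpoly_eval_power)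

text \<open>The ring endomorphism that raises every variable to its \<open>p\<close>-th power; it lifts the Frobenius map modulo
  \<open>p\<close>.\<close>

definition mpoly_frob :: "nat \<Rightarrow> 'v int_mpoly \<Rightarrow> 'v int_mpoly" where
  "mpoly_frob p = mpoly_eval (\<lambda>v. mpoly_var v ^ p)"

lemma mpoly_frob_cong:
  assumes p: "prime p"
  shows "of_nat p dvd mpoly_frob p f - f ^ p"
proof (induction f rule: int_mpoly_induct)
  case (of_int c)
  have "int p dvd c - c ^ p"
    using int_prime_dvd_power_minus_self[OF p, of c] by (simp add: dvd_diff_commute)
  then obtain k where "c - c ^ p = int p * k"
    by (rule dvdE)
  then have "(of_int (c - c ^ p) :: 'a int_mpoly) = of_int (int p * k)"
    by simp
  then show ?case
    by (simp add: mpoly_frob_def)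
next
  case (var v)
  then show ?case
    by (simp add: mpoly_frob_def)
next
  case (add f g)
  have "mpoly_frob p (f + g) - (f + g) ^ p
      = (mpoly_frob p f - f ^ p) + (mpoly_frob p g - g ^ p) - of_nat p * frob_defect p f g"
    unfolding prime_power_add[OF p] by (simp add: mpoly_frob_def mpoly_eval_add)
  then show ?case
    using add by (simp add: dvd_diff)
next
  case (mult f g)
  have "mpoly_frob p (f * g) - (f * g) ^ p
      = (mpoly_frob p f - f ^ p) * mpoly_frob p g + f ^ p * (mpoly_frob p g - g ^ p)"
    by (simp add: mpoly_frob_def mpoly_eval_mult power_mult_distrib algebra_simps)
  then show ?case
    using mult by simp
qed

text \<open>The sum is the ghost component of index \<open>n + 1\<close> without its last term. Replacing \<open>x\<^sub>i\<^sup>p\<close> by the congruent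
  Frobenius image changes the \<open>i\<close>-th term only by a multiple of \<open>p\<^sup>i p\<^bsup>n+1-i\<^esup>\<close>.\<close>

lemma mpoly_frob_ghost_cong:
  assumes p: "prime p"
  shows "of_nat p ^ Suc n dvd (\<Sum>i<Suc n. of_nat p ^ i * x i ^ (p ^ (Suc n - i))) - mpoly_frob p (ghost p x n)"
proof -
  have "(\<Sum>i<Suc n. of_nat p ^ i * x i ^ (p ^ (Suc n - i))) - mpoly_frob p (ghost p x n)
      = (\<Sum>i<Suc n. of_nat p ^ i * ((x i ^ p) ^ (p ^ (n - i)) - mpoly_frob p (x i) ^ (p ^ (n - i))))"
    unfolding mpoly_frob_def mpoly_eval_ghost unfolding ghost_def lessThan_Suc_atMost sum_subtractf[symmetric]
    by (rule sum.cong) (auto simp: Suc_diff_le power_mult[symmetric] right_diff_distrib)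
  also have "of_nat p ^ Suc n dvd \<dots>"
  proof (rule dvd_sum)
    fix i assume "i \<in> {..<Suc n}"
    then have n: "Suc n = i + Suc (n - i)"
      by simp
    have "of_nat p dvd x i ^ p - mpoly_frob p (x i)"
      using mpoly_frob_cong[OF p, of "x i"] by (metis dvd_minus_iff minus_diff_eq)
    then have "of_nat p ^ Suc (n - i) dvd (x i ^ p) ^ (p ^ (n - i)) - mpoly_frob p (x i) ^ (p ^ (n - i))"
      by (rule p_power_dvd_power_diff[OF p])
    then have "of_nat p ^ i * of_nat p ^ Suc (n - i) dvd of_nat p ^ i * ((x i ^ p) ^ (p ^ (n - i)) - mpoly_frob p (x i) ^ (p ^ (n - i)))"
      by (rule mult_dvd_mono[OF dvd_refl])
    then show "of_nat p ^ Suc n dvd of_nat p ^ i * ((x i ^ p) ^ (p ^ (n - i)) - mpoly_frob p (x i) ^ (p ^ (n - i)))"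
      unfolding power_add[symmetric] n[symmetric] .
  qed
  finally show ?thesis .
qed

lemma ghost_dwork:
  assumes p: "prime p"
  shows "of_nat p ^ Suc n dvd ghost p x (Suc n) - mpoly_frob p (ghost p x n)"
proof -
  have "ghost p x (Suc n) - mpoly_frob p (ghost p x n)
      = ((\<Sum>i<Suc n. of_nat p ^ i * x i ^ (p ^ (Suc n - i))) - mpoly_frob p (ghost p x n)) + of_nat p ^ Suc n * x (Suc n)"
    unfolding ghost_split[of p x "Suc n"] by simp
  also have "of_nat p ^ Suc n dvd \<dots>"
    by (intro dvd_add mpoly_frob_ghost_cong[OF p]) simp
  finally show ?thesis .
qed

text \<open>Dwork's criterion: the components are found one after the other, and the congruence says precisely that
  \<open>p\<^sup>n\<close> divides what is left for the \<open>n\<close>-th one.\<close>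

lemma dwork_ghost_exists:
  fixes g :: "nat \<Rightarrow> 'v int_mpoly"
  assumes p: "prime p" and g: "\<And>n. of_nat p ^ Suc n dvd g (Suc n) - mpoly_frob p (g n)"
  shows "\<exists>s. \<forall>n. ghost p s n = g n"
proof -
  let ?P = "\<lambda>s n r. g n = (\<Sum>i<n. of_nat p ^ i * s i ^ (p ^ (n - i))) + of_nat p ^ n * r"
  have "\<exists>s. \<forall>n. ?P s n (s n)"
  proof (rule dependent_wf_choice[OF wf_less_than])
    fix s s' :: "nat \<Rightarrow> 'v int_mpoly" and n r
    assume "\<And>m. (m, n) \<in> less_than \<Longrightarrow> s m = s' m"
    then have "(\<Sum>i<n. of_nat p ^ i * s i ^ (p ^ (n - i))) = (\<Sum>i<n. of_nat p ^ i * s' i ^ (p ^ (n - i)))"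
      by (intro sum.cong) auto
    then show "?P s n r = ?P s' n r"
      by simp
  next
    fix n and s :: "nat \<Rightarrow> 'v int_mpoly"
    assume IH: "\<And>m. (m, n) \<in> less_than \<Longrightarrow> ?P s m (s m)"
    show "\<exists>r. ?P s n r"
    proof (cases n)
      case 0
      then show ?thesis
        by simp
    next
      case (Suc k)
      have "ghost p s k = g k"
        using IH[of k] by (simp add: Suc ghost_split)
      then have "of_nat p ^ n dvd (\<Sum>i<n. of_nat p ^ i * s i ^ (p ^ (n - i))) - mpoly_frob p (g k)"
        using mpoly_frob_ghost_cong[OF p, of k s] by (simp only: Suc)
      then have "of_nat p ^ n dvd (g n - mpoly_frob p (g k)) - ((\<Sum>i<n. of_nat p ^ i * s i ^ (p ^ (n - i))) - mpoly_frob p (g k))"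
        using g[of k] unfolding Suc by (rule dvd_diff[rotated])
      then have "of_nat p ^ n dvd g n - (\<Sum>i<n. of_nat p ^ i * s i ^ (p ^ (n - i)))"
        by simp
      then obtain r where "g n - (\<Sum>i<n. of_nat p ^ i * s i ^ (p ^ (n - i))) = of_nat p ^ n * r"
        by (rule dvdE)
      then show ?thesis
        by (intro exI[of _ r]) (simp add: algebra_simps)
    qed
  qed
  then obtain s where s: "\<And>n. ?P s n (s n)"
    by blast
  have "ghost p s n = g n" for n
    unfolding ghost_split by (rule s[symmetric])
  then show ?thesis
    by blast
qed

lemma ghost_inj:
  fixes x y :: "nat \<Rightarrow> 'v int_mpoly"
  assumes p: "p > 0" and eq: "\<And>n. ghost p x n = ghost p y n"
  shows "x = y"
proof
  fix n
  show "x n = y n"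
  proof (induction n rule: less_induct)
    case (less n)
    then have "(\<Sum>i<n. of_nat p ^ i * x i ^ (p ^ (n - i))) = (\<Sum>i<n. of_nat p ^ i * y i ^ (p ^ (n - i)))"
      by simp
    then show ?case
      using eq[of n] int_mpoly_of_nat_power_cancel[OF _ p] unfolding ghost_split by simp
  qed
qed

text \<open>Together with \<open>ghost_inj\<close> this reduces identities between Witt vectors to identities between ghost components,
  over the integers and modulo \<open>p\<close>.\<close>

lemma ghost_cong:
  fixes x y :: "nat \<Rightarrow> 'v int_mpoly"
  assumes p: "prime p" and dvd: "\<And>n. of_nat p ^ Suc n dvd ghost p x n - ghost p y n"
  shows "of_nat p dvd x n - y n"
proof (induction n rule: less_induct)
  case (less n)
  have "of_nat p ^ Suc n dvd (\<Sum>i<n. of_nat p ^ i * (x i ^ (p ^ (n - i)) - y i ^ (p ^ (n - i))))"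
  proof (rule dvd_sum)
    fix i assume "i \<in> {..<n}"
    then have n: "Suc n = i + Suc (n - i)" and "of_nat p dvd x i - y i"
      using less by auto
    then have "of_nat p ^ i * of_nat p ^ Suc (n - i) dvd of_nat p ^ i * (x i ^ (p ^ (n - i)) - y i ^ (p ^ (n - i)))"
      by (intro mult_dvd_mono[OF dvd_refl] p_power_dvd_power_diff[OF p])
    then show "of_nat p ^ Suc n dvd of_nat p ^ i * (x i ^ (p ^ (n - i)) - y i ^ (p ^ (n - i)))"
      unfolding power_add[symmetric] n[symmetric] .
  qed
  moreover have "of_nat p ^ n * (x n - y n) = (ghost p x n - ghost p y n)
      - (\<Sum>i<n. of_nat p ^ i * (x i ^ (p ^ (n - i)) - y i ^ (p ^ (n - i))))"
    unfolding ghost_split by (simp add: right_diff_distrib sum_subtractf)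
  ultimately have "of_nat p ^ Suc n dvd of_nat p ^ n * (x n - y n)"
    using dvd[of n] by (simp only: dvd_diff)
  then obtain k where "of_nat p ^ n * (x n - y n) = of_nat p ^ Suc n * k"
    by (rule dvdE)
  then have "of_nat p ^ n * (x n - y n) = of_nat p ^ n * (of_nat p * k)"
    by (simp add: mult.assoc mult.left_commute)
  then show ?case
    using int_mpoly_of_nat_power_cancel[OF _ prime_gt_0_nat[OF p]] by fastforce
qed

lemma ghost_add_exists:
  fixes x y :: "nat \<Rightarrow> 'v int_mpoly"
  assumes p: "prime p"
  shows "\<exists>s. \<forall>n. ghost p s n = ghost p x n + ghost p y n"
proof (rule dwork_ghost_exists[OF p])
  fix n
  have "of_nat p ^ Suc n dvd (ghost p x (Suc n) - mpoly_frob p (ghost p x n)) + (ghost p y (Suc n) - mpoly_frob p (ghost p y n))"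
    by (rule dvd_add[OF ghost_dwork[OF p] ghost_dwork[OF p]])
  then show "of_nat p ^ Suc n dvd ghost p x (Suc n) + ghost p y (Suc n) - mpoly_frob p (ghost p x n + ghost p y n)"
    by (simp add: mpoly_frob_def mpoly_eval_add algebra_simps)
qed

lemma ghost_mult_exists:
  fixes x y :: "nat \<Rightarrow> 'v int_mpoly"
  assumes p: "prime p"
  shows "\<exists>s. \<forall>n. ghost p s n = ghost p x n * ghost p y n"
proof (rule dwork_ghost_exists[OF p])
  fix n
  have "of_nat p ^ Suc n dvd (ghost p x (Suc n) - mpoly_frob p (ghost p x n)) * ghost p y (Suc n)
      + mpoly_frob p (ghost p x n) * (ghost p y (Suc n) - mpoly_frob p (ghost p y n))"
    by (rule dvd_add[OF dvd_mult2[OF ghost_dwork[OF p]] dvd_mult[OF ghost_dwork[OF p]]])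
  then show "of_nat p ^ Suc n dvd ghost p x (Suc n) * ghost p y (Suc n) - mpoly_frob p (ghost p x n * ghost p y n)"
    by (simp add: mpoly_frob_def mpoly_eval_mult algebra_simps)
qed

lemma ghost_uminus_exists:
  fixes x :: "nat \<Rightarrow> 'v int_mpoly"
  assumes p: "prime p"
  shows "\<exists>s. \<forall>n. ghost p s n = - ghost p x n"
proof (rule dwork_ghost_exists[OF p])
  fix n
  have "of_nat p ^ Suc n dvd - (ghost p x (Suc n) - mpoly_frob p (ghost p x n))"
    unfolding dvd_minus_iff by (rule ghost_dwork[OF p])
  then show "of_nat p ^ Suc n dvd - ghost p x (Suc n) - mpoly_frob p (- ghost p x n)"
    by (simp add: mpoly_frob_def mpoly_eval_uminus algebra_simps)
qed

lemma ghost_witt_add_poly: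
  assumes p: "prime p"
  shows "ghost p (witt_add_poly p) n = ghost p (\<lambda>i. mpoly_var (Inl i)) n + ghost p (\<lambda>i. mpoly_var (Inr i)) n"
proof -
  let ?Q = "\<lambda>s. \<forall>n. ghost p s n = ghost p (\<lambda>i. mpoly_var (Inl i)) n + ghost p (\<lambda>i. mpoly_var (Inr i :: nat + nat)) n"
  have "\<exists>!s. ?Q s"
  proof (rule ex_ex1I)
    show "\<exists>s. ?Q s"
      by (rule ghost_add_exists[OF p])
    show "s = s'" if "?Q s" "?Q s'" for s s'
      by (rule ghost_inj[OF prime_gt_0_nat[OF p]]) (use that in simp)
  qed
  then have "?Q (THE s. ?Q s)"
    by (rule theI')
  then show ?thesis
    unfolding witt_add_poly_def by blast
qed

lemma ghost_witt_mult_poly: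
  assumes p: "prime p"
  shows "ghost p (witt_mult_poly p) n = ghost p (\<lambda>i. mpoly_var (Inl i)) n * ghost p (\<lambda>i. mpoly_var (Inr i)) n"
proof -
  let ?Q = "\<lambda>s. \<forall>n. ghost p s n = ghost p (\<lambda>i. mpoly_var (Inl i)) n * ghost p (\<lambda>i. mpoly_var (Inr i :: nat + nat)) n"
  have "\<exists>!s. ?Q s"
  proof (rule ex_ex1I)
    show "\<exists>s. ?Q s"
      by (rule ghost_mult_exists[OF p])
    show "s = s'" if "?Q s" "?Q s'" for s s'
      by (rule ghost_inj[OF prime_gt_0_nat[OF p]]) (use that in simp)
  qed
  then have "?Q (THE s. ?Q s)"
    by (rule theI')
  then show ?thesis
    unfolding witt_mult_poly_def by blast
qed

section \<open>The ring of Witt vectors\<close>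

definition witt_add :: "nat \<Rightarrow> (nat \<Rightarrow> 'a::comm_ring_1) \<Rightarrow> (nat \<Rightarrow> 'a) \<Rightarrow> nat \<Rightarrow> 'a" where
  "witt_add p a b n = mpoly_eval (case_sum a b) (witt_add_poly p n)"

definition witt_mult :: "nat \<Rightarrow> (nat \<Rightarrow> 'a::comm_ring_1) \<Rightarrow> (nat \<Rightarrow> 'a) \<Rightarrow> nat \<Rightarrow> 'a" where
  "witt_mult p a b n = mpoly_eval (case_sum a b) (witt_mult_poly p n)"

lemma ghost_witt_add:
  assumes "prime p"
  shows "ghost p (witt_add p a b) n = ghost p a n + ghost p b n"
proof -
  have "ghost p (witt_add p a b) n = mpoly_eval (case_sum a b) (ghost p (witt_add_poly p) n)"
    by (simp add: mpoly_eval_ghost witt_add_def[abs_def])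
  then show ?thesis
    by (simp add: ghost_witt_add_poly[OF assms] mpoly_eval_add mpoly_eval_ghost)
qed

lemma ghost_witt_mult:
  assumes "prime p"
  shows "ghost p (witt_mult p a b) n = ghost p a n * ghost p b n"
proof -
  have "ghost p (witt_mult p a b) n = mpoly_eval (case_sum a b) (ghost p (witt_mult_poly p) n)"
    by (simp add: mpoly_eval_ghost witt_mult_def[abs_def])
  then show ?thesis
    by (simp add: ghost_witt_mult_poly[OF assms] mpoly_eval_mult mpoly_eval_ghost)
qed

lemma ghost_teichmuller:
  assumes "p > 0"
  shows "ghost p (teichmuller a) n = a ^ (p ^ n)"
proof -
  have "ghost p (teichmuller a) n = (\<Sum>i\<in>{..n}. if i = 0 then a ^ (p ^ n) else 0)"
    unfolding ghost_def by (rule sum.cong) (use assms in \<open>auto simp: teichmuller_def power_0_left\<close>)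
  then show ?thesis
    by simp
qed

lemma ghost_zero: "p > 0 \<Longrightarrow> ghost p (\<lambda>_. 0) n = 0"
  by (simp add: ghost_def power_0_left)

text \<open>Every Witt vector over \<open>'a\<close> is the image of one over the polynomial ring whose variables are the elements of
  \<open>'a\<close> themselves. There the ghost map is injective, so ring identities can be checked on ghost components and then
  mapped down.\<close>

definition witt_map :: "(nat \<Rightarrow> 'a::comm_ring_1 int_mpoly) \<Rightarrow> nat \<Rightarrow> 'a" where
  "witt_map x n = mpoly_eval (\<lambda>a. a) (x n)"

definition witt_lift :: "(nat \<Rightarrow> 'a) \<Rightarrow> nat \<Rightarrow> 'a int_mpoly" where
  "witt_lift a n = mpoly_var (a n)"

lemma witt_map_lift [simp]: "witt_map (witt_lift a) = a"
  by (simp add: witt_map_def witt_lift_def fun_eq_iff)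

lemma witt_map_add: "witt_map (witt_add p x y) = witt_add p (witt_map x) (witt_map y)"
proof
  fix n
  have "(\<lambda>v. mpoly_eval (\<lambda>a. a) (case_sum x y v)) = case_sum (witt_map x) (witt_map y)"
    by (auto simp: fun_eq_iff witt_map_def split: sum.split)
  then show "witt_map (witt_add p x y) n = witt_add p (witt_map x) (witt_map y) n"
    unfolding witt_map_def[of "witt_add p x y"] witt_add_def mpoly_eval_mpoly_eval by simp
qed

lemma witt_map_mult: "witt_map (witt_mult p x y) = witt_mult p (witt_map x) (witt_map y)"
proof
  fix n
  have "(\<lambda>v. mpoly_eval (\<lambda>a. a) (case_sum x y v)) = case_sum (witt_map x) (witt_map y)"
    by (auto simp: fun_eq_iff witt_map_def split: sum.split)
  then show "witt_map (witt_mult p x y) n = witt_mult p (witt_map x) (witt_map y) n"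
    unfolding witt_map_def[of "witt_mult p x y"] witt_mult_def mpoly_eval_mpoly_eval by simp
qed

lemma witt_map_teichmuller: "witt_map (teichmuller x) = teichmuller (mpoly_eval (\<lambda>a. a) x)"
  by (auto simp: witt_map_def teichmuller_def)

lemma witt_map_zero [simp]: "witt_map (\<lambda>_. 0) = (\<lambda>_. 0)"
  by (simp add: witt_map_def fun_eq_iff)

text \<open>The negative is taken over the polynomial ring, where Dwork's criterion provides it, and mapped down.\<close>

definition witt_neg :: "nat \<Rightarrow> (nat \<Rightarrow> 'a::comm_ring_1) \<Rightarrow> nat \<Rightarrow> 'a" where
  "witt_neg p a = witt_map (SOME s. \<forall>n. ghost p s n = - ghost p (witt_lift a) n)"

context
  fixes p :: nat
  assumes p: "prime p"
begin

lemma ghost_injI: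
  fixes x y :: "nat \<Rightarrow> 'v int_mpoly"
  shows "(\<And>n. ghost p x n = ghost p y n) \<Longrightarrow> x = y"
  by (rule ghost_inj[OF prime_gt_0_nat[OF p]])

lemmas ghost_simps = ghost_witt_add[OF p] ghost_witt_mult[OF p]
  ghost_zero[OF prime_gt_0_nat[OF p]] ghost_teichmuller[OF prime_gt_0_nat[OF p]]

lemma witt_add_assoc: "witt_add p (witt_add p a b) c = witt_add p a (witt_add p b c)"
proof -
  have "witt_add p (witt_add p (witt_lift a) (witt_lift b)) (witt_lift c)
      = witt_add p (witt_lift a) (witt_add p (witt_lift b) (witt_lift c))"
    by (rule ghost_injI) (simp add: ghost_simps)
  from arg_cong[OF this, of witt_map] show ?thesis
    by (simp add: witt_map_add)
qed

lemma witt_add_commute: "witt_add p a b = witt_add p b a"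
proof -
  have "witt_add p (witt_lift a) (witt_lift b) = witt_add p (witt_lift b) (witt_lift a)"
    by (rule ghost_injI) (simp add: ghost_simps)
  from arg_cong[OF this, of witt_map] show ?thesis
    by (simp add: witt_map_add)
qed

lemma witt_add_0: "witt_add p (\<lambda>_. 0) a = a"
proof -
  have "witt_add p (\<lambda>_. 0) (witt_lift a) = witt_lift a"
    by (rule ghost_injI) (simp add: ghost_simps)
  from arg_cong[OF this, of witt_map] show ?thesis
    by (simp add: witt_map_add)
qed

lemma witt_add_neg: "witt_add p (witt_neg p a) a = (\<lambda>_. 0)"
proof -
  define s where "s = (SOME s. \<forall>n. ghost p s n = - ghost p (witt_lift a) n)"
  have s: "\<forall>n. ghost p s n = - ghost p (witt_lift a) n"
    unfolding s_def by (rule someI_ex[OF ghost_uminus_exists[OF p]])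
  have "witt_add p s (witt_lift a) = (\<lambda>_. 0)"
    by (rule ghost_injI) (simp add: ghost_simps s)
  from arg_cong[OF this, of witt_map] show ?thesis
    by (simp add: witt_map_add witt_neg_def s_def)
qed

lemma witt_mult_assoc: "witt_mult p (witt_mult p a b) c = witt_mult p a (witt_mult p b c)"
proof -
  have "witt_mult p (witt_mult p (witt_lift a) (witt_lift b)) (witt_lift c)
      = witt_mult p (witt_lift a) (witt_mult p (witt_lift b) (witt_lift c))"
    by (rule ghost_injI) (simp add: ghost_simps)
  from arg_cong[OF this, of witt_map] show ?thesis
    by (simp add: witt_map_mult)
qed

lemma witt_mult_commute: "witt_mult p a b = witt_mult p b a"
proof -
  have "witt_mult p (witt_lift a) (witt_lift b) = witt_mult p (witt_lift b) (witt_lift a)"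
    by (rule ghost_injI) (simp add: ghost_simps)
  from arg_cong[OF this, of witt_map] show ?thesis
    by (simp add: witt_map_mult)
qed

lemma witt_mult_1: "witt_mult p (teichmuller 1) a = a"
proof -
  have "witt_mult p (teichmuller 1) (witt_lift a) = witt_lift a"
    by (rule ghost_injI) (simp add: ghost_simps)
  from arg_cong[OF this, of witt_map] show ?thesis
    by (simp add: witt_map_mult witt_map_teichmuller)
qed

lemma witt_distrib: "witt_mult p (witt_add p a b) c = witt_add p (witt_mult p a c) (witt_mult p b c)"
proof -
  have "witt_mult p (witt_add p (witt_lift a) (witt_lift b)) (witt_lift c)
      = witt_add p (witt_mult p (witt_lift a) (witt_lift c)) (witt_mult p (witt_lift b) (witt_lift c))"
    by (rule ghost_injI) (simp add: ghost_simps distrib_right)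
  from arg_cong[OF this, of witt_map] show ?thesis
    by (simp add: witt_map_mult witt_map_add)
qed

lemma witt_mult_teichmuller: "witt_mult p (teichmuller a) (teichmuller b) = teichmuller (a * b)"
proof -
  have "witt_mult p (teichmuller (mpoly_var a)) (teichmuller (mpoly_var b)) = teichmuller (mpoly_var a * mpoly_var b)"
    by (rule ghost_injI) (simp add: ghost_simps power_mult_distrib)
  from arg_cong[OF this, of witt_map] show ?thesis
    by (simp add: witt_map_mult witt_map_teichmuller mpoly_eval_mult)
qed

lemma witt_add_comp_0: "witt_add p a b 0 = a 0 + b 0"
  using ghost_witt_add[OF p, of a b 0] by simp

text \<open>In characteristic \<open>p\<close>, multiplication by \<open>p\<close> is the Frobenius map followed by a shift. Over the polynomial
  ring the two sides have ghost components that agree up to the multiple \<open>p\<^bsup>n+1\<^esup>\<close> required by \<open>ghost_cong\<close>.\<close>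

lemma witt_p_fold_add:
  fixes a :: "nat \<Rightarrow> 'a::comm_ring_1"
  assumes char: "of_nat p = (0 :: 'a)"
  shows "(witt_add p a ^^ p) (\<lambda>_. 0) = case_nat 0 (\<lambda>n. a n ^ p)"
proof
  fix n
  define x where "x = witt_lift a"
  define y where "y = case_nat 0 (\<lambda>n. x n ^ p)"
  have fold: "ghost p ((witt_add p x ^^ k) (\<lambda>_. 0)) n = of_nat k * ghost p x n" for k n
    by (induction k) (simp_all add: ghost_simps distrib_right)
  have fold_map: "witt_map ((witt_add p x ^^ k) (\<lambda>_. 0)) = (witt_add p a ^^ k) (\<lambda>_. 0)" for k
    by (induction k) (simp_all add: witt_map_add x_def)
  have "of_nat p dvd (witt_add p x ^^ p) (\<lambda>_. 0) n - y n"
  proof (rule ghost_cong[OF p])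
    fix n
    show "of_nat p ^ Suc n dvd ghost p ((witt_add p x ^^ p) (\<lambda>_. 0)) n - ghost p y n"
    proof (cases n)
      case 0
      then show ?thesis
        using fold[of p 0] by (simp add: y_def)
    next
      case (Suc m)
      have "ghost p y n = (\<Sum>i<Suc m. of_nat p ^ Suc i * (x i ^ p) ^ (p ^ (m - i)))"
        using prime_gt_0_nat[OF p]
        by (simp add: ghost_def lessThan_Suc_atMost[symmetric] Suc y_def sum.lessThan_Suc_shift power_0_left del: sum.lessThan_Suc)
      also have "\<dots> = of_nat p * (\<Sum>i<Suc m. of_nat p ^ i * x i ^ (p ^ (Suc m - i)))"
        unfolding sum_distrib_left
        by (rule sum.cong) (auto simp: Suc_diff_le power_mult[symmetric] mult.assoc)
      finally have "ghost p ((witt_add p x ^^ p) (\<lambda>_. 0)) n - ghost p y n = of_nat p ^ Suc n * x n"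
        unfolding fold ghost_split[of p x n] by (simp add: Suc distrib_left mult.assoc)
      then show ?thesis
        by simp
    qed
  qed
  then obtain k where "(witt_add p x ^^ p) (\<lambda>_. 0) n - y n = of_nat p * k"
    by (rule dvdE)
  from arg_cong[OF this, of "mpoly_eval (\<lambda>a. a)"]
  have "witt_map ((witt_add p x ^^ p) (\<lambda>_. 0)) n = witt_map y n"
    by (simp add: mpoly_eval_diff mpoly_eval_mult char witt_map_def)
  moreover have "witt_map y n = case_nat 0 (\<lambda>n. a n ^ p) n"
    by (cases n) (simp_all add: witt_map_def y_def x_def witt_lift_def mpoly_eval_power)
  ultimately show "(witt_add p a ^^ p) (\<lambda>_. 0) n = case_nat 0 (\<lambda>n. a n ^ p) n"
    by (simp only: fold_map)
qed

end

text \<open>The prime is determined by the coefficient ring as its characteristic, which makes Witt vectors a type with ring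
  operations.\<close>

typedef 'k witt = "UNIV :: (nat \<Rightarrow> 'k) set"
  morphisms witt_comp Witt
  by simp

lemma witt_comp_Witt [simp]: "witt_comp (Witt a) = a"
  by (simp add: Witt_inverse)

lemma Witt_comp [simp]: "Witt (witt_comp w) = w"
  by (rule witt_comp_inverse)

lemma witt_eq_iff: "v = w \<longleftrightarrow> witt_comp v = witt_comp w"
  by (simp add: witt_comp_inject)

instantiation witt :: (comm_ring_prime_char) comm_ring_1
begin

definition "0 = Witt (\<lambda>_. 0 :: 'a)"
definition "1 = Witt (teichmuller (1 :: 'a))"
definition "v + w = Witt (witt_add CHAR('a) (witt_comp v) (witt_comp w))" for v w :: "'a witt"
definition "v * w = Witt (witt_mult CHAR('a) (witt_comp v) (witt_comp w))" for v w :: "'a witt"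
definition "- v = Witt (witt_neg CHAR('a) (witt_comp v))" for v :: "'a witt"
definition "v - w = v + - w" for v w :: "'a witt"

instance
proof
  have p: "prime CHAR('a)"
    by simp
  fix a b c :: "'a witt"
  note defs = zero_witt_def one_witt_def plus_witt_def times_witt_def uminus_witt_def witt_comp_Witt Witt_comp
  show "a + b + c = a + (b + c)"
    by (simp only: defs witt_add_assoc[OF p])
  show "a + b = b + a"
    unfolding plus_witt_def by (subst witt_add_commute[OF p]) (rule refl)
  show "0 + a = a"
    by (simp only: defs witt_add_0[OF p])
  show "- a + a = 0"
    by (simp only: defs witt_add_neg[OF p])
  show "a * b * c = a * (b * c)"
    by (simp only: defs witt_mult_assoc[OF p])
  show "a * b = b * a"
    unfolding times_witt_def by (subst witt_mult_commute[OF p]) (rule refl)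
  show "1 * a = a"
    by (simp only: defs witt_mult_1[OF p])
  show "(a + b) * c = a * c + b * c"
    by (simp only: defs witt_distrib[OF p])
  show "a - b = a + - b"
    by (rule minus_witt_def)
  show "(0 :: 'a witt) \<noteq> 1"
    by (auto simp: zero_witt_def one_witt_def witt_eq_iff fun_eq_iff teichmuller_def intro: exI[of _ 0])
qed

end

lemma witt_comp_0 [simp]: "witt_comp 0 = (\<lambda>_. 0)"
  by (simp add: zero_witt_def)

lemma witt_comp_1: "witt_comp 1 = teichmuller 1"
  by (simp add: one_witt_def)

lemma witt_comp_add: "witt_comp (v + w) = witt_add CHAR('a) (witt_comp v) (witt_comp w)" for v w :: "'a::comm_ring_prime_char witt"
  by (simp add: plus_witt_def)

lemma witt_comp_mult: "witt_comp (v * w) = witt_mult CHAR('a) (witt_comp v) (witt_comp w)" for v w :: "'a::comm_ring_prime_char witt"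
  by (simp add: times_witt_def)

lemma witt_comp_of_nat_mult:
  "witt_comp (of_nat n * w) = (witt_add CHAR('a) (witt_comp w) ^^ n) (\<lambda>_. 0)" for w :: "'a::comm_ring_prime_char witt"
  by (induction n) (simp_all add: distrib_right witt_comp_add)

lemma witt_comp_p_mult:
  "witt_comp (of_nat CHAR('a) * w) = case_nat 0 (\<lambda>n. witt_comp w n ^ CHAR('a))" for w :: "'a::comm_ring_prime_char witt"
  unfolding witt_comp_of_nat_mult by (rule witt_p_fold_add) simp_all

text \<open>Every element has a \<open>p\<close>-th root, so that a shifted vector can be divided by \<open>p\<close>.\<close>

lemma witt_p_dvd_iff:
  fixes w :: "'a::{alg_closed_field, field_prime_char} witt"
  shows "of_nat CHAR('a) dvd w \<longleftrightarrow> witt_comp w 0 = 0"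
proof
  assume "of_nat CHAR('a) dvd w"
  then obtain v where "w = of_nat CHAR('a) * v"
    by (rule dvdE)
  then show "witt_comp w 0 = 0"
    by (simp add: witt_comp_p_mult)
next
  assume w: "witt_comp w 0 = 0"
  have "\<exists>b. b ^ CHAR('a) = a" for a :: 'a
    by (rule nth_root_exists) simp
  then obtain root where root: "\<And>a::'a. root a ^ CHAR('a) = a"
    by metis
  have "w = of_nat CHAR('a) * Witt (\<lambda>n. root (witt_comp w (Suc n)))"
    using w by (auto simp: witt_eq_iff witt_comp_p_mult root fun_eq_iff split: nat.split)
  then show "of_nat CHAR('a) dvd w"
    by (rule dvdI)
qed

lemma witt_comp_0_diff: "witt_comp (v - w) 0 = witt_comp v 0 - witt_comp w 0" for v w :: "'a::comm_ring_prime_char witt"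
proof -
  have "witt_comp ((v - w) + w) 0 = witt_comp (v - w) 0 + witt_comp w 0"
    unfolding plus_witt_def by (simp add: witt_add_comp_0)
  then show ?thesis
    by simp
qed

theorem residue_lift_witt:
  "residue_lift CHAR('a) (\<lambda>a :: 'a::{alg_closed_field, field_prime_char}. Witt (teichmuller a))"
proof
  show "prime CHAR('a)"
    by simp
  show "Witt (teichmuller (a * b)) = Witt (teichmuller a) * Witt (teichmuller b)" for a b :: 'a
    by (simp add: times_witt_def witt_mult_teichmuller)
  show "Witt (teichmuller (0 :: 'a)) = 0" "Witt (teichmuller (1 :: 'a)) = 1"
    by (simp_all add: zero_witt_def one_witt_def teichmuller_def)
  show "w = 0" if "of_nat CHAR('a) * w = 0" for w :: "'a witt"
  proof -
    have "witt_comp w n ^ CHAR('a) = 0" for n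
      using arg_cong[OF that, of "\<lambda>v. witt_comp v (Suc n)"] by (simp add: witt_comp_p_mult zero_witt_def)
    then show ?thesis
      by (auto simp: witt_eq_iff zero_witt_def fun_eq_iff)
  qed
  show "\<exists>a. of_nat CHAR('a) dvd w - Witt (teichmuller a)" for w :: "'a witt"
    by (rule exI[of _ "witt_comp w 0"]) (simp add: witt_p_dvd_iff witt_comp_0_diff teichmuller_def)
  show "a = b" if "of_nat CHAR('a) dvd Witt (teichmuller a) - Witt (teichmuller b)" for a b :: 'a
    using that by (simp add: witt_p_dvd_iff witt_comp_0_diff teichmuller_def)
qed

section \<open>Transport of ring structures along surjections\<close>

text \<open>Carries the ring structure of a type over to a ring given by a carrier and operations, along a surjection that
  respects the operations. It is applied to Witt vectors, to Hahn series and to the quotient field.\<close>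

locale surj_ring_rep =
  fixes R :: "('b, 'm) ring_scheme" (structure) and \<phi> :: "'a::comm_ring_1 \<Rightarrow> 'b"
  assumes rep_carrier: "carrier R = range \<phi>"
    and rep_add: "\<phi> x \<oplus> \<phi> y = \<phi> (x + y)"
    and rep_mult: "\<phi> x \<otimes> \<phi> y = \<phi> (x * y)"
    and rep_zero: "\<zero> = \<phi> 0"
    and rep_one: "\<one> = \<phi> 1"
begin

lemma cring: "cring R"
proof (rule cringI)
  show "abelian_group R"
  proof (rule abelian_groupI)
    fix x assume "x \<in> carrier R"
    then obtain a where "x = \<phi> a"
      by (auto simp: rep_carrier)
    then show "\<exists>y\<in>carrier R. y \<oplus> x = \<zero>"
      by (intro bexI[of _ "\<phi> (- a)"]) (simp_all add: rep_carrier rep_add rep_zero)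
  qed (auto simp: rep_carrier rep_add rep_zero algebra_simps)
  show "comm_monoid R"
    by (rule comm_monoidI) (auto simp: rep_carrier rep_mult rep_one algebra_simps)
qed (auto simp: rep_carrier rep_add rep_mult algebra_simps)

lemma a_inv: "\<ominus> \<phi> x = \<phi> (- x)"
proof -
  interpret cring R
    by (rule cring)
  show ?thesis
    by (rule minus_equality) (simp_all add: rep_carrier rep_add rep_zero)
qed

lemma a_minus: "\<phi> x \<ominus> \<phi> y = \<phi> (x - y)"
  by (simp add: a_minus_def a_inv rep_add)

lemma finsum: "finsum R (\<lambda>i. \<phi> (f i)) A = \<phi> (sum f A)"
proof -
  interpret cring R
    by (rule cring)
  show ?thesis
  proof (induction A rule: infinite_finite_induct)
    case (infinite A)
    then show ?case
      by (simp add: finsum_def finprod_def rep_zero)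
  next
    case (insert a A)
    then show ?case
      by (subst finsum_insert) (auto simp: rep_carrier rep_add)
  qed (simp add: rep_zero)
qed

lemma nat_pow: "\<phi> x [^] (n :: nat) = \<phi> (x ^ n)"
  by (induction n) (simp_all add: rep_one rep_mult mult.commute)

lemma add_pow: "add_pow R (n :: nat) (\<phi> x) = \<phi> (of_nat n * x)"
proof -
  interpret cring R
    by (rule cring)
  show ?thesis
    by (induction n) (simp_all add: rep_zero rep_add rep_carrier algebra_simps)
qed

end

lemma (in surj_ring_rep) field:
  assumes "\<phi> 1 \<noteq> \<phi> 0" and "\<And>x. \<phi> x \<noteq> \<phi> 0 \<Longrightarrow> \<exists>y. \<phi> (x * y) = \<phi> 1"
  shows "field R"
proof -
  interpret cring R
    by (rule cring)
  show ?thesis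
  proof (rule cring_fieldI2)
    show "\<zero> \<noteq> \<one>"
      using assms(1) by (simp add: rep_zero rep_one)
    fix a assume "a \<in> carrier R" "a \<noteq> \<zero>"
    then show "\<exists>b\<in>carrier R. a \<otimes> b = \<one>"
      using assms(2) by (auto simp: rep_carrier rep_zero rep_one rep_mult)
  qed
qed

section \<open>Elements algebraic over algebraic elements\<close>

text \<open>The coefficients generate a finite extension of \<open>K\<close>, over which \<open>x\<close> is algebraic; by the tower law \<open>x\<close>
  lies in a finite extension of \<open>K\<close>.\<close>

lemma (in field) algebraic_if_root_of_algebraic_poly:
  assumes K: "subfield K R" and x: "x \<in> carrier R"
    and ps: "set ps \<subseteq> carrier R" "\<And>a. a \<in> set ps \<Longrightarrow> (algebraic over K) a"
    and nz: "ps \<noteq> []" "hd ps \<noteq> \<zero>" and root: "eval ps x = \<zero>"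
  shows "(algebraic over K) x"
proof -
  define F where "F = finite_extension K ps"
  have F: "subfield F R"
    unfolding F_def by (rule finite_extension_is_subfield[OF K ps])
  have "set ps \<subseteq> F"
    unfolding F_def by (rule finite_extension_mem[OF subfieldE(1)[OF K] ps(1)])
  then have "ps \<in> carrier (F[X])"
    using nz unfolding univ_poly_def polynomial_def by simp
  then have "(algebraic over F) x"
    using nz(1) root by (rule algebraicI)
  then have "finite_dimension F (simple_extension F x)"
    using finite_dimension_simple_extension[OF F x] by simp
  moreover have "finite_dimension K F"
    unfolding F_def by (rule finite_extension_finite_dimension(1)[OF K ps])
  ultimately have "finite_dimension K (simple_extension F x)"
    by (rule telescopic_base_dim(1)[OF K F, rotated])
  then show ?thesis
    using simple_extension_is_subring[OF subfieldE(1)[OF F] x] simple_extension_mem[OF subfieldE(1)[OF F] x]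
    by (intro finite_dimension_imp_algebraic[OF K])
qed

lemma (in field) algebraic_if_root_of_trinomial:
  assumes K: "subfield K R" and x: "x \<in> carrier R"
    and a: "a \<in> carrier R" "(algebraic over K) a" and b: "b \<in> carrier R" "(algebraic over K) b"
    and root: "x [^] Suc (Suc n) \<oplus> (a \<otimes> x \<oplus> b) = \<zero>"
  shows "(algebraic over K) x"
proof (rule algebraic_if_root_of_algebraic_poly[OF K x])
  let ?ps = "\<one> # replicate n \<zero> @ [a, b]"
  show "set ?ps \<subseteq> carrier R" "?ps \<noteq> []" "hd ?ps \<noteq> \<zero>"
    using a b by auto
  have "(algebraic over K) \<zero>" "(algebraic over K) \<one>"
    using algebraic_self[OF subfieldE(1)[OF K]] subringE(2,3)[OF subfieldE(1)[OF K]] by auto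
  then show "(algebraic over K) c" if "c \<in> set ?ps" for c
    using that a b by (auto split: if_splits)
  have "eval (replicate n \<zero> @ [a, b]) x = a \<otimes> x \<oplus> b"
    using x a b by (induction n) simp_all
  then show "eval ?ps x = \<zero>"
    using root x by simp
qed

section \<open>The field of \<open>p\<close>-adic Hahn series\<close>

context
  fixes R :: "'k::{alg_closed_field, field_prime_char} witt_vec ring"
  defines "R \<equiv> witt_ring CHAR('k)"
begin

lemma witt_ring_rep: "surj_ring_rep R (witt_comp :: 'k witt \<Rightarrow> _)"
proof
  show "carrier R = range (witt_comp :: 'k witt \<Rightarrow> _)"
    by (auto simp: R_def witt_ring_def) (metis witt_comp_Witt rangeI)
qed (simp_all add: R_def witt_ring_def witt_comp_add witt_comp_mult witt_comp_1
    fun_eq_iff witt_add_def witt_mult_def)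

interpretation R: surj_ring_rep R "witt_comp :: 'k witt \<Rightarrow> _"
  by (rule witt_ring_rep)

interpretation residue_lift "CHAR('k)" "\<lambda>a :: 'k. Witt (teichmuller a)"
  by (rule residue_lift_witt)

text \<open>Translates a Hahn series over the type of Witt vectors into a family of component sequences.\<close>

definition hahn_comp :: "'k witt hahn \<Rightarrow> rat \<Rightarrow> 'k witt_vec" where
  "hahn_comp f q = witt_comp (hcoeff f q)"

lemma hahn_support_comp: "hahn_support R (hahn_comp f) = {q. hcoeff f q \<noteq> 0}"
  by (auto simp: hahn_support_def hahn_comp_def R.rep_zero witt_eq_iff)

lemma hahn_comp_Abs: "wfp_on {q. f q \<noteq> 0} (<) \<Longrightarrow> hahn_comp (Abs_hahn f) = (\<lambda>q. witt_comp (f q))"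
  by (simp add: hahn_comp_def[abs_def] hcoeff_Abs)

lemma hahn_comp_inject: "hahn_comp f = hahn_comp g \<Longrightarrow> f = g"
  by (rule hahn_eqI) (simp add: hahn_comp_def fun_eq_iff witt_eq_iff)

lemma hahn_ring_rep: "surj_ring_rep (hahn_ring R) hahn_comp"
proof
  show "carrier (hahn_ring R) = range hahn_comp"
  proof (intro equalityI subsetI)
    fix f assume "f \<in> carrier (hahn_ring R)"
    then have wf: "wfp_on {q. f q \<noteq> \<zero>\<^bsub>R\<^esub>} (<)"
      by (simp add: hahn_ring_def hahn_support_def)
    have "f q \<noteq> \<zero>\<^bsub>R\<^esub> \<longleftrightarrow> Witt (f q) \<noteq> 0" for q
      by (simp add: R.rep_zero witt_eq_iff)
    then have "wfp_on {q. Witt (f q) \<noteq> 0} (<)"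
      using wf by simp
    then have "f = hahn_comp (Abs_hahn (\<lambda>q. Witt (f q)))"
      by (simp add: hahn_comp_Abs)
    then show "f \<in> range hahn_comp"
      by (rule range_eqI)
  next
    fix f assume "f \<in> range hahn_comp"
    then obtain g where "f = hahn_comp g"
      by blast
    then show "f \<in> carrier (hahn_ring R)"
      using wfp_on_hcoeff[of g] by (auto simp: hahn_ring_def hahn_support_comp R.rep_carrier hahn_comp_def)
  qed
  show "hahn_comp f \<oplus>\<^bsub>hahn_ring R\<^esub> hahn_comp g = hahn_comp (f + g)" for f g
    by (simp add: hahn_ring_def hahn_comp_def[abs_def] R.rep_add plus_hahn.rep_eq)
  show "hahn_comp f \<otimes>\<^bsub>hahn_ring R\<^esub> hahn_comp g = hahn_comp (f * g)" for f g
  proof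
    fix q
    have "(hahn_comp f \<otimes>\<^bsub>hahn_ring R\<^esub> hahn_comp g) q
        = (\<Oplus>\<^bsub>R\<^esub>a\<in>{a. hcoeff f a \<noteq> 0 \<and> hcoeff g (q - a) \<noteq> 0}. witt_comp (hcoeff f a * hcoeff g (q - a)))"
      by (simp add: hahn_ring_def hahn_support_comp) (simp add: hahn_comp_def R.rep_mult)
    then show "(hahn_comp f \<otimes>\<^bsub>hahn_ring R\<^esub> hahn_comp g) q = hahn_comp (f * g) q"
      by (simp add: R.finsum hahn_comp_def times_hahn.rep_eq)
  qed
  show "\<zero>\<^bsub>hahn_ring R\<^esub> = hahn_comp 0"
    by (simp add: hahn_ring_def hahn_comp_def[abs_def] R.rep_zero zero_hahn.rep_eq)
  show "\<one>\<^bsub>hahn_ring R\<^esub> = hahn_comp 1"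
    by (auto simp: hahn_ring_def hahn_comp_def R.rep_one R.rep_zero one_hahn.rep_eq)
qed

interpretation S: surj_ring_rep "hahn_ring R" hahn_comp
  by (rule hahn_ring_rep)

lemma padic_sum_zero_iff:
  "padic_sum_zero R CHAR('k) (\<lambda>n. witt_comp (c n)) \<longleftrightarrow> padic_sum_null c"
proof -
  have "(\<exists>w\<in>carrier R. witt_comp v = add_pow R (CHAR('k) ^ N) w) \<longleftrightarrow> of_nat CHAR('k) ^ N dvd v" for N v
    by (auto simp: R.rep_carrier R.add_pow witt_eq_iff[symmetric] dvd_def)
  then show ?thesis
    by (simp add: padic_sum_zero_def padic_sum_null_def padic_null_def R.add_pow R.finsum R.rep_zero
        witt_comp_inject del: witt_comp_0)
qed

text \<open>This identifies the field of \<open>p\<close>-adic Hahn series with the quotient by \<open>p - t\<close>.\<close>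

lemma hahn_null_ideal_eq: "hahn_null_ideal CHAR('k) = hahn_comp ` {f. p_minus_t CHAR('k) dvd f}"
proof -
  have "hahn_comp f \<in> hahn_null_ideal CHAR('k) \<longleftrightarrow> p_minus_t CHAR('k) dvd f" for f
    using padic_sum_null_of_dvd[of f] dvd_of_padic_sum_null[of f]
    by (auto simp: hahn_null_ideal_def R_def[symmetric] S.rep_carrier hahn_comp_def[of f] padic_sum_zero_iff)
  moreover have "hahn_null_ideal CHAR('k) \<subseteq> range hahn_comp"
    by (auto simp: hahn_null_ideal_def R_def[symmetric] S.rep_carrier)
  ultimately show ?thesis
    by auto
qed

lemma hahn_null_ideal_ideal: "ideal (hahn_null_ideal CHAR('k)) (hahn_ring R)"
proof (rule idealI)
  interpret cring "hahn_ring R"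
    by (rule S.cring)
  show "ring (hahn_ring R)"
    by (rule ring_axioms)
  show "subgroup (hahn_null_ideal CHAR('k)) (add_monoid (hahn_ring R))"
  proof (rule add.subgroupI)
    show "hahn_null_ideal CHAR('k) \<subseteq> carrier (hahn_ring R)"
      by (auto simp: hahn_null_ideal_eq S.rep_carrier)
    show "hahn_null_ideal CHAR('k) \<noteq> ({} :: (rat \<Rightarrow> 'k witt_vec) set)"
      using imageI[of 0 "{f. p_minus_t CHAR('k) dvd f}" hahn_comp] by (auto simp: hahn_null_ideal_eq)
  qed (auto simp: hahn_null_ideal_eq S.rep_add S.a_inv a_inv_def[symmetric])
qed (auto simp: hahn_null_ideal_eq S.rep_carrier S.rep_mult)

definition padic_of_hahn :: "'k witt hahn \<Rightarrow> 'k padic_hahn" where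
  "padic_of_hahn f = to_padic_hahn CHAR('k) (hahn_comp f)"

lemma padic_of_hahn_eq_iff: "padic_of_hahn f = padic_of_hahn g \<longleftrightarrow> p_minus_t CHAR('k) dvd f - g"
proof -
  interpret I: ideal "hahn_null_ideal CHAR('k)" "hahn_ring R"
    by (rule hahn_null_ideal_ideal)
  have "padic_of_hahn f = padic_of_hahn g \<longleftrightarrow> hahn_comp f \<ominus>\<^bsub>hahn_ring R\<^esub> hahn_comp g \<in> hahn_null_ideal CHAR('k)"
    unfolding padic_of_hahn_def to_padic_hahn_def R_def[symmetric]
    by (subst I.quotient_eq_iff_same_a_r_cos[OF hahn_null_ideal_ideal]) (auto simp: S.rep_carrier)
  also have "\<dots> \<longleftrightarrow> p_minus_t CHAR('k) dvd f - g"
    by (auto simp: S.a_minus hahn_null_ideal_eq dest: hahn_comp_inject)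
  finally show ?thesis .
qed

lemma padic_hahn_rep: "surj_ring_rep (padic_hahn_field CHAR('k)) padic_of_hahn"
proof -
  interpret I: ideal "hahn_null_ideal CHAR('k)" "hahn_ring R"
    by (rule hahn_null_ideal_ideal)
  have hom: "padic_of_hahn f = (hahn_null_ideal CHAR('k) +>\<^bsub>hahn_ring R\<^esub> hahn_comp f)" for f
    by (simp add: padic_of_hahn_def to_padic_hahn_def R_def)
  have L: "padic_hahn_field CHAR('k) = hahn_ring R Quot hahn_null_ideal CHAR('k)"
    by (simp add: padic_hahn_field_def R_def)
  note rh = I.rcos_ring_hom
  have mem: "hahn_comp f \<in> carrier (hahn_ring R)" for f
    by (simp add: S.rep_carrier)
  show ?thesis
  proof
    show "carrier (padic_hahn_field CHAR('k)) = range padic_of_hahn"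
      unfolding L by (auto simp: FactRing_def A_RCOSETS_def' S.rep_carrier hom)
    show "padic_of_hahn f \<oplus>\<^bsub>padic_hahn_field CHAR('k)\<^esub> padic_of_hahn g = padic_of_hahn (f + g)" for f g
      unfolding L hom using ring_hom_add[OF rh mem[of f] mem[of g]] by (simp add: S.rep_add)
    show "padic_of_hahn f \<otimes>\<^bsub>padic_hahn_field CHAR('k)\<^esub> padic_of_hahn g = padic_of_hahn (f * g)" for f g
      unfolding L hom using ring_hom_mult[OF rh mem[of f] mem[of g]] by (simp add: S.rep_mult)
    show "\<one>\<^bsub>padic_hahn_field CHAR('k)\<^esub> = padic_of_hahn 1"
      unfolding L hom using ring_hom_one[OF rh] by (simp add: S.rep_one)
    show "\<zero>\<^bsub>padic_hahn_field CHAR('k)\<^esub> = padic_of_hahn 0"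
    proof -
      have "hahn_comp 0 \<in> hahn_null_ideal CHAR('k)"
        by (auto simp: hahn_null_ideal_eq)
      from I.a_rcos_zero[OF hahn_null_ideal_ideal this] show ?thesis
        unfolding L hom by (simp add: FactRing_def)
    qed
  qed
qed

interpretation L: surj_ring_rep "padic_hahn_field CHAR('k)" padic_of_hahn
  by (rule padic_hahn_rep)

lemma field_padic_hahn: "field (padic_hahn_field CHAR('k) :: 'k padic_hahn ring)"
proof (rule L.field)
  show "padic_of_hahn 1 \<noteq> padic_of_hahn 0"
    using not_p_minus_t_dvd_1 by (simp add: padic_of_hahn_eq_iff)
  show "\<exists>g. padic_of_hahn (f * g) = padic_of_hahn 1" if "padic_of_hahn f \<noteq> padic_of_hahn 0" for f
    using that ex_inverse_mod_p_minus_t[of f] by (simp add: padic_of_hahn_eq_iff)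
qed

text \<open>The standard expansion of the class of \<open>f\<close> has its support above the lower bound \<open>c\<close> of the support of
  \<open>f\<close>, and the least exponent occurring in it is attained.\<close>

lemma padic_hahn_val_ge:
  assumes f: "hge c f" and nz: "padic_of_hahn f \<noteq> padic_of_hahn 0"
  shows "c \<le> padic_hahn_val CHAR('k) (padic_of_hahn f)"
proof -
  have std: "padic_of_hahn g = to_padic_hahn CHAR('k) (\<lambda>q. teichmuller (r q))
      \<longleftrightarrow> p_minus_t CHAR('k) dvd g - Abs_hahn (\<lambda>q. Witt (teichmuller (r q)))"
    if "wfp_on {q. r q \<noteq> 0} (<)" for r g
    unfolding padic_of_hahn_eq_iff[symmetric]
    by (simp add: padic_of_hahn_def[of "Abs_hahn _"] hahn_comp_Abs[OF wfp_on_T[OF that]])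
  obtain r where r: "wfp_on {q. r q \<noteq> 0} (<)" "\<And>q. q < c \<Longrightarrow> r q = 0"
    "p_minus_t CHAR('k) dvd f - Abs_hahn (\<lambda>q. Witt (teichmuller (r q)))"
    using ex_standard_expansion[OF f] by blast
  have "standard_expansion CHAR('k) (padic_of_hahn f) = r"
    unfolding standard_expansion_def
  proof (rule the_equality)
    show "wfp_on {q. r q \<noteq> 0} (<) \<and> padic_of_hahn f = to_padic_hahn CHAR('k) (\<lambda>q. teichmuller (r q))"
      using r by (simp add: std)
    fix s assume s: "wfp_on {q. s q \<noteq> 0} (<) \<and> padic_of_hahn f = to_padic_hahn CHAR('k) (\<lambda>q. teichmuller (s q))"
    then have "p_minus_t CHAR('k) dvd f - Abs_hahn (\<lambda>q. Witt (teichmuller (s q)))"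
      using std[of s f] by blast
    from dvd_diff[OF r(3) this] have "p_minus_t CHAR('k) dvd
        Abs_hahn (\<lambda>q. Witt (teichmuller (s q))) - Abs_hahn (\<lambda>q. Witt (teichmuller (r q)))"
      by simp
    then show "s = r"
      using s r(1) by (intro standard_expansion_unique) auto
  qed
  moreover have "{q. r q \<noteq> 0} \<noteq> {}"
  proof
    assume "{q. r q \<noteq> 0} = {}"
    then have "r q = 0" for q
      by auto
    then have "Abs_hahn (\<lambda>q. Witt (teichmuller (r q))) = 0"
      by (intro hahn_eqI, unfold hcoeff_Abs[OF wfp_on_T[OF r(1)]] zero_hahn.rep_eq) simp
    then show False
      using r(3) nz by (simp add: padic_of_hahn_eq_iff)
  qed
  then obtain q where q: "r q \<noteq> 0" "\<And>s. r s \<noteq> 0 \<Longrightarrow> q \<le> s"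
    using wfp_on_less_ex_least[OF r(1), of "{q. r q \<noteq> 0}"] by auto
  then have "(LEAST q. r q \<noteq> 0) = q"
    by (intro Least_equality)
  ultimately have "padic_hahn_val CHAR('k) (padic_of_hahn f) = q"
    by (simp add: padic_hahn_val_def)
  then show ?thesis
    using r(2)[of q] q(1) by (meson not_less)
qed

text \<open>Algebraicity over the prime field. As the prime field is contained in the field of \<open>p\<close>-adic numbers, this is
  enough for the algebraic approximations, and it keeps the coefficients of all polynomials elementary.\<close>

definition algebraic_hahn :: "'k witt hahn \<Rightarrow> bool" where
  "algebraic_hahn f \<longleftrightarrow> (ring.algebraic (padic_hahn_field CHAR('k)) over
     generate_field (padic_hahn_field CHAR('k)) {}) (padic_of_hahn f)"

text \<open>The algebraic elements form a subfield. The class of \<open>t\<close> is \<open>p\<close>, which lies in the prime field, so powers of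
  \<open>t\<close> with rational exponents are roots of elements of the prime field.\<close>

lemma algebraic_residues_padic:
  "algebraic_residues CHAR('k) (\<lambda>a :: 'k. Witt (teichmuller a)) algebraic_hahn"
proof -
  interpret F: field "padic_hahn_field CHAR('k) :: 'k padic_hahn ring"
    by (rule field_padic_hahn)
  let ?L = "padic_hahn_field CHAR('k) :: 'k padic_hahn ring"
  let ?K = "generate_field ?L {}"
  have K: "subfield ?K ?L"
    by (rule F.generate_field_is_subfield) simp
  have mem: "padic_of_hahn f \<in> carrier ?L" for f
    by (simp add: L.rep_carrier)
  have A: "subfield {x \<in> carrier ?L. (F.algebraic over ?K) x} ?L"
    by (rule F.subfield_of_algebraics[OF K])
  have Alg: "algebraic_hahn f \<longleftrightarrow> padic_of_hahn f \<in> {x \<in> carrier ?L. (F.algebraic over ?K) x}" for f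
    by (simp add: algebraic_hahn_def mem)
  note subring = subfieldE(1)[OF A]
  have add: "algebraic_hahn (f + g)" if "algebraic_hahn f" "algebraic_hahn g" for f g
    using subringE(7)[OF subring] that unfolding Alg L.rep_add[symmetric] by blast
  have mult: "algebraic_hahn (f * g)" if "algebraic_hahn f" "algebraic_hahn g" for f g
    using subringE(6)[OF subring] that unfolding Alg L.rep_mult[symmetric] by blast
  have uminus: "algebraic_hahn (- f)" if "algebraic_hahn f" for f
    using subringE(5)[OF subring] that unfolding Alg L.a_inv[symmetric] by blast
  have one: "algebraic_hahn 1"
    using subringE(3)[OF subring] unfolding Alg L.rep_one[symmetric] .
  have zero: "algebraic_hahn 0"
    using subringE(2)[OF subring] unfolding Alg L.rep_zero[symmetric] .
  have of_nat: "algebraic_hahn (of_nat n)" for n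
    by (induction n) (auto intro: zero one add)
  have power: "algebraic_hahn (f ^ n)" if "algebraic_hahn f" for f n
    by (induction n) (auto intro: one mult that)
  have cong: "algebraic_hahn f" if "algebraic_hahn g" "p_minus_t CHAR('k) dvd f - g" for f g
    using that by (simp add: algebraic_hahn_def padic_of_hahn_eq_iff[symmetric])
  have root: "algebraic_hahn x"
    if "algebraic_hahn a" "algebraic_hahn b" "p_minus_t CHAR('k) dvd x ^ Suc (Suc n) + (a * x + b)" for a b x n
  proof -
    have "(F.algebraic over ?K) (padic_of_hahn x)"
    proof (rule F.algebraic_if_root_of_trinomial[OF K mem mem _ mem])
      show "(F.algebraic over ?K) (padic_of_hahn a)" "(F.algebraic over ?K) (padic_of_hahn b)"
        using that(1,2) by (simp_all add: algebraic_hahn_def)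
      show "padic_of_hahn x [^]\<^bsub>?L\<^esub> Suc (Suc n) \<oplus>\<^bsub>?L\<^esub>
          (padic_of_hahn a \<otimes>\<^bsub>?L\<^esub> padic_of_hahn x \<oplus>\<^bsub>?L\<^esub> padic_of_hahn b) = \<zero>\<^bsub>?L\<^esub>"
        using that(3) unfolding L.nat_pow L.rep_mult L.rep_add L.rep_zero padic_of_hahn_eq_iff by simp
    qed
    then show ?thesis
      by (simp add: algebraic_hahn_def)
  qed
  have inverse: "algebraic_hahn g" if "algebraic_hahn f" "f * g = 1" for f g
  proof -
    have "padic_of_hahn f \<otimes>\<^bsub>?L\<^esub> padic_of_hahn g = \<one>\<^bsub>?L\<^esub>"
      by (simp add: L.rep_mult L.rep_one that(2))
    then have inv: "inv\<^bsub>?L\<^esub> (padic_of_hahn f) = padic_of_hahn g"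
      using mem by (intro F.comm_inv_char)
    have "padic_of_hahn f \<noteq> \<zero>\<^bsub>?L\<^esub>"
    proof
      assume "padic_of_hahn f = \<zero>\<^bsub>?L\<^esub>"
      then have "\<zero>\<^bsub>?L\<^esub> = \<one>\<^bsub>?L\<^esub>"
        using \<open>padic_of_hahn f \<otimes>\<^bsub>?L\<^esub> padic_of_hahn g = \<one>\<^bsub>?L\<^esub>\<close> mem[of g] by simp
      then show False
        by simp
    qed
    then have "inv\<^bsub>?L\<^esub> (padic_of_hahn f) \<in> {x \<in> carrier ?L. (F.algebraic over ?K) x}"
      using F.subfield_m_inv(1)[OF A, of "padic_of_hahn f"] that(1) unfolding Alg by blast
    then show ?thesis
      unfolding Alg inv .
  qed
  have t: "algebraic_hahn (hmonom 1 1)"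
    by (rule cong[OF of_nat[of "CHAR('k)"]])
      (rule dvdI[of _ _ "- 1"], simp add: p_minus_t_def)
  have t_nat: "algebraic_hahn (hmonom (of_nat n) 1)" for n
    using power[OF t, of n] by (simp add: hmonom_power)
  have t_int: "algebraic_hahn (hmonom (of_int z) 1)" for z
  proof (cases "z \<ge> 0")
    case True
    then show ?thesis
      using t_nat[of "nat z"] by simp
  next
    case False
    then show ?thesis
    proof -
      have "algebraic_hahn (hmonom (of_int (- z)) 1)"
        using False t_nat[of "nat (- z)"] by simp
      then show ?thesis
        by (rule inverse) (simp add: hmonom_mult hmonom_0_1)
    qed
  qed
  have t_rat: "algebraic_hahn (hmonom q 1)" for q
  proof -
    obtain a b where q: "q = of_int a / of_int b" "b > 0"
      by (metis quotient_of_denom_pos' quotient_of_div surj_pair quotient_of_denom_pos)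
    \<comment> \<open>The denominator is doubled so that the exponent of the polynomial is at least 2 also for integral \<open>q\<close>.\<close>
    define n where "n = nat (2 * b) - 2"
    have n: "int (Suc (Suc n)) = 2 * b"
      using q(2) by (simp add: n_def)
    have "of_nat (Suc (Suc n)) * q = of_int (int (Suc (Suc n))) * q"
      by simp
    also have "\<dots> = of_int (2 * a)"
      unfolding n using q by simp
    finally have "hmonom q 1 ^ Suc (Suc n) = (hmonom (of_int (2 * a)) 1 :: 'k witt hahn)"
      by (simp only: hmonom_power power_one)
    then show ?thesis
      by (intro root[OF zero uminus[OF t_int[of "2 * a"]], of _ n]) simp
  qed
  have artin_schreier: "algebraic_hahn x"
    if "algebraic_hahn b" "p_minus_t CHAR('k) dvd x ^ CHAR('k) - x - b" for b x
  proof -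
    have "CHAR('k) \<ge> 2"
      using p_prime by (rule prime_ge_2_nat)
    then obtain n where n: "CHAR('k) = Suc (Suc n)"
      by (metis add_2_eq_Suc le_Suc_ex)
    have "x ^ Suc (Suc n) + (- 1 * x + - b) = x ^ CHAR('k) - x - b"
      by (simp add: n)
    then show ?thesis
      using that(2) by (intro root[OF uminus[OF one] uminus[OF that(1)], of _ n]) (simp only:)
  qed
  show ?thesis
    by unfold_locales (fact add mult uminus t_rat artin_schreier)+
qed

text \<open>An approximation of the series within valuation \<open>c + 1\<close> gives the strict bound required by the definition of
  the closure.\<close>

theorem frakA_in_padic_complex: "(frakA CHAR('k) :: 'k padic_hahn) \<in> padic_complex CHAR('k)"
proof -
  interpret algebraic_residues "CHAR('k)" "\<lambda>a :: 'k. Witt (teichmuller a)" algebraic_hahn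
    by (rule algebraic_residues_padic)
  interpret F: field "padic_hahn_field CHAR('k) :: 'k padic_hahn ring"
    by (rule field_padic_hahn)
  let ?L = "padic_hahn_field CHAR('k) :: 'k padic_hahn ring"
  have p2: "CHAR('k) \<ge> 2"
    using p_prime by (rule prime_ge_2_nat)
  have comp: "hahn_comp (root_sum CHAR('k)) = (\<lambda>q. if \<exists>k\<ge>1. q = - (1 / of_nat CHAR('k) ^ k) then \<one>\<^bsub>R\<^esub> else \<zero>\<^bsub>R\<^esub>)"
    by (auto simp: hahn_comp_def fun_eq_iff hcoeff_root_sum[OF p2] R.rep_one R.rep_zero)
  have A: "frakA CHAR('k) = padic_of_hahn (root_sum CHAR('k))"
    unfolding frakA_def padic_of_hahn_def comp unfolding R_def ..
  have prime_field: "generate_field ?L {} \<subseteq> padic_numbers CHAR('k)"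
    using F.generate_field_in_carrier[of "{}"]
    by (auto simp: padic_numbers_def padic_hahn_closure_def)
  show ?thesis
    unfolding padic_complex_def padic_hahn_closure_def
  proof (intro CollectI conjI allI)
    show "frakA CHAR('k) \<in> carrier ?L"
      by (simp add: A L.rep_carrier)
    fix c
    obtain g h where gh: "algebraic_hahn g" "hge (c + 1) h" "p_minus_t CHAR('k) dvd root_sum CHAR('k) - (g + h)"
      using near_root_sum[of "c + 1"] unfolding near_def by blast
    have "(F.algebraic over padic_numbers CHAR('k)) (padic_of_hahn g)"
      using F.algebraic_mono[OF prime_field] gh(1) by (simp add: algebraic_hahn_def)
    then have "padic_of_hahn g \<in> padic_algebraic_closure CHAR('k)"
      by (simp add: padic_algebraic_closure_def L.rep_carrier)
    moreover have diff: "frakA CHAR('k) \<ominus>\<^bsub>?L\<^esub> padic_of_hahn g = padic_of_hahn h"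
      using gh(3) by (simp add: A L.a_minus padic_of_hahn_eq_iff algebra_simps)
    have "frakA CHAR('k) = padic_of_hahn g \<or>
        c < padic_hahn_val CHAR('k) (frakA CHAR('k) \<ominus>\<^bsub>?L\<^esub> padic_of_hahn g)"
    proof (cases "padic_of_hahn h = padic_of_hahn 0")
      case True
      then have "p_minus_t CHAR('k) dvd (root_sum CHAR('k) - (g + h)) + (h - 0)"
        using gh(3) by (intro dvd_add) (simp_all add: padic_of_hahn_eq_iff)
      then show ?thesis
        by (simp add: A padic_of_hahn_eq_iff)
    next
      case False
      then show ?thesis
        using padic_hahn_val_ge[OF gh(2)] by (simp add: diff)
    qed
    ultimately show "\<exists>y\<in>padic_algebraic_closure CHAR('k). frakA CHAR('k) = y \<or>
        c < padic_hahn_val CHAR('k) (frakA CHAR('k) \<ominus>\<^bsub>?L\<^esub> y)"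
      by blast
  qed
qed

end

instance alg_closure :: (field_prime_char) field_prime_char
  by (rule field_prime_charI') simp

theorem theorem1:
  fixes p :: nat
  assumes "Factorial_Ring.prime p" and "CARD('p::prime_card) = p"
  shows "(frakA p :: 'p mod_ring alg_closure padic_hahn) \<in> padic_complex p"
proof -
  have "CHAR('p mod_ring alg_closure) = p"
    using assms(2) by simp
  then show ?thesis
    using frakA_in_padic_complex[where 'k = "'p mod_ring alg_closure"] by simp
qed

end
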